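(* Let $0<\alpha<1$ and $|\beta|\le 1$, and let $X=\{X_t,t\in R_+\}$ be a real valued Lévy process with characteristic exponent $$\psi(\lambda)=|\lambda|^{\alpha+1}\big(1-i\beta\,\mathrm{sign}(\lambda)\tan((\alpha+1)\pi/2)\big).$$ Let $u_{T_0}(x,y)=E^x(L^y_{T_0})$, where $\{L_t^x\}$ are the local times of $X$ and $T_0$ is the first hitting time of $0$ by $X$, and write $$u_{T_0}(x,y)=R(x,y)+H(x,y),\qquad u_{T_0}(y,x)=R(x,y)-H(x,y).$$ Then $$R(x,y)=C_{\alpha,\beta}\big(|x|^\alpha+|y|^\alpha-|x-y|^\alpha\big)$$ and $$H(x,y)=-\beta\,C_{\alpha,\beta}\big(\mathrm{sign}(x)|x|^\alpha-\mathrm{sign}(y)|y|^\alpha-\mathrm{sign}(x-y)|x-y|^\alpha\big),$$ where $$C_{\alpha,\beta}=\frac{-\sin\big((\alpha+1)\frac\pi2\big)\,\Gamma(-\alpha)}{\pi\big(1+\beta^2\tan^2((\alpha+1)\pi/2)\big)}>0 .$$ Consequently $$u_{T_0}(x,y)=C_{\alpha,\beta}\Big(\big(1-\beta\,\mathrm{sign}(x)\big)|x|^\alpha+\big(1-\beta\,\mathrm{sign}(-y)\big)|y|^\alpha-\big(1-\beta\,\mathrm{sign}(x-y)\big)|x-y|^\alpha\Big).$$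
   Context: The characteristic exponent $\psi$ of $X$ is defined by $E e^{i\lambda X_t}=e^{-t\psi(\lambda)}$, $\lambda\in R$, $t\ge0$ (with $X_0=0$); thus $X$ is a (generally non-symmetric) stable process of index $\alpha+1\in(1,2)$. $E^x$ denotes expectation for the process started at $x$. Local times are normalized in the usual way as densities of the occupation measure of $X$ with respect to Lebesgue measure. $\Gamma(\cdot)$ in the formula for $C_{\alpha,\beta}$ is the Gamma function. $R$ and $H$ are the symmetric and antisymmetric parts, $R(x,y)=\frac12(u_{T_0}(x,y)+u_{T_0}(y,x))$ and $H(x,y)=\frac12(u_{T_0}(x,y)-u_{T_0}(y,x))$. (The permanental process with kernel $u_{T_0}$ is called $\mathrm{FBMQ}^{\alpha,\beta}$.) *)

theory Defs
  imports "HOL-Probability.Probability"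
begin

definition cadlag :: "(real \<Rightarrow> real) \<Rightarrow> bool" where
  "cadlag f \<longleftrightarrow>
     (\<forall>t\<ge>0. (f \<longlongrightarrow> f t) (at_right t)) \<and>
     (\<forall>t>0. \<exists>l. (f \<longlongrightarrow> l) (at_left t))"

text \<open>Time is the half-line of nonnegative reals; the values of \<open>X t\<close> for negative \<open>t\<close> are
  never used.\<close>

definition levy_process :: "'a measure \<Rightarrow> (real \<Rightarrow> 'a \<Rightarrow> real) \<Rightarrow> real \<Rightarrow> bool" where
  "levy_process M X x \<longleftrightarrow>
     prob_space M \<and>
     (\<forall>t\<ge>0. X t \<in> borel_measurable M) \<and>
     (AE \<omega> in M. X 0 \<omega> = x) \<and>
     (\<forall>n ts. mono ts \<and> (0::real) \<le> ts 0 \<longrightarrow>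
        prob_space.indep_vars M (\<lambda>_. borel)
          (\<lambda>i \<omega>. X (ts (Suc i)) \<omega> - X (ts i) \<omega>) {..<n::nat}) \<and>
     (\<forall>s\<ge>0. \<forall>t\<ge>0.
        distr M borel (\<lambda>\<omega>. X (s + t) \<omega> - X s \<omega>) = distr M borel (\<lambda>\<omega>. X t \<omega> - X 0 \<omega>)) \<and>
     (AE \<omega> in M. cadlag (\<lambda>t. X t \<omega>))"

text \<open>The Markov-process setting: one measurable space and one process \<open>X\<close>, with a family of
  laws \<open>P x\<close> under which \<open>X\<close> starts at \<open>x\<close>; \<open>E\<^sup>x\<close> is integration against \<open>P x\<close>.
  The increments have characteristic exponent \<open>\<psi>\<close> under every \<open>P x\<close>, so \<open>X\<close> under \<open>P x\<close>
  has the law of \<open>x + X\<close> under \<open>P 0\<close>.\<close>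

definition levy_family ::
    "(real \<Rightarrow> 'a measure) \<Rightarrow> (real \<Rightarrow> 'a \<Rightarrow> real) \<Rightarrow> (real \<Rightarrow> complex) \<Rightarrow> bool" where
  "levy_family P X \<psi> \<longleftrightarrow>
     (\<forall>x. sets (P x) = sets (P 0)) \<and>
     (\<forall>x. levy_process (P x) X x) \<and>
     (\<forall>x. \<forall>t\<ge>0. \<forall>\<theta>.
        char (distr (P x) borel (\<lambda>\<omega>. X t \<omega> - X 0 \<omega>)) \<theta> = exp (- complex_of_real t * \<psi> \<theta>))"

definition stable_exponent :: "real \<Rightarrow> real \<Rightarrow> real \<Rightarrow> complex" where
  "stable_exponent \<alpha> \<beta> \<theta> =
     complex_of_real (\<bar>\<theta>\<bar> powr (\<alpha> + 1)) *
       (1 - \<i> * complex_of_real (\<beta> * sgn \<theta> * tan ((\<alpha> + 1) * pi / 2)))"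

text \<open>\<open>L y t\<close> is the local time at the point \<open>y\<close> up to time \<open>t\<close>. A density of the occupation
  measure is determined only up to Lebesgue-null sets of \<open>y\<close>; joint continuity in \<open>(y, t)\<close>
  selects the version for which \<open>L y t\<close> is meaningful at each fixed \<open>y\<close>. Stable
  processes of index greater than 1 have such a version.\<close>

definition local_times ::
    "'a measure \<Rightarrow> (real \<Rightarrow> 'a \<Rightarrow> real) \<Rightarrow> (real \<Rightarrow> real \<Rightarrow> 'a \<Rightarrow> real) \<Rightarrow> bool" where
  "local_times M X L \<longleftrightarrow>
     (\<forall>y. \<forall>t\<ge>0. L y t \<in> borel_measurable M) \<and>
     (AE \<omega> in M.
        (\<forall>y. \<forall>t\<ge>0. 0 \<le> L y t \<omega>) \<and>
        continuous_on (UNIV \<times> {0..}) (\<lambda>(y, t). L y t \<omega>) \<and>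
        (\<forall>t\<ge>0. \<forall>A\<in>sets borel.
           emeasure lborel {s \<in> {0..t}. X s \<omega> \<in> A} =
             (\<integral>\<^sup>+y\<in>A. ennreal (L y t \<omega>) \<partial>lborel)))"

definition hitting_time :: "(real \<Rightarrow> 'a \<Rightarrow> real) \<Rightarrow> real \<Rightarrow> 'a \<Rightarrow> ennreal" where
  "hitting_time X a \<omega> = (INF t\<in>{t. 0 < t \<and> X t \<omega> = a}. ennreal t)"

text \<open>The value of \<open>L y\<close> at a possibly infinite time \<open>T\<close>: as local times are nondecreasing and
  continuous in time, the supremum is \<open>L y T\<close> for finite \<open>T\<close> and the limit for \<open>T = \<infinity>\<close>.\<close>

definition local_time_at ::
    "(real \<Rightarrow> real \<Rightarrow> 'a \<Rightarrow> real) \<Rightarrow> real \<Rightarrow> ('a \<Rightarrow> ennreal) \<Rightarrow> 'a \<Rightarrow> ennreal" where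
  "local_time_at L y T \<omega> = (SUP t\<in>{t. 0 \<le> t \<and> ennreal t \<le> T \<omega>}. ennreal (L y t \<omega>))"

definition u_T0 ::
    "(real \<Rightarrow> 'a measure) \<Rightarrow> (real \<Rightarrow> 'a \<Rightarrow> real) \<Rightarrow> (real \<Rightarrow> real \<Rightarrow> 'a \<Rightarrow> real) \<Rightarrow>
       real \<Rightarrow> real \<Rightarrow> ennreal" where
  "u_T0 P X L x y = (\<integral>\<^sup>+\<omega>. local_time_at L y (hitting_time X 0) \<omega> \<partial>P x)"

definition sym_part :: "(real \<Rightarrow> real \<Rightarrow> real) \<Rightarrow> real \<Rightarrow> real \<Rightarrow> real" where
  "sym_part u x y = (u x y + u y x) / 2"

definition antisym_part :: "(real \<Rightarrow> real \<Rightarrow> real) \<Rightarrow> real \<Rightarrow> real \<Rightarrow> real" where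
  "antisym_part u x y = (u x y - u y x) / 2"

definition C_const :: "real \<Rightarrow> real \<Rightarrow> real" where
  "C_const \<alpha> \<beta> =
     - sin ((\<alpha> + 1) * (pi / 2)) * Gamma (- \<alpha>) /
       (pi * (1 + \<beta>\<^sup>2 * (tan ((\<alpha> + 1) * pi / 2))\<^sup>2))"

end

theory Submission
  imports Defs
begin

text \<open>Let \<open>\<phi>(w) = (1/2\<pi>) \<integral> (1 - e\<^sup>-\<^sup>i\<^sup>l\<^sup>w) / \<psi>(l) dl\<close>; a Mellin transform evaluates it to
  \<open>C (1 + \<beta> sgn w) |w|\<^sup>\<alpha>\<close>. For fixed \<open>y\<close> the difference \<open>g(z) = \<phi>(-z) - \<phi>(y-z)\<close> is bounded, tends to
  \<open>0\<close> at infinity, and \<open>g(X\<^sub>t) + L\<^sup>y\<^sub>t - L\<^sup>0\<^sub>t\<close> is a martingale, because the generator of \<open>X\<close> has the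
  Fourier multiplier \<open>-\<psi>\<close>. Stop it at the first entrance times into shrinking neighbourhoods of \<open>0\<close>:
  \<open>L\<^sup>0\<close> vanishes before these times, so their limit \<open>S\<close> satisfies
  \<open>E\<^sup>x L\<^sup>y\<^sub>S = g(x) - g(0) = \<phi>(-x) + \<phi>(y) - \<phi>(y-x)\<close>, once \<open>S < \<infinity>\<close> (let \<open>|y|\<close> tend to infinity in
  \<open>E\<^sup>x L\<^sup>y\<^sub>S \<ge> 0\<close>) and \<open>X\<^sub>S = 0\<close> (quasi-left-continuity), so that \<open>S\<close> is the hitting time of \<open>0\<close>.
  For \<open>x = 0\<close> the same argument is applied to the entrance times after a small time \<open>s\<close>.

  Only the independence of increments along finite sets of times is used: all stopping times are limits
  of dyadic ones, which also settles their measurability without completing the filtration.\<close>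

section \<open>Mellin transforms\<close>

text \<open>As the index exceeds 1, the process is recurrent and has no finite Green function. The
  compensation \<open>1 - e^(-ilw)\<close> takes its place: it tames \<open>1 / \<psi>\<close> at 0,
  for which \<alpha> < 1 is needed, while integrability at infinity comes from \<alpha> > 0. A point
  mass has no integrable Fourier transform, so each identity is first proved for normal densities of
  width \<sigma>; the moment bounds must therefore be uniform in \<sigma>. Neighbourhoods of 0
  replace the point 0 because dyadic times, together with right-continuity, detect the entrance into
  an open set but not a visit to a point. The two inequalities at the hitting time have different
  proofs. From below the search starts at s = 0: entrance times never exceed the hitting time, and
  second moments prevent a loss of mass as \<sigma> tends to 0. From above, for every x, the search
  starts at some s > 0, since only strictly positive zeros count as hits; Fatou's lemma suffices
  there, and the price is the expected local time at 0 before s, at most \<open>kappa s\<close>,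
  which vanishes with s.\<close>

lemma nn_integral_Gamma_scaled:
  fixes s c :: real
  assumes "0 < s" "0 < c"
  shows "(\<integral>\<^sup>+t\<in>{0<..}. ennreal (t powr (s - 1) * exp (- (c * t))) \<partial>lborel) = ennreal (Gamma s * c powr (- s))"
proof -
  have "(\<integral>\<^sup>+t\<in>{0<..}. ennreal (t powr (s - 1) * exp (- (c * t))) \<partial>lborel)
      = (\<integral>\<^sup>+t. ennreal (indicator {0<..} t * (t powr (s - 1) * exp (- (c * t)))) \<partial>lborel)"
    by (intro nn_integral_cong) (auto split: split_indicator)
  also have "\<dots> = \<bar>1 / c\<bar> * (\<integral>\<^sup>+t. ennreal (indicator {0<..} (0 + (1/c) * t) * ((0 + (1/c) * t) powr (s - 1) * exp (- (c * (0 + (1/c) * t))))) \<partial>lborel)"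
    using assms by (intro nn_integral_real_affine) auto
  also have "(\<lambda>t. ennreal (indicator {0<..} (0 + (1/c) * t) * ((0 + (1/c) * t) powr (s - 1) * exp (- (c * (0 + (1/c) * t))))))
     = (\<lambda>t. ennreal ((1 / c) powr (s - 1)) * ennreal (indicator {0..} t * t powr (s - 1) / exp t))"
  proof
    fix t :: real
    show "ennreal (indicator {0<..} (0 + (1/c) * t) * ((0 + (1/c) * t) powr (s - 1) * exp (- (c * (0 + (1/c) * t)))))
     = ennreal ((1 / c) powr (s - 1)) * ennreal (indicator {0..} t * t powr (s - 1) / exp t)"
    proof (cases "t \<le> 0")
      case True
      then show ?thesis using assms
        by (auto simp: indicator_def divide_less_0_iff zero_less_divide_iff)
    next
      case False
      then have "indicator {0<..} (0 + (1/c) * t) * ((0 + (1/c) * t) powr (s - 1) * exp (- (c * (0 + (1/c) * t))))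
         = (1 / c) powr (s - 1) * (indicator {0..} t * t powr (s - 1) / exp t)"
        using assms by (simp add: powr_divide exp_minus field_simps)
      then show ?thesis using False assms by (simp add: ennreal_mult' [symmetric])
    qed
  qed
  also have "\<bar>1 / c\<bar> * (\<integral>\<^sup>+t. ennreal ((1 / c) powr (s - 1)) * ennreal (indicator {0..} t * t powr (s - 1) / exp t) \<partial>lborel)
      = ennreal \<bar>1 / c\<bar> * (ennreal ((1 / c) powr (s - 1)) * ennreal (Gamma s))"
    using Gamma_conv_nn_integral_real[OF assms(1)] by (subst nn_integral_cmult) auto
  also have "\<dots> = ennreal (\<bar>1 / c\<bar> * ((1 / c) powr (s - 1) * Gamma s))"
    using assms by (simp add: ennreal_mult' [symmetric])
  also have "\<bar>1 / c\<bar> * ((1 / c) powr (s - 1) * Gamma s) = Gamma s * c powr (- s)"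
    using assms by (simp add: powr_diff powr_divide powr_minus field_simps)
  finally show ?thesis .
qed

text \<open>On [0, n] this is ordinary substitution, with image [0, n^2]; monotone convergence on
  both sides reaches the half-line.\<close>

lemma nn_integral_substitution_square:
  fixes f :: "real \<Rightarrow> real"
  assumes [measurable]: "f \<in> borel_measurable borel"
  shows "(\<integral>\<^sup>+x\<in>{0..}. ennreal (f x) \<partial>lborel) = (\<integral>\<^sup>+x\<in>{0..}. ennreal (f (x\<^sup>2) * (2 * x)) \<partial>lborel)"
proof -
  have sup: "(\<integral>\<^sup>+x\<in>{0..}. h x \<partial>lborel) = (SUP n. \<integral>\<^sup>+x. h x * indicator {0..r n} x \<partial>lborel)"
    if [measurable]: "h \<in> borel_measurable borel" and r: "incseq r" "filterlim r at_top sequentially"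
    for h :: "real \<Rightarrow> ennreal" and r :: "nat \<Rightarrow> real"
  proof -
    have "(SUP n. h x * indicator {0..r n} x) = h x * indicator {0..} x" for x
    proof -
      obtain n where n: "x \<le> r n"
        using r(2) by (auto simp: filterlim_at_top eventually_sequentially)
      show ?thesis
      proof (rule antisym)
        show "(SUP n. h x * indicator {0..r n} x) \<le> h x * indicator {0..} x"
          by (intro SUP_least) (auto split: split_indicator)
        have "h x * indicator {0..} x = h x * indicator {0..r n} x"
          using n by (auto split: split_indicator)
        then show "h x * indicator {0..} x \<le> (SUP n. h x * indicator {0..r n} x)"
          by (auto intro!: SUP_upper2[of n])
      qed
    qed
    then have "(\<integral>\<^sup>+x\<in>{0..}. h x \<partial>lborel) = (\<integral>\<^sup>+x. (SUP n. h x * indicator {0..r n} x) \<partial>lborel)"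
      by simp
    also have "\<dots> = (SUP n. \<integral>\<^sup>+x. h x * indicator {0..r n} x \<partial>lborel)"
      using r(1) by (intro nn_integral_monotone_convergence_SUP)
        (auto simp: incseq_def le_fun_def split: split_indicator intro: order_trans)
    finally show ?thesis .
  qed
  have "(\<integral>\<^sup>+x. ennreal (f x) * indicator {0..(real n)\<^sup>2} x \<partial>lborel)
      = (\<integral>\<^sup>+x. ennreal (f (x\<^sup>2) * (2 * x)) * indicator {0..real n} x \<partial>lborel)" for n
  proof -
    have "(\<integral>\<^sup>+x. ennreal (f x * indicator {0\<^sup>2..(real n)\<^sup>2} x) \<partial>lborel)
      = (\<integral>\<^sup>+x. ennreal (f (x\<^sup>2) * (2 * x) * indicator {0..real n} x) \<partial>lborel)"
      by (rule nn_integral_substitution)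
        (auto intro!: derivative_eq_intros continuous_intros simp: set_borel_measurable_def)
    then show ?thesis by (auto simp: nn_integral_set_ennreal)
  qed
  moreover have "filterlim (\<lambda>n. (real n)\<^sup>2) at_top sequentially" by real_asymp
  ultimately show ?thesis
    by (subst (1 2) sup[where r="\<lambda>n. (real n)\<^sup>2"] sup[where r="real"])
     (auto simp: incseq_def filterlim_real_sequentially intro!: power_mono)
qed

text \<open>At integers both sides are 0: one Gamma factor stands at a pole, where its value is 0,
  and the right side is a division by 0.\<close>

lemma Gamma_reflection_real:
  fixes z :: real
  shows "Gamma z * Gamma (1 - z) = pi / sin (pi * z)"
proof -
  have "complex_of_real (Gamma z * Gamma (1 - z)) = of_real (pi / sin (pi * z))"
    using Gamma_reflection_complex[of "of_real z"]
    by (simp add: Gamma_complex_of_real [symmetric] sin_of_real [symmetric])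
  then show ?thesis by (simp only: of_real_eq_iff)
qed

text \<open>Writing \<open>1 / (1 + s^2)\<close> as the integral of
  \<open>exp (- (1 + s^2) * w)\<close> over \<open>w > 0\<close> and exchanging the integrals leaves
  two Gamma integrals with the positive parameters \<open>a / 2\<close> and
  \<open>1 - a / 2\<close>; reflection turns their product into a sine.\<close>

lemma nn_integral_powr_div_one_plus_square:
  fixes a :: real
  assumes "0 < a" "a < 2"
  shows "(\<integral>\<^sup>+s\<in>{0<..}. ennreal (s powr (a - 1) / (1 + s\<^sup>2)) \<partial>lborel) = ennreal (pi / (2 * sin (pi * a / 2)))"
proof -
  \<comment> \<open>The substitution of the square needs a factor \<open>2 * s\<close>; this is why
    the integral is doubled first.\<close>
  have inner: "(\<integral>\<^sup>+s\<in>{0<..}. ennreal (s powr (a - 1) * exp (- (w * s\<^sup>2))) \<partial>lborel)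
      = ennreal (Gamma (a / 2) * w powr (- (a / 2)) / 2)" if "0 < w" for w
  proof -
    have "2 * (\<integral>\<^sup>+s\<in>{0<..}. ennreal (s powr (a - 1) * exp (- (w * s\<^sup>2))) \<partial>lborel)
        = (\<integral>\<^sup>+s. 2 * (ennreal (s powr (a - 1) * exp (- (w * s\<^sup>2))) * indicator {0<..} s) \<partial>lborel)"
      by (rule nn_integral_cmult [symmetric]) simp
    also have "\<dots> = (\<integral>\<^sup>+s\<in>{0..}. ennreal (((s\<^sup>2) powr (a / 2 - 1) * exp (- (w * s\<^sup>2))) * (2 * s)) \<partial>lborel)"
    proof (intro nn_integral_cong)
      fix s :: real
      show "2 * (ennreal (s powr (a - 1) * exp (- (w * s\<^sup>2))) * indicator {0<..} s)
        = ennreal (((s\<^sup>2) powr (a / 2 - 1) * exp (- (w * s\<^sup>2))) * (2 * s)) * indicator {0..} s"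
      proof (cases "s > 0")
        case True
        then have "((s\<^sup>2) powr (a / 2 - 1) * exp (- (w * s\<^sup>2))) * (2 * s) = 2 * (s powr (a - 1) * exp (- (w * s\<^sup>2)))"
          by (simp add: powr_diff powr_powr flip: powr_numeral) (simp add: field_simps power2_eq_square)
        then show ?thesis using True
            unfolding \<open>(s\<^sup>2) powr (a / 2 - 1) * exp (- (w * s\<^sup>2)) * (2 * s) = _\<close>
            by (simp add: ennreal_mult')
      qed (auto simp: indicator_def)
    qed
    also have "\<dots> = (\<integral>\<^sup>+s\<in>{0..}. ennreal (s powr (a / 2 - 1) * exp (- (w * s))) \<partial>lborel)"
      by (rule nn_integral_substitution_square [symmetric]) simp
    also have "\<dots> = (\<integral>\<^sup>+s\<in>{0<..}. ennreal (s powr (a / 2 - 1) * exp (- (w * s))) \<partial>lborel)"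
      by (intro nn_integral_cong) (auto simp: indicator_def)
    also have "\<dots> = ennreal (Gamma (a / 2) * w powr (- (a / 2)))"
      using assms that by (intro nn_integral_Gamma_scaled) auto
    also have "\<dots> = 2 * ennreal (Gamma (a / 2) * w powr (- (a / 2)) / 2)"
      using assms by (simp flip: ennreal_numeral ennreal_mult')
    finally show ?thesis by (simp add: ennreal_mult_cancel_left)
  qed
  have "(\<integral>\<^sup>+s\<in>{0<..}. ennreal (s powr (a - 1) / (1 + s\<^sup>2)) \<partial>lborel)
     = (\<integral>\<^sup>+s. (\<integral>\<^sup>+w. ennreal (s powr (a - 1)) * (ennreal (exp (- ((1 + s\<^sup>2) * w))) * indicator {0<..} w * indicator {0<..} s) \<partial>lborel) \<partial>lborel)"
  proof (intro nn_integral_cong)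
    fix s :: real
    have pos: "1 + s\<^sup>2 > 0" by (simp add: add_pos_nonneg)
    have "(\<integral>\<^sup>+w. ennreal (exp (- ((1 + s\<^sup>2) * w))) * indicator {0<..} w \<partial>lborel)
       = (\<integral>\<^sup>+w\<in>{0<..}. ennreal (w powr (1 - 1) * exp (- ((1 + s\<^sup>2) * w))) \<partial>lborel)"
      by (intro nn_integral_cong) (auto simp: indicator_def)
    also have "\<dots> = ennreal (1 / (1 + s\<^sup>2))"
      using pos by (subst nn_integral_Gamma_scaled) (auto simp: powr_minus field_simps)
    finally show "ennreal (s powr (a - 1) / (1 + s\<^sup>2)) * indicator {0<..} s
      = (\<integral>\<^sup>+w. ennreal (s powr (a - 1)) * (ennreal (exp (- ((1 + s\<^sup>2) * w))) * indicator {0<..} w * indicator {0<..} s) \<partial>lborel)"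
      using pos by (subst nn_integral_cmult, simp, subst nn_integral_multc, simp)
        (simp add: ennreal_mult' [symmetric] flip: mult.assoc)
  qed
  also have "\<dots> = (\<integral>\<^sup>+w. (\<integral>\<^sup>+s. ennreal (s powr (a - 1)) * (ennreal (exp (- ((1 + s\<^sup>2) * w))) * indicator {0<..} w * indicator {0<..} s) \<partial>lborel) \<partial>lborel)"
    by (rule lborel_pair.Fubini') simp
  also have "\<dots> = (\<integral>\<^sup>+w. ennreal (Gamma (a / 2) / 2) * (ennreal (w powr ((1 - a / 2) - 1) * exp (- (1 * w))) * indicator {0<..} w) \<partial>lborel)"
  proof (intro nn_integral_cong)
    fix w :: real
    show "(\<integral>\<^sup>+s. ennreal (s powr (a - 1)) * (ennreal (exp (- ((1 + s\<^sup>2) * w))) * indicator {0<..} w * indicator {0<..} s) \<partial>lborel)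
       = ennreal (Gamma (a / 2) / 2) * (ennreal (w powr ((1 - a / 2) - 1) * exp (- (1 * w))) * indicator {0<..} w)"
    proof (cases "w > 0")
      case True
      have "(\<integral>\<^sup>+s. ennreal (s powr (a - 1)) * (ennreal (exp (- ((1 + s\<^sup>2) * w))) * indicator {0<..} w * indicator {0<..} s) \<partial>lborel)
        = (\<integral>\<^sup>+s. ennreal (exp (- w)) * (ennreal (s powr (a - 1) * exp (- (w * s\<^sup>2))) * indicator {0<..} s) \<partial>lborel)"
        using True
        by (intro nn_integral_cong)
         (auto simp: indicator_def algebra_simps exp_minus exp_diff divide_inverse simp flip: ennreal_mult')
      also have "\<dots> = ennreal (exp (- w)) * ennreal (Gamma (a / 2) * w powr (- (a / 2)) / 2)"
        using inner[OF True] by (subst nn_integral_cmult) auto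
      also have "\<dots> = ennreal (Gamma (a / 2) / 2) * (ennreal (w powr ((1 - a / 2) - 1) * exp (- (1 * w))) * indicator {0<..} w)"
        using True assms by (simp add: ennreal_mult' [symmetric] mult_ac)
      finally show ?thesis .
    qed auto
  qed
  also have "\<dots> = ennreal (Gamma (a / 2) / 2) * ennreal (Gamma (1 - a / 2) * 1 powr (- (1 - a / 2)))"
    using assms by (subst nn_integral_cmult, simp, subst nn_integral_Gamma_scaled) auto
  also have "\<dots> = ennreal ((Gamma (a / 2) * Gamma (1 - a / 2)) / 2)"
    using assms by (simp add: ennreal_mult' [symmetric])
  also have "(Gamma (a / 2) * Gamma (1 - a / 2)) / 2 = pi / (2 * sin (pi * a / 2))"
    by (simp add: Gamma_reflection_real)
  finally show ?thesis .
qed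


lemma nn_integral_indicator_reflect:
  fixes f :: "real \<Rightarrow> ennreal"
  assumes [measurable]: "f \<in> borel_measurable borel" and f: "\<And>x. f (- x) = f x"
  shows "(\<integral>\<^sup>+x. f x \<partial>lborel) = 2 * (\<integral>\<^sup>+x\<in>{0<..}. f x \<partial>lborel)"
proof -
  have "(\<integral>\<^sup>+x. f x \<partial>lborel) = (\<integral>\<^sup>+x. f x * indicator {0<..} x + f x * indicator {..<0} x \<partial>lborel)"
    by (intro nn_integral_cong_AE, use AE_lborel_singleton[of 0] in eventually_elim)
      (auto simp: indicator_def)
  also have "\<dots> = (\<integral>\<^sup>+x\<in>{0<..}. f x \<partial>lborel) + (\<integral>\<^sup>+x\<in>{..<0}. f x \<partial>lborel)"
    by (rule nn_integral_add) auto
  also have "(\<integral>\<^sup>+x\<in>{..<0}. f x \<partial>lborel) = ennreal \<bar>-1\<bar> * (\<integral>\<^sup>+x. f (0 + (-1) * x) * indicator {..<0} (0 + (-1) * x) \<partial>lborel)"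
    by (rule nn_integral_real_affine) auto
  also have "\<dots> = (\<integral>\<^sup>+x\<in>{0<..}. f x \<partial>lborel)"
    by (auto simp: f indicator_def intro!: nn_integral_cong)
  finally show ?thesis by (simp add: mult_2)
qed

text \<open>The cut \<open>R\<close> stays free: the first term bounds the part with modulus at most
  \<open>R\<close>, the second the tail. It is chosen later as a function of a time horizon
  \<open>s\<close>.\<close>

lemma nn_integral_min_powr_le:
  fixes \<alpha> R s :: real
  assumes "0 < \<alpha>" "0 < R" "0 \<le> s"
  shows "(\<integral>\<^sup>+l. ennreal (min s (\<bar>l\<bar> powr (- 1 - \<alpha>))) \<partial>lborel) \<le> ennreal (2 * (s * R + R powr (- \<alpha>) / \<alpha>))"
proof -
  have tail: "(\<integral>\<^sup>+l\<in>{R..}. ennreal (l powr (- 1 - \<alpha>)) \<partial>lborel) = ennreal (R powr (- \<alpha>) / \<alpha>)"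
    using nn_integral_has_integral_lebesgue'[OF _ has_integral_powr_to_inf[of "- 1 - \<alpha>" R]] assms
    by simp
  have "(\<integral>\<^sup>+l\<in>{0<..}. ennreal (min s (\<bar>l\<bar> powr (- 1 - \<alpha>))) \<partial>lborel)
     \<le> (\<integral>\<^sup>+l. ennreal s * indicator {0..R} l + ennreal (l powr (- 1 - \<alpha>)) * indicator {R..} l \<partial>lborel)"
    by (intro nn_integral_mono) (auto simp: indicator_def intro!: add_increasing2 ennreal_leI)
  also have "\<dots> = ennreal s * ennreal R + ennreal (R powr (- \<alpha>) / \<alpha>)"
    using assms by (subst nn_integral_add) (auto simp: nn_integral_cmult_indicator tail)
  also have "\<dots> = ennreal (s * R + R powr (- \<alpha>) / \<alpha>)"
    using assms by (simp flip: ennreal_mult' ennreal_plus)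
  finally have "2 * (\<integral>\<^sup>+l\<in>{0<..}. ennreal (min s (\<bar>l\<bar> powr (- 1 - \<alpha>))) \<partial>lborel)
      \<le> ennreal 2 * ennreal (s * R + R powr (- \<alpha>) / \<alpha>)"
    by (intro mult_mono) auto
  also have "\<dots> = ennreal (2 * (s * R + R powr (- \<alpha>) / \<alpha>))"
    using assms by (intro ennreal_mult [symmetric]) auto
  finally show ?thesis
    by (subst nn_integral_indicator_reflect) auto
qed

text \<open>Near 0 the integrand is \<open>|l|^(-\<alpha>)\<close>, integrable because \<alpha> < 1;
  beyond 1 it is \<open>|l|^(-1-\<alpha>)\<close>, integrable because \<alpha> > 0. It dominates the
  integrands of the Mellin transform and of \<open>G0\<close>.\<close>

lemma integrable_min_powr:
  fixes \<alpha> :: real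
  assumes "0 < \<alpha>" "\<alpha> < 1"
  shows "integrable lborel (\<lambda>l::real. min 1 \<bar>l\<bar> * \<bar>l\<bar> powr (- 1 - \<alpha>))"
proof (rule integrableI_nonneg)
  have head: "(\<integral>\<^sup>+l\<in>{0..1}. ennreal (l powr (- \<alpha>)) \<partial>lborel) = ennreal (1 / (1 - \<alpha>))"
    using nn_integral_has_integral_lebesgue'[OF _ has_integral_powr_from_0[of "- \<alpha>" 1]] assms
    by simp
  have tail: "(\<integral>\<^sup>+l\<in>{1..}. ennreal (l powr (- 1 - \<alpha>)) \<partial>lborel) = ennreal (1 / \<alpha>)"
    using nn_integral_has_integral_lebesgue'[OF _ has_integral_powr_to_inf[of "- 1 - \<alpha>" 1]] assms
    by simp
  have "(\<integral>\<^sup>+l\<in>{0<..}. ennreal (min 1 \<bar>l\<bar> * \<bar>l\<bar> powr (- 1 - \<alpha>)) \<partial>lborel)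
     \<le> (\<integral>\<^sup>+l. ennreal (l powr (- \<alpha>)) * indicator {0..1} l + ennreal (l powr (- 1 - \<alpha>)) * indicator {1..} l \<partial>lborel)"
    by (intro nn_integral_mono)
      (auto simp: indicator_def powr_diff powr_minus field_simps min_def)
  also have "\<dots> = ennreal (1 / (1 - \<alpha>)) + ennreal (1 / \<alpha>)"
    by (subst nn_integral_add) (auto simp: head tail)
  also have "\<dots> < \<infinity>" by simp
  finally show "(\<integral>\<^sup>+l. ennreal (min 1 \<bar>l\<bar> * \<bar>l\<bar> powr (- 1 - \<alpha>)) \<partial>lborel) < \<infinity>"
    by (subst nn_integral_indicator_reflect) (auto simp: ennreal_mult_less_top)
qed auto

section \<open>Laplace and Mellin transforms of complex exponentials\<close>

lemma Laplace_exp_complex: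
  fixes c :: complex
  assumes "0 < Re c"
  shows "has_bochner_integral lborel (\<lambda>u. indicator {0<..} u *\<^sub>R exp (- (c * of_real u))) (1 / c)"
proof -
  have c: "c \<noteq> 0" using assms by auto
  have norm: "norm (exp (- (c * of_real u))) = exp (- (u * Re c))" for u
    by (simp add: norm_exp_eq_Re)
  have int: "set_integrable lborel {0<..} (\<lambda>u. exp (- (c * of_real u)))"
    unfolding set_integrable_def
    by (rule Bochner_Integration.integrable_bound[OF integrable_I0i_exp_mscale[OF assms, unfolded set_integrable_def]])
       (auto simp: norm mult.commute)
  have "(LBINT u=0..\<infinity>. exp (- (c * of_real u))) = 0 - (- (1 / c))"
  proof (rule interval_integral_FTC_integrable[where F = "\<lambda>u. - exp (- (c * of_real u)) / c"])
    show "((\<lambda>u. - exp (- (c * of_real u)) / c) has_vector_derivative exp (- (c * of_real x))) (at x)" for x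
      using c by (intro has_vector_derivative_real_field[where f="\<lambda>z. - exp (- (c * z)) / c"])
        (auto intro!: derivative_eq_intros)
    have "((\<lambda>u. - exp (- (c * complex_of_real u)) / c) \<longlongrightarrow> - exp (- (c * complex_of_real 0)) / c) (at_right 0)"
      by (intro tendsto_intros c)
    then show "(((\<lambda>u. - exp (- (c * complex_of_real u)) / c) \<circ> real_of_ereal) \<longlongrightarrow> - (1 / c)) (at_right 0)"
      by (simp add: zero_ereal_def ereal_tendsto_simps)
    have "((\<lambda>u. norm (exp (- (c * complex_of_real u)) / c)) \<longlongrightarrow> 0) at_top"
    proof -
      have "((\<lambda>u. exp (- (u * r))) \<longlongrightarrow> 0) at_top" if "0 < r" for r :: real
        using that by real_asymp
      from tendsto_divide_zero[OF this[OF assms]] show ?thesis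
        by (simp add: norm norm_divide mult.commute)
    qed
    then have "((\<lambda>u. - exp (- (c * complex_of_real u)) / c) \<longlongrightarrow> 0) at_top"
      by (subst tendsto_norm_zero_iff [symmetric]) simp
    then show "(((\<lambda>u. - exp (- (c * complex_of_real u)) / c) \<circ> real_of_ereal) \<longlongrightarrow> 0) (at_left \<infinity>)"
      by (simp add: ereal_tendsto_simps)
    show "set_integrable lborel (einterval 0 \<infinity>) (\<lambda>u. exp (- (c * complex_of_real u)))"
      using int by (simp add: zero_ereal_def einterval_eq)
  qed auto
  then show ?thesis
    using int by (simp add: has_bochner_integral_iff interval_lebesgue_integral_0_infty
      set_integrable_def set_lebesgue_integral_def)
qed

text \<open>The integrand is a difference of two exponentials with the rates \<open>s\<close> and
  \<open>s - \<i>\<close>, both of positive real part; the value is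
  \<open>1 / s - 1 / (s - \<i>)\<close> over a real denominator.\<close>

lemma Laplace_iexp:
  assumes "0 < s"
  shows "has_bochner_integral lborel (\<lambda>u. indicator {0<..} u *\<^sub>R ((1 - iexp u) * of_real (exp (- (u * s)))))
     ((1 - \<i> * of_real s) / of_real (s * (1 + s\<^sup>2)))"
proof -
  have nz: "of_real s - \<i> \<noteq> 0" using assms by (auto simp: complex_eq_iff)
  have "has_bochner_integral lborel (\<lambda>u. indicator {0<..} u *\<^sub>R exp (- (of_real s * of_real u)) -
      indicator {0<..} u *\<^sub>R exp (- ((of_real s - \<i>) * of_real u))) (1 / of_real s - 1 / (of_real s - \<i>))"
    using assms by (intro has_bochner_integral_diff Laplace_exp_complex) auto
  also have "1 / of_real s - 1 / (of_real s - \<i>) = (1 - \<i> * of_real s) / of_real (s * (1 + s\<^sup>2))"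
  proof -
    define S P Q where "S = complex_of_real s" and "P = of_real s - \<i>" and "Q = of_real s + \<i>"
    have nz: "S \<noteq> 0" "P \<noteq> 0" "Q \<noteq> 0" using assms by (auto simp: complex_eq_iff S_def P_def Q_def)
    have "1 / S - 1 / P = (P - S) / (S * P)" using nz by (simp add: field_simps)
    also have "P - S = - \<i>" by (simp add: P_def S_def)
    also have "- \<i> / (S * P) = (- \<i> * Q) / (S * (P * Q))" using nz by simp
    also have "- \<i> * Q = 1 - \<i> * of_real s" by (simp add: Q_def algebra_simps)
    also have "S * (P * Q) = of_real (s * (1 + s\<^sup>2))"
      by (simp add: S_def P_def Q_def algebra_simps power2_eq_square)
    finally show ?thesis by (simp add: S_def P_def)
  qed
  also have "(\<lambda>u. indicator {0<..} u *\<^sub>R exp (- (of_real s * of_real u)) -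
      indicator {0<..} u *\<^sub>R exp (- ((of_real s - \<i>) * of_real u)))
    = (\<lambda>u. indicator {0<..} u *\<^sub>R ((1 - iexp u) * complex_of_real (exp (- (u * s)))))"
    by (auto simp: fun_eq_iff indicator_def exp_of_real[symmetric] algebra_simps exp_add[symmetric] exp_diff exp_minus divide_inverse)
  finally show ?thesis .
qed

lemma norm_one_minus_iexp_le: "norm (1 - iexp u) \<le> 2 * min 1 \<bar>u\<bar>"
proof -
  have "norm (1 - iexp u) \<le> norm (1::complex) + norm (iexp u)" by (rule norm_triangle_ineq4)
  moreover have "norm (1 - iexp u) \<le> \<bar>u\<bar>"
    using iexp_approx1[of u 0] by (simp add: norm_minus_commute)
  ultimately show ?thesis by auto
qed

text \<open>\<open>Gamma (1 + \<alpha>) * u powr (- 1 - \<alpha>)\<close> is the integral of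
  \<open>s powr \<alpha> * exp (- (u * s))\<close> over \<open>s > 0\<close>, and Fubini leads to
  \<open>Laplace_iexp\<close>. The value equals
  \<open>- Gamma (- \<alpha>) * exp (- \<i> * pi * \<alpha> / 2)\<close>, kept in components for
  \<open>potential_integrand_integral\<close>.\<close>

lemma Mellin_one_minus_iexp:
  fixes \<alpha> :: real
  assumes \<alpha>: "0 < \<alpha>" "\<alpha> < 1"
  shows "has_bochner_integral lborel (\<lambda>u. indicator {0<..} u *\<^sub>R ((1 - iexp u) * of_real (u powr (- 1 - \<alpha>))))
     (of_real (pi / (2 * Gamma (1 + \<alpha>))) * Complex (1 / sin (pi * \<alpha> / 2)) (- 1 / cos (pi * \<alpha> / 2)))"
proof -
  define K where "K u s = (indicator {0<..} u * indicator {0<..} s) *\<^sub>R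
      ((1 - iexp u) * complex_of_real (s powr \<alpha> * exp (- (u * s))))" for u s :: real
  have [measurable]: "case_prod K \<in> borel_measurable (lborel \<Otimes>\<^sub>M lborel)"
    unfolding K_def split_beta' by measurable
  have Gpos: "0 < Gamma (1 + \<alpha>)" using \<alpha> by (simp add: Gamma_real_pos)
  have G: "has_bochner_integral lborel (\<lambda>s. indicator {0<..} s * (s powr \<alpha> * exp (- (u * s)))) (Gamma (1 + \<alpha>) * u powr (- 1 - \<alpha>))"
    if "0 < u" for u
  proof (rule has_bochner_integral_nn_integral)
    have "(\<integral>\<^sup>+s. ennreal (indicator {0<..} s * (s powr \<alpha> * exp (- (u * s)))) \<partial>lborel)
      = (\<integral>\<^sup>+s\<in>{0<..}. ennreal (s powr ((1 + \<alpha>) - 1) * exp (- (u * s))) \<partial>lborel)"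
      by (intro nn_integral_cong) (auto simp: indicator_def)
    also have "\<dots> = ennreal (Gamma (1 + \<alpha>) * u powr (- (1 + \<alpha>)))"
      using that \<alpha> by (intro nn_integral_Gamma_scaled) auto
    finally show "(\<integral>\<^sup>+s. ennreal (indicator {0<..} s * (s powr \<alpha> * exp (- (u * s)))) \<partial>lborel)
      = ennreal (Gamma (1 + \<alpha>) * u powr (- 1 - \<alpha>))" by simp
  qed (use Gpos in auto)
  define J where "J = (\<lambda>u. indicator {0<..} u *\<^sub>R ((1 - iexp u) * complex_of_real (u powr (- 1 - \<alpha>))))"
  have [measurable]: "J \<in> borel_measurable lborel" unfolding J_def by measurable
  have Kint: "has_bochner_integral lborel (\<lambda>s. K u s) (of_real (Gamma (1 + \<alpha>)) * J u)"
    and Knorm: "(LINT s|lborel. norm (K u s)) = Gamma (1 + \<alpha>) * norm (J u)" for u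
  proof -
    have "has_bochner_integral lborel (\<lambda>s. K u s) (of_real (Gamma (1 + \<alpha>)) * J u) \<and>
        (LINT s|lborel. norm (K u s)) = Gamma (1 + \<alpha>) * norm (J u)"
    proof (cases "u > 0")
      case True
      have "has_bochner_integral lborel (\<lambda>s. (1 - iexp u) * of_real (indicator {0<..} s * (s powr \<alpha> * exp (- (u * s)))))
         ((1 - iexp u) * of_real (Gamma (1 + \<alpha>) * u powr (- 1 - \<alpha>)))"
        by (intro has_bochner_integral_mult_right has_bochner_integral_of_real G True)
      also have "(\<lambda>s. (1 - iexp u) * of_real (indicator {0<..} s * (s powr \<alpha> * exp (- (u * s))))) = (\<lambda>s. K u s)"
        using True by (auto simp: K_def indicator_def)
      finally have 1: "has_bochner_integral lborel (\<lambda>s. K u s) (of_real (Gamma (1 + \<alpha>)) * J u)"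
        using True by (simp add: J_def mult_ac)
      have "has_bochner_integral lborel (\<lambda>s. norm (1 - iexp u) * (indicator {0<..} s * (s powr \<alpha> * exp (- (u * s)))))
         (norm (1 - iexp u) * (Gamma (1 + \<alpha>) * u powr (- 1 - \<alpha>)))"
        by (intro has_bochner_integral_mult_right G True)
      also have "(\<lambda>s. norm (1 - iexp u) * (indicator {0<..} s * (s powr \<alpha> * exp (- (u * s))))) = (\<lambda>s. norm (K u s))"
        using True by (auto simp: K_def indicator_def norm_mult)
      finally have "(LINT s|lborel. norm (K u s)) = norm (1 - iexp u) * (Gamma (1 + \<alpha>) * u powr (- 1 - \<alpha>))"
        by (simp add: has_bochner_integral_integral_eq)
      then show ?thesis using 1 True by (simp add: J_def norm_mult)
    next
      case False
      then have "K u = (\<lambda>s. 0)" "J u = 0" by (auto simp: K_def J_def indicator_def)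
      then show ?thesis by (simp add: has_bochner_integral_zero)
    qed
    then show "has_bochner_integral lborel (\<lambda>s. K u s) (of_real (Gamma (1 + \<alpha>)) * J u)"
        "(LINT s|lborel. norm (K u s)) = Gamma (1 + \<alpha>) * norm (J u)" by auto
  qed
  \<comment> \<open>This is what Fubini needs: integrating \<open>norm (K u s)\<close> in
    \<open>s\<close> gives back \<open>norm (J u)\<close> up to the factor
    \<open>Gamma (1 + \<alpha>)\<close>.\<close>
  have Jint: "integrable lborel J"
  proof (rule Bochner_Integration.integrable_bound)
    show "integrable lborel (\<lambda>l::real. 2 * (min 1 \<bar>l\<bar> * \<bar>l\<bar> powr (- 1 - \<alpha>)))"
      by (intro integrable_mult_right integrable_min_powr \<alpha>)
    have "norm (1 - iexp u) \<le> 2 * min 1 u" if "u > 0" for u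
      using that norm_one_minus_iexp_le[of u] by (simp only: abs_of_pos)
    then show "AE x in lborel. norm (J x) \<le> norm (2 * (min 1 \<bar>x\<bar> * \<bar>x\<bar> powr (- 1 - \<alpha>)))"
      by (intro AE_I2) (auto simp: J_def norm_mult indicator_def mult.assoc[symmetric] abs_of_pos intro!: mult_right_mono dest: order_trans)
  qed simp
  have "integrable (lborel \<Otimes>\<^sub>M lborel) (case_prod K)"
    using Kint by (intro lborel_pair.Fubini_integrable)
       (auto simp: Knorm has_bochner_integral_iff intro!: integrable_mult_right integrable_norm Jint)
  then have "(LINT s|lborel. LINT u|lborel. K u s) = (LINT u|lborel. LINT s|lborel. K u s)"
    by (rule lborel_pair.Fubini_integral)
  also have "\<dots> = of_real (Gamma (1 + \<alpha>)) * (LINT u|lborel. J u)"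
    using Kint by (simp add: has_bochner_integral_iff)
  finally have eq: "of_real (Gamma (1 + \<alpha>)) * (LINT u|lborel. J u) = (LINT s|lborel. LINT u|lborel. K u s)" ..
  \<comment> \<open>Used at \<open>a = \<alpha>\<close> for the real part and at
    \<open>a = 1 + \<alpha>\<close> for the imaginary part.\<close>
  have B: "has_bochner_integral lborel (\<lambda>s. indicator {0<..} s * (s powr (a - 1) / (1 + s\<^sup>2))) (pi / (2 * sin (pi * a / 2)))"
    if "0 < a" "a < 2" for a
  proof (rule has_bochner_integral_nn_integral)
    show "(\<integral>\<^sup>+s. ennreal (indicator {0<..} s * (s powr (a - 1) / (1 + s\<^sup>2))) \<partial>lborel) = ennreal (pi / (2 * sin (pi * a / 2)))"
      unfolding nn_integral_powr_div_one_plus_square[OF that, symmetric]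
      by (intro nn_integral_cong) (auto simp: indicator_def)
    have "0 < sin (pi * a / 2)" using that by (intro sin_gt_zero) auto
    then show "0 \<le> pi / (2 * sin (pi * a / 2))" by simp
  qed auto
  have "(LINT u|lborel. K u s) = of_real (indicator {0<..} s * (s powr (\<alpha> - 1) / (1 + s\<^sup>2)))
      - \<i> * of_real (indicator {0<..} s * (s powr ((1 + \<alpha>) - 1) / (1 + s\<^sup>2)))" for s
  proof (cases "s > 0")
    case True
    have nz: "1 + s\<^sup>2 \<noteq> 0" by (metis add_pos_nonneg less_numeral_extra(1) less_irrefl zero_le_power2)
    have "(LINT u|lborel. K u s) = (LINT u|lborel. of_real (s powr \<alpha>) * (indicator {0<..} u *\<^sub>R ((1 - iexp u) * of_real (exp (- (u * s))))))"
      using True by (intro Bochner_Integration.integral_cong) (auto simp: K_def indicator_def)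
    also have "\<dots> = of_real (s powr \<alpha>) * ((1 - \<i> * of_real s) / of_real (s * (1 + s\<^sup>2)))"
      by (simp only: integral_mult_right_zero has_bochner_integral_integral_eq[OF Laplace_iexp[OF True]])
    finally have *: "(LINT u|lborel. K u s) = of_real (s powr \<alpha>) * ((1 - \<i> * of_real s) / of_real (s * (1 + s\<^sup>2)))" .
    define D where "D = 1 + s\<^sup>2"
    show ?thesis unfolding * using True nz unfolding D_def [symmetric]
      by (simp add: powr_diff field_simps)
  qed (simp add: K_def)
  then have "(LINT s|lborel. LINT u|lborel. K u s) = (LINT s|lborel. of_real (indicator {0<..} s * (s powr (\<alpha> - 1) / (1 + s\<^sup>2)))
      - \<i> * of_real (indicator {0<..} s * (s powr ((1 + \<alpha>) - 1) / (1 + s\<^sup>2))))" by simp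
  also have "\<dots> = of_real (pi / (2 * sin (pi * \<alpha> / 2))) - \<i> * of_real (pi / (2 * sin (pi * (1 + \<alpha>) / 2)))"
    by (intro has_bochner_integral_integral_eq has_bochner_integral_diff has_bochner_integral_mult_right
      has_bochner_integral_of_real B) (use \<alpha> in auto)
  also have "sin (pi * (1 + \<alpha>) / 2) = cos (pi * \<alpha> / 2)"
    by (simp add: add_divide_distrib distrib_left sin_add)
  finally have "of_real (Gamma (1 + \<alpha>)) * (LINT u|lborel. J u)
     = of_real (pi / (2 * sin (pi * \<alpha> / 2))) - \<i> * of_real (pi / (2 * cos (pi * \<alpha> / 2)))"
    using eq by simp
  then have "(LINT u|lborel. J u) = (of_real (pi / (2 * sin (pi * \<alpha> / 2))) - \<i> * of_real (pi / (2 * cos (pi * \<alpha> / 2)))) / of_real (Gamma (1 + \<alpha>))"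
    using Gpos by (simp add: eq_divide_eq mult.commute)
  also have "\<dots> = of_real (pi / (2 * Gamma (1 + \<alpha>))) * Complex (1 / sin (pi * \<alpha> / 2)) (- 1 / cos (pi * \<alpha> / 2))"
    by (simp add: complex_eq_iff mult_ac)
  finally have "(LINT u|lborel. J u) = of_real (pi / (2 * Gamma (1 + \<alpha>))) * Complex (1 / sin (pi * \<alpha> / 2)) (- 1 / cos (pi * \<alpha> / 2))" .
  then show ?thesis using Jint by (auto simp: has_bochner_integral_iff J_def)
qed

section \<open>The stable exponent and its potential\<close>

lemma measurable_stable_exponent [measurable]: "stable_exponent \<alpha> \<beta> \<in> borel_measurable borel"
  unfolding stable_exponent_def[abs_def] by measurable

lemma Re_stable_exponent: "Re (stable_exponent \<alpha> \<beta> l) = \<bar>l\<bar> powr (\<alpha> + 1)"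
  by (simp add: stable_exponent_def)

lemma stable_exponent_0 [simp]: "stable_exponent \<alpha> \<beta> 0 = 0"
  by (simp add: stable_exponent_def)

lemma norm_stable_exponent_ge: "\<bar>l\<bar> powr (\<alpha> + 1) \<le> norm (stable_exponent \<alpha> \<beta> l)"
  by (metis Re_stable_exponent abs_of_nonneg abs_Re_le_cmod powr_ge_zero)

lemma stable_exponent_eq_0_iff [simp]: "stable_exponent \<alpha> \<beta> l = 0 \<longleftrightarrow> l = 0"
  using norm_stable_exponent_ge[of l \<alpha> \<beta>] by (cases "l = 0") (auto simp del: powr_ge_zero)

lemma norm_exp_stable_exponent:
  "norm (exp (- complex_of_real t * stable_exponent \<alpha> \<beta> l)) = exp (- (t * \<bar>l\<bar> powr (\<alpha> + 1)))"
  by (simp add: norm_exp_eq_Re Re_stable_exponent)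

context
  fixes \<alpha> \<beta> :: real
  assumes \<alpha>: "0 < \<alpha>" "\<alpha> < 1"
begin

lemma Gamma_uminus_eq: "- Gamma (- \<alpha>) = pi / (sin (pi * \<alpha>) * Gamma (1 + \<alpha>))"
proof -
  have "Gamma (- \<alpha>) * Gamma (1 + \<alpha>) = pi / sin (pi * (- \<alpha>))"
    using Gamma_reflection_real[of "- \<alpha>"] by simp
  moreover have "Gamma (1 + \<alpha>) > 0" using \<alpha> by (simp add: Gamma_real_pos)
  moreover have "sin (pi * \<alpha>) > 0" using \<alpha> by (intro sin_gt_zero) auto
  ultimately show ?thesis by (simp add: field_simps)
qed

lemma half_angle_pos: "0 < sin (pi * \<alpha> / 2)" "0 < cos (pi * \<alpha> / 2)"
  using \<alpha> by (auto intro!: sin_gt_zero cos_gt_zero)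

lemma sin_shift: "sin ((\<alpha> + 1) * (pi / 2)) = cos (pi * \<alpha> / 2)"
proof -
  have "(\<alpha> + 1) * (pi / 2) = pi * \<alpha> / 2 + pi / 2" by (simp add: field_simps)
  then show ?thesis by (simp only: sin_add) simp
qed

lemma tan_shift: "tan ((\<alpha> + 1) * pi / 2) = - cos (pi * \<alpha> / 2) / sin (pi * \<alpha> / 2)"
  by (simp add: algebra_simps add_divide_distrib tan_def sin_add cos_add)

text \<open>Reflection trades \<open>Gamma (- \<alpha>)\<close>, which is negative, for
  \<open>Gamma (1 + \<alpha>)\<close>; the double angle formula for
  \<open>sin (pi * \<alpha>)\<close> then produces a cosine that cancels the sine of the shifted
  angle. In this form positivity can be read off.\<close>

lemma C_const_eq: "C_const \<alpha> \<beta> = 1 / (2 * Gamma (1 + \<alpha>) * sin (pi * \<alpha> / 2) * (1 + \<beta>\<^sup>2 * (tan ((\<alpha> + 1) * pi / 2))\<^sup>2))"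
proof -
  have "- Gamma (- \<alpha>) = pi / (2 * sin (pi * \<alpha> / 2) * cos (pi * \<alpha> / 2) * Gamma (1 + \<alpha>))"
    using Gamma_uminus_eq sin_double[of "pi * \<alpha> / 2"] by simp
  have "- cos (pi * \<alpha> / 2) * Gamma (- \<alpha>) = cos (pi * \<alpha> / 2) * (- Gamma (- \<alpha>))" by simp
  also have "\<dots> = pi / (2 * Gamma (1 + \<alpha>) * sin (pi * \<alpha> / 2))"
    unfolding \<open>- Gamma (- \<alpha>) = _\<close> using half_angle_pos by simp
  finally have "- cos (pi * \<alpha> / 2) * Gamma (- \<alpha>) = pi / (2 * Gamma (1 + \<alpha>) * sin (pi * \<alpha> / 2))" .
  then show ?thesis unfolding C_const_def sin_shift by simp
qed

lemma C_const_pos: "0 < C_const \<alpha> \<beta>"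
  unfolding C_const_eq using half_angle_pos(1) \<alpha> Gamma_real_pos[of "1 + \<alpha>"]
  by (intro divide_pos_pos mult_pos_pos add_pos_nonneg) auto

text \<open>The function \<phi> of the overview, given by its closed value;
  \<open>potential_integrand_integral\<close> recovers the Fourier integral.\<close>

definition potential :: "real \<Rightarrow> real" where
  "potential w = C_const \<alpha> \<beta> * (1 + \<beta> * sgn w) * \<bar>w\<bar> powr \<alpha>"

definition potential_integrand :: "real \<Rightarrow> real \<Rightarrow> complex" where
  "potential_integrand w l = (1 - iexp (- (l * w))) / stable_exponent \<alpha> \<beta> l / of_real (2 * pi)"

text \<open>The factor \<open>min 1 |l|\<close> is what a zero of the numerator at the origin
  provides; against the lower bound \<open>|l|^(\<alpha>+1)\<close> for the exponent it leaves
  exactly the function of \<open>integrable_min_powr\<close>.\<close>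

lemma integrable_div_stable_exponent:
  assumes [measurable]: "f \<in> borel_measurable borel" and f: "\<And>l. norm (f l) \<le> K * min 1 \<bar>l\<bar>"
  shows "integrable lborel (\<lambda>l. f l / stable_exponent \<alpha> \<beta> l)"
proof (rule Bochner_Integration.integrable_bound)
  show "integrable lborel (\<lambda>l::real. K * (min 1 \<bar>l\<bar> * \<bar>l\<bar> powr (- 1 - \<alpha>)))"
    by (intro integrable_mult_right integrable_min_powr \<alpha>)
  have "norm (f l / stable_exponent \<alpha> \<beta> l) \<le> K * (min 1 \<bar>l\<bar> * \<bar>l\<bar> powr (- 1 - \<alpha>))" for l
  proof (cases "l = 0")
    case False
    have "norm (f l / stable_exponent \<alpha> \<beta> l) \<le> K * min 1 \<bar>l\<bar> / \<bar>l\<bar> powr (\<alpha> + 1)"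
      unfolding norm_divide using f[of l] norm_stable_exponent_ge[of l \<alpha> \<beta>] False norm_ge_zero[of "f l"]
      by (intro frac_le) (auto simp del: norm_ge_zero intro: order_trans)
    also have "\<dots> = K * (min 1 \<bar>l\<bar> * \<bar>l\<bar> powr (- 1 - \<alpha>))"
      using False by (simp add: powr_minus powr_diff powr_add field_simps)
    finally show ?thesis .
  qed simp
  then show "AE x in lborel. norm (f x / stable_exponent \<alpha> \<beta> x) \<le> norm (K * (min 1 \<bar>x\<bar> * \<bar>x\<bar> powr (- 1 - \<alpha>)))"
    by (intro AE_I2) (metis abs_ge_self order_trans real_norm_def)
qed measurable

text \<open>On \<open>l > 0\<close> the exponent is a constant \<open>z\<close> times a power, and
  negative \<open>l\<close> give the complex conjugate, so the integral is twice the real part of a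
  half-line integral. Scaling reduces that one to the Mellin integral \<open>J\<close> or its
  conjugate, according to the sign of \<open>w\<close>.\<close>

lemma potential_integrand_integral:
  "has_bochner_integral lborel (potential_integrand w) (of_real (potential w))"
proof (cases "w = 0")
  case True
  then show ?thesis by (auto simp: potential_integrand_def[abs_def] potential_def has_bochner_integral_zero)
next
  case w: False
  define \<tau> where "\<tau> = tan ((\<alpha> + 1) * pi / 2)"
  define D where "D = 1 + \<beta>\<^sup>2 * \<tau>\<^sup>2"
  have D: "D > 0" unfolding D_def by (intro add_pos_nonneg) auto
  define z where "z = Complex 1 (- \<beta> * \<tau>)"
  have Z: "stable_exponent \<alpha> \<beta> l = of_real (\<bar>l\<bar> powr (\<alpha> + 1)) * (if l > 0 then z else cnj z)" for l
    by (cases "l = 0") (auto simp: stable_exponent_def z_def \<tau>_def complex_eq_iff sgn_if)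
  have zz: "z * cnj z = of_real D" by (simp add: z_def D_def complex_eq_iff power2_eq_square)
  have zn: "z \<noteq> 0" by (simp add: z_def complex_eq_iff)
  define J where "J = of_real (pi / (2 * Gamma (1 + \<alpha>))) * Complex (1 / sin (pi * \<alpha> / 2)) (- 1 / cos (pi * \<alpha> / 2))"
  have M: "has_bochner_integral lborel (\<lambda>u. indicator {0<..} u *\<^sub>R ((1 - iexp u) * of_real (u powr (- 1 - \<alpha>)))) J"
    unfolding J_def by (rule Mellin_one_minus_iexp) (use \<alpha> in auto)
  have Mc: "has_bochner_integral lborel (\<lambda>u. indicator {0<..} u *\<^sub>R ((1 - iexp (- u)) * of_real (u powr (- 1 - \<alpha>)))) (cnj J)"
    using has_bochner_integral_bounded_linear[OF bounded_linear_cnj M]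
    by (simp add: exp_cnj mult_ac)
  define Jw where "Jw = (if w > 0 then cnj J else J)"
  have H: "has_bochner_integral lborel (\<lambda>l. indicator {0<..} l *\<^sub>R ((1 - iexp (- (l * w))) * of_real (l powr (- 1 - \<alpha>))))
      (of_real (\<bar>w\<bar> powr \<alpha>) * Jw)"
  proof -
    \<comment> \<open>Substituting \<open>u = |w| * l\<close> turns \<open>l * w\<close> into
      \<open>u * sgn w\<close>; what remains of the powers of \<open>|w|\<close> is
      \<open>|w|^(1+\<alpha>) / |w|\<close>.\<close>
    let ?f = "\<lambda>u. indicator {0<..} u *\<^sub>R ((1 - iexp (- (u * sgn w))) * complex_of_real (u powr (- 1 - \<alpha>)))"
    let ?A = "complex_of_real (\<bar>w\<bar> powr (1 + \<alpha>))"
    have "has_bochner_integral lborel ?f Jw"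
      using M Mc w by (cases "w > 0") (auto simp: Jw_def)
    then have "has_bochner_integral lborel (\<lambda>l. ?f (0 + \<bar>w\<bar> * l))
       (Jw /\<^sub>R \<bar>\<bar>w\<bar>\<bar>)"
      by (rule lborel_has_bochner_integral_real_affine_iff[THEN iffD1, rotated]) (use w in auto)
    then have "has_bochner_integral lborel (\<lambda>l. ?A * (?f (0 + \<bar>w\<bar> * l)))
       (?A * (Jw /\<^sub>R \<bar>\<bar>w\<bar>\<bar>))"
      by (rule has_bochner_integral_mult_right)
    also have "?A * (Jw /\<^sub>R \<bar>\<bar>w\<bar>\<bar>) = of_real (\<bar>w\<bar> powr \<alpha>) * Jw"
      using w by (simp add: powr_add scaleR_conv_of_real field_simps)
    also have "(\<lambda>l. ?A * (?f (0 + \<bar>w\<bar> * l)))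
       = (\<lambda>l. indicator {0<..} l *\<^sub>R ((1 - iexp (- (l * w))) * of_real (l powr (- 1 - \<alpha>))))"
    proof
      fix l :: real
      have "\<bar>w\<bar> * l * sgn w = l * w" by (simp add: abs_mult_sgn mult.commute mult.left_commute)
      moreover have "\<bar>w\<bar> powr (1 + \<alpha>) * (\<bar>w\<bar> * l) powr (- 1 - \<alpha>) = l powr (- 1 - \<alpha>)" if "l > 0"
        using that w by (simp add: powr_mult powr_add[symmetric] flip: mult.assoc)
      then have "?A * of_real ((\<bar>w\<bar> * l) powr (- 1 - \<alpha>)) = of_real (l powr (- 1 - \<alpha>))" if "l > 0"
        using that by (simp flip: of_real_mult)
      moreover have "indicator {0<..} (0 + \<bar>w\<bar> * l) = (indicator {0<..} l :: real)"
        using w by (auto simp: indicator_def zero_less_mult_iff)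
      ultimately show "?A * (?f (0 + \<bar>w\<bar> * l))
       = indicator {0<..} l *\<^sub>R ((1 - iexp (- (l * w))) * of_real (l powr (- 1 - \<alpha>)))"
        by (cases "l > 0") (simp_all only: add_0_left mult_scaleR_right mult.left_commute[of "complex_of_real (\<bar>w\<bar> powr (1 + \<alpha>))"], simp_all)
    qed
    finally show ?thesis .
  qed
  have P: "has_bochner_integral lborel (\<lambda>l. indicator {0<..} l *\<^sub>R ((1 - iexp (- (l * w))) / stable_exponent \<alpha> \<beta> l))
      (of_real (\<bar>w\<bar> powr \<alpha>) * Jw / z)"
  proof -
    have "has_bochner_integral lborel (\<lambda>l. indicator {0<..} l *\<^sub>R ((1 - iexp (- (l * w))) * of_real (l powr (- 1 - \<alpha>))) / z)
      (of_real (\<bar>w\<bar> powr \<alpha>) * Jw / z)"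
      by (intro has_bochner_integral_divide H)
    also have "(\<lambda>l. indicator {0<..} l *\<^sub>R ((1 - iexp (- (l * w))) * of_real (l powr (- 1 - \<alpha>))) / z)
       = (\<lambda>l. indicator {0<..} l *\<^sub>R ((1 - iexp (- (l * w))) / stable_exponent \<alpha> \<beta> l))"
      by (auto simp: fun_eq_iff indicator_def Z powr_minus powr_diff powr_add field_simps)
    finally show ?thesis .
  qed
  \<comment> \<open>The reflection of \<open>P\<close>: under \<open>l\<close> to \<open>- l\<close>
    both the exponential and the exponent are conjugated.\<close>
  have N: "has_bochner_integral lborel (\<lambda>l. indicator {..<0} l *\<^sub>R ((1 - iexp (- (l * w))) / stable_exponent \<alpha> \<beta> l))
      (cnj (of_real (\<bar>w\<bar> powr \<alpha>) * Jw / z))"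
  proof -
    have "has_bochner_integral lborel (\<lambda>l. cnj (indicator {0<..} l *\<^sub>R ((1 - iexp (- (l * w))) / stable_exponent \<alpha> \<beta> l)))
        (cnj (of_real (\<bar>w\<bar> powr \<alpha>) * Jw / z))"
      by (rule has_bochner_integral_bounded_linear[OF bounded_linear_cnj P])
    then have "has_bochner_integral lborel (\<lambda>l. cnj (indicator {0<..} (0 + (-1) * l) *\<^sub>R ((1 - iexp (- ((0 + (-1) * l) * w))) / stable_exponent \<alpha> \<beta> (0 + (-1) * l))))
       ((cnj (of_real (\<bar>w\<bar> powr \<alpha>) * Jw / z)) /\<^sub>R \<bar>-1\<bar>)"
      by (rule lborel_has_bochner_integral_real_affine_iff[THEN iffD1, rotated]) auto
    also have "(\<lambda>l. cnj (indicator {0<..} (0 + (-1) * l) *\<^sub>R ((1 - iexp (- ((0 + (-1) * l) * w))) / stable_exponent \<alpha> \<beta> (0 + (-1) * l))))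
       = (\<lambda>l. indicator {..<0} l *\<^sub>R ((1 - iexp (- (l * w))) / stable_exponent \<alpha> \<beta> l))"
      by (auto simp: fun_eq_iff indicator_def Z exp_cnj)
    finally show ?thesis by simp
  qed
  have "has_bochner_integral lborel (\<lambda>l. (indicator {0<..} l *\<^sub>R ((1 - iexp (- (l * w))) / stable_exponent \<alpha> \<beta> l)
     + indicator {..<0} l *\<^sub>R ((1 - iexp (- (l * w))) / stable_exponent \<alpha> \<beta> l)) / of_real (2 * pi))
     ((of_real (\<bar>w\<bar> powr \<alpha>) * Jw / z + cnj (of_real (\<bar>w\<bar> powr \<alpha>) * Jw / z)) / of_real (2 * pi))"
    by (intro has_bochner_integral_divide has_bochner_integral_add P N)
  also have "(\<lambda>l. (indicator {0<..} l *\<^sub>R ((1 - iexp (- (l * w))) / stable_exponent \<alpha> \<beta> l)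
     + indicator {..<0} l *\<^sub>R ((1 - iexp (- (l * w))) / stable_exponent \<alpha> \<beta> l)) / of_real (2 * pi))
     = potential_integrand w"
    unfolding potential_integrand_def by (rule ext) (auto simp: indicator_def)
  also have "(of_real (\<bar>w\<bar> powr \<alpha>) * Jw / z + cnj (of_real (\<bar>w\<bar> powr \<alpha>) * Jw / z)) / of_real (2 * pi)
     = of_real (Re (of_real (\<bar>w\<bar> powr \<alpha>) * Jw / z) / pi)"
    unfolding complex_add_cnj by simp
  also have "Re (of_real (\<bar>w\<bar> powr \<alpha>) * Jw / z) / pi = potential w"
  proof -
    have "Jw / z = Jw * cnj z / of_real D" using zn D unfolding zz [symmetric] by simp
    then have "Re (of_real (\<bar>w\<bar> powr \<alpha>) * Jw / z) = \<bar>w\<bar> powr \<alpha> * Re (Jw * cnj z) / D"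
      by (simp add: add_divide_distrib flip: times_divide_eq_right)
    \<comment> \<open>Since \<tau> is minus the cotangent of \<open>pi * \<alpha> / 2\<close>,
      multiplying it by one over the cosine gives minus one over the sine. Both products thus share
      one factor, and \<open>1 + \<beta> * sgn w\<close> is left.\<close>
    also have "Re (Jw * cnj z) = pi / (2 * Gamma (1 + \<alpha>) * sin (pi * \<alpha> / 2)) * (1 + \<beta> * sgn w)"
    proof -
      have "\<tau> = - cos (pi * \<alpha> / 2) / sin (pi * \<alpha> / 2)" unfolding \<tau>_def by (rule tan_shift)
      moreover have "Gamma (1 + \<alpha>) > 0" using \<alpha> by (simp add: Gamma_real_pos)
      ultimately show ?thesis using w half_angle_pos unfolding Jw_def J_def z_def
        by (simp only:) (auto simp: field_simps)
    qed
    finally show ?thesis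
      unfolding potential_def C_const_eq \<tau>_def [symmetric] D_def [symmetric] by (simp add: mult_ac)
  qed
  finally show ?thesis .
qed

end

section \<open>Entrance times of right-continuous paths\<close>

text \<open>Right-continuity alone carries the discretisation; left limits enter only in the
  quasi-left-continuity.\<close>

definition right_cont :: "(real \<Rightarrow> real) \<Rightarrow> bool" where
  "right_cont w \<longleftrightarrow> (\<forall>t\<ge>0. (w \<longlongrightarrow> w t) (at_right t))"

text \<open>The filter \<open>at_right a\<close> leaves out \<open>a\<close>, whereas the sequence
  may sit at \<open>a\<close>, where convergence is trivial.\<close>

lemma tendsto_at_right_seq:
  fixes w :: "real \<Rightarrow> 'b::topological_space"
  assumes "(w \<longlongrightarrow> w a) (at_right a)" "r \<longlonglongrightarrow> a" "\<And>n. a \<le> r n"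
  shows "(\<lambda>n. w (r n)) \<longlonglongrightarrow> w a"
  unfolding tendsto_def
proof (intro allI impI)
  fix U assume U: "open U" "w a \<in> U"
  then have "\<forall>\<^sub>F x in at_right a. w x \<in> U" using assms(1) by (auto simp: tendsto_def)
  then obtain b where b: "b > a" "\<And>x. a < x \<Longrightarrow> x < b \<Longrightarrow> w x \<in> U"
    by (auto simp: eventually_at_right_field)
  have "\<forall>\<^sub>F n in sequentially. r n < b" using assms(2) b(1) by (auto simp: order_tendsto_iff)
  then show "\<forall>\<^sub>F n in sequentially. w (r n) \<in> U"
  proof eventually_elim
    case (elim n)
    then show ?case using b(2)[of "r n"] U(2) assms(3)[of n] by (cases "r n = a") auto
  qed
qed

lemma right_cont_seq:
  assumes "right_cont w" "r \<longlonglongrightarrow> a" "\<And>n. a \<le> r n" "0 \<le> a"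
  shows "(\<lambda>n. w (r n)) \<longlonglongrightarrow> w a"
  using assms by (auto simp: right_cont_def intro!: tendsto_at_right_seq[where w = w and a = a and r = r])

text \<open>Riemann sums are taken at right endpoints, so that right-continuity suffices for their
  convergence and no count of discontinuities is needed.\<close>

definition next_dyadic :: "nat \<Rightarrow> real \<Rightarrow> real" where
  "next_dyadic n v = real_of_int (\<lfloor>v * 2 ^ n\<rfloor> + 1) / 2 ^ n"

lemma next_dyadic_bounds: "v < next_dyadic n v" "next_dyadic n v \<le> v + 1 / 2 ^ n"
proof -
  have "v * 2 ^ n < real_of_int (\<lfloor>v * 2 ^ n\<rfloor> + 1)" "real_of_int (\<lfloor>v * 2 ^ n\<rfloor> + 1) \<le> v * 2 ^ n + 1" by linarith+
  then show "v < next_dyadic n v" "next_dyadic n v \<le> v + 1 / 2 ^ n"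
    by (auto simp: next_dyadic_def field_simps)
qed

lemma next_dyadic_tendsto: "(\<lambda>n. next_dyadic n v) \<longlonglongrightarrow> v"
proof (rule tendsto_sandwich[OF _ _ tendsto_const])
  have "(\<lambda>n. v + 1 / 2 ^ n :: real) \<longlonglongrightarrow> v + 0"
    by (intro tendsto_add tendsto_const) (use LIMSEQ_inverse_realpow_zero[of 2] in \<open>simp add: divide_inverse\<close>)
  then show "(\<lambda>n. v + 1 / 2 ^ n :: real) \<longlonglongrightarrow> v" by simp
qed (auto simp: next_dyadic_bounds less_imp_le)

lemma next_dyadic_nat: "0 \<le> v \<Longrightarrow> next_dyadic n v = real (nat \<lfloor>v * 2 ^ n\<rfloor> + 1) / 2 ^ n"
  by (simp add: next_dyadic_def)

section \<open>Dyadic approximation of entrance times\<close>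

definition stays :: "(real \<Rightarrow> real) \<Rightarrow> real \<Rightarrow> real \<Rightarrow> nat \<Rightarrow> nat \<Rightarrow> bool" where
  "stays w s e n k \<longleftrightarrow> (\<forall>i\<le>k. s \<le> real i / 2 ^ n \<longrightarrow> e \<le> \<bar>w (real i / 2 ^ n)\<bar>)"

text \<open>As \<open>stays\<close> is downward closed in \<open>k\<close>, this is the first dyadic index at which it fails, capped
  at \<open>t * 2 ^ n\<close>.\<close>

definition stop_index :: "(real \<Rightarrow> real) \<Rightarrow> real \<Rightarrow> real \<Rightarrow> nat \<Rightarrow> nat \<Rightarrow> nat" where
  "stop_index w s e t n = card {k. k < t * 2 ^ n \<and> stays w s e n k}"

text \<open>The cap \<open>t\<close> keeps the set nonempty and is the value when nothing is
  entered. The strict inequality makes the target open, which is what lets dyadic times detect the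
  entrance.\<close>

definition stop_time :: "(real \<Rightarrow> real) \<Rightarrow> real \<Rightarrow> real \<Rightarrow> nat \<Rightarrow> real" where
  "stop_time w s e t = Inf (insert (real t) {v. s \<le> v \<and> v \<le> t \<and> \<bar>w v\<bar> < e})"

lemma downward_closed_eq_lessThan_card:
  fixes S :: "nat set"
  assumes "finite S" "\<And>i j. i \<le> j \<Longrightarrow> j \<in> S \<Longrightarrow> i \<in> S"
  shows "S = {..<card S}"
proof -
  define m where "m = (LEAST m. m \<notin> S)"
  have "\<exists>m. m \<notin> S" using assms(1) ex_new_if_finite infinite_UNIV_nat by blast
  then have m: "m \<notin> S" "\<And>k. k < m \<Longrightarrow> k \<in> S"
    unfolding m_def using LeastI_ex[of "\<lambda>m. m \<notin> S"] not_less_Least[of _ "\<lambda>m. m \<notin> S"] by blast+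
  have "k < m" if "k \<in> S" for k
  proof (rule ccontr)
    assume "\<not> k < m"
    then show False using assms(2)[of m k] that m(1) by simp
  qed
  then have "S = {..<m}" using m(2) by auto
  then show ?thesis by simp
qed

lemma stays_iff_less_stop_index:
  assumes "k < t * 2 ^ n"
  shows "stays w s e n k \<longleftrightarrow> k < stop_index w s e t n"
proof -
  have "{k. k < t * 2 ^ n \<and> stays w s e n k} = {..<stop_index w s e t n}"
    unfolding stop_index_def
    by (rule downward_closed_eq_lessThan_card) (auto simp: stays_def)
  then show ?thesis using assms by blast
qed

lemma stop_index_le: "stop_index w s e t n \<le> t * 2 ^ n"
  unfolding stop_index_def by (rule order_trans[OF card_mono[of "{..<t * 2 ^ n}"]]) auto

context
  fixes w :: "real \<Rightarrow> real" and s e :: real and t :: nat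
  assumes s: "0 \<le> s" "s \<le> t"
begin

private abbreviation "A \<equiv> insert (real t) {v. s \<le> v \<and> v \<le> t \<and> \<bar>w v\<bar> < e}"

lemma bdd_below_stop: "bdd_below A"
  using s by (intro bdd_belowI[of _ s]) auto

lemma stop_time_bounds: "s \<le> stop_time w s e t" "stop_time w s e t \<le> t"
  using s bdd_below_stop unfolding stop_time_def
  by (auto intro!: cInf_greatest cInf_lower)

lemma before_stop_time:
  assumes "s \<le> v" "v < stop_time w s e t"
  shows "e \<le> \<bar>w v\<bar>"
proof (rule ccontr)
  assume "\<not> ?thesis"
  then have "v \<in> A" using assms stop_time_bounds(2) by auto
  then have "stop_time w s e t \<le> v" unfolding stop_time_def by (rule cInf_lower) (rule bdd_below_stop)
  then show False using assms by simp
qed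

lemma stop_time_less_ex:
  assumes "stop_time w s e t < v"
  obtains u where "u \<in> A" "stop_time w s e t \<le> u" "u < v"
proof -
  obtain u where "u \<in> A" "u < v"
    using assms cInf_lessD[of A v] unfolding stop_time_def by auto
  moreover from this have "stop_time w s e t \<le> u"
    unfolding stop_time_def by (intro cInf_lower bdd_below_stop)
  ultimately show ?thesis using that by blast
qed

text \<open>The approximation is from above: an index below its cap marks a dyadic time no earlier
  than some visit to the band, and every visit bounds the infimum. Hence right-continuity is enough
  to pass to the limit.\<close>

lemma stop_time_less_index: "stop_time w s e t \<le> real (stop_index w s e t n) / 2 ^ n"
proof (cases "stop_index w s e t n < t * 2 ^ n")
  case True
  then obtain i where i: "i \<le> stop_index w s e t n" "s \<le> real i / 2 ^ n" "\<bar>w (real i / 2 ^ n)\<bar> < e"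
    using stays_iff_less_stop_index[of "stop_index w s e t n" t n w s e] by (auto simp: stays_def not_le)
  have "i \<le> t * 2 ^ n" using i(1) True by simp
  then have "real i \<le> real (t * 2 ^ n)" unfolding of_nat_le_iff .
  then have "real i / 2 ^ n \<in> A" using i by (auto simp: field_simps)
  then have "stop_time w s e t \<le> real i / 2 ^ n"
    unfolding stop_time_def by (intro cInf_lower bdd_below_stop)
  also have "\<dots> \<le> real (stop_index w s e t n) / 2 ^ n" using i by (simp add: divide_right_mono)
  finally show ?thesis .
next
  case False
  then have "stop_index w s e t n = t * 2 ^ n" using stop_index_le[of w s e t n] by simp
  then show ?thesis using stop_time_bounds(2) by simp
qed

lemma stop_index_le_t: "real (stop_index w s e t n) / 2 ^ n \<le> t"
proof -
  have "real (stop_index w s e t n) \<le> real (t * 2 ^ n)" using stop_index_le of_nat_le_iff by blast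
  then show ?thesis by (simp add: field_simps)
qed

context
  assumes w: "right_cont w"
begin

text \<open>Only the weak inequality can hold: the infimum of the visits to an open band need not be
  a visit, and right-continuity leads no further than the closed band.\<close>

lemma at_stop_time:
  assumes "stop_time w s e t < t"
  shows "\<bar>w (stop_time w s e t)\<bar> \<le> e"
proof (rule ccontr)
  let ?T = "stop_time w s e t"
  assume "\<not> ?thesis"
  then have gt: "e < \<bar>w ?T\<bar>" by simp
  have "((\<lambda>v. \<bar>w v\<bar>) \<longlongrightarrow> \<bar>w ?T\<bar>) (at_right ?T)"
    using w stop_time_bounds s by (intro tendsto_intros) (auto simp: right_cont_def)
  then have "\<forall>\<^sub>F v in at_right ?T. e < \<bar>w v\<bar>" using gt by (rule order_tendstoD)
  then obtain b where b: "b > ?T" "\<And>v. ?T < v \<Longrightarrow> v < b \<Longrightarrow> e < \<bar>w v\<bar>"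
    by (auto simp: eventually_at_right_field)
  obtain u where "u \<in> A" "?T \<le> u" "u < min b t"
    by (rule stop_time_less_ex[of "min b t"]) (use assms b in auto)
  then show False using b(2)[of u] gt by (cases "u = ?T") auto
qed

text \<open>The lower bound is \<open>stop_time_less_index\<close>. For the upper one take a visit
  \<open>u\<close> just after the infimum: by right-continuity the dyadic times next to
  \<open>u\<close> also lie in the band for large \<open>n\<close>, and they bound the
  index.\<close>

lemma stop_index_tendsto: "(\<lambda>n. real (stop_index w s e t n) / 2 ^ n) \<longlonglongrightarrow> stop_time w s e t"
proof (rule order_tendstoI)
  fix a assume "a < stop_time w s e t"
  then show "\<forall>\<^sub>F n in sequentially. a < real (stop_index w s e t n) / 2 ^ n"
    by (intro always_eventually allI less_le_trans[OF _ stop_time_less_index])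
next
  fix a assume "stop_time w s e t < a"
  then obtain u where u: "u \<in> A" "stop_time w s e t \<le> u" "u < a" by (rule stop_time_less_ex)
  show "\<forall>\<^sub>F n in sequentially. real (stop_index w s e t n) / 2 ^ n < a"
  proof (cases "u = t")
    case True
    then show ?thesis using u(3) by (intro always_eventually allI le_less_trans[OF stop_index_le_t]) auto
  next
    case False
    then have u': "s \<le> u" "u \<le> t" "\<bar>w u\<bar> < e" using u(1) by auto
    have "(\<lambda>n. \<bar>w (next_dyadic n u)\<bar>) \<longlonglongrightarrow> \<bar>w u\<bar>"
      using u' s next_dyadic_bounds(1)[THEN less_imp_le]
      by (intro tendsto_rabs right_cont_seq[OF w] next_dyadic_tendsto) auto
    then have 1: "\<forall>\<^sub>F n in sequentially. \<bar>w (next_dyadic n u)\<bar> < e" using u'(3) by (rule order_tendstoD)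
    have 2: "\<forall>\<^sub>F n in sequentially. next_dyadic n u < a"
      using next_dyadic_tendsto u(3) by (rule order_tendstoD)
    show ?thesis using 1 2
    proof eventually_elim
      case (elim n)
      define i where "i = nat \<lfloor>u * 2 ^ n\<rfloor> + 1"
      have i: "next_dyadic n u = real i / 2 ^ n" using u' s by (simp add: next_dyadic_nat i_def)
      have "\<not> stays w s e n i"
        using elim(1) u'(1) next_dyadic_bounds(1)[of u n] unfolding i stays_def
        by (auto intro!: exI[of _ i])
      then have "stop_index w s e t n \<le> i"
        using stays_iff_less_stop_index[of i t n w s e] stop_index_le[of w s e t n] by (cases "i < t * 2 ^ n") auto
      then have "real (stop_index w s e t n) / 2 ^ n \<le> next_dyadic n u"
        unfolding i by (simp add: divide_right_mono)
      then show ?case using elim(2) by simp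
    qed
  qed
qed

lemma path_at_stop_index_tendsto:
  assumes "0 \<le> r"
  shows "(\<lambda>n. w (real (stop_index w s e t n) / 2 ^ n + r)) \<longlonglongrightarrow> w (stop_time w s e t + r)"
proof (rule right_cont_seq[OF w])
  show "(\<lambda>n. real (stop_index w s e t n) / 2 ^ n + r) \<longlonglongrightarrow> stop_time w s e t + r"
    by (intro tendsto_add stop_index_tendsto tendsto_const)
  show "0 \<le> stop_time w s e t + r" using assms s(1) stop_time_bounds(1) by linarith
  show "stop_time w s e t + r \<le> real (stop_index w s e t n) / 2 ^ n + r" for n
    using stop_time_less_index[of n] by linarith
qed

end
end

section \<open>Riemann sums up to the entrance time\<close>

lemma step_function_integral:
  fixes h :: "nat \<Rightarrow> complex"
  shows "has_bochner_integral lborel (\<lambda>v. indicator {0..<real K / 2 ^ n} v *\<^sub>R h (nat \<lfloor>v * 2 ^ n\<rfloor> + 1))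
     (\<Sum>k<K. h (k + 1) / 2 ^ n)"
proof (induction K)
  case 0
  then show ?case by (simp add: has_bochner_integral_zero)
next
  case (Suc K)
  have "has_bochner_integral lborel (\<lambda>v. indicator {real K / 2 ^ n..<real (Suc K) / 2 ^ n} v *\<^sub>R h (K + 1))
     (measure lborel {real K / 2 ^ n..<real (Suc K) / 2 ^ n} *\<^sub>R h (K + 1))"
    by (intro has_bochner_integral_scaleR_left has_bochner_integral_real_indicator)
      (use emeasure_bounded_finite[of "{real K / 2 ^ n..<real (Suc K) / 2 ^ n}"] in auto)
  also have "measure lborel {real K / 2 ^ n..<real (Suc K) / 2 ^ n} = 1 / 2 ^ n"
    by (simp add: divide_right_mono flip: diff_divide_distrib)
  finally have "has_bochner_integral lborel (\<lambda>v. indicator {0..<real K / 2 ^ n} v *\<^sub>R h (nat \<lfloor>v * 2 ^ n\<rfloor> + 1)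
      + indicator {real K / 2 ^ n..<real (Suc K) / 2 ^ n} v *\<^sub>R h (K + 1))
     ((\<Sum>k<K. h (k + 1) / 2 ^ n) + (1 / 2 ^ n) *\<^sub>R h (K + 1))"
    by (intro has_bochner_integral_add Suc.IH)
  also have "(\<lambda>v. indicator {0..<real K / 2 ^ n} v *\<^sub>R h (nat \<lfloor>v * 2 ^ n\<rfloor> + 1)
      + indicator {real K / 2 ^ n..<real (Suc K) / 2 ^ n} v *\<^sub>R h (K + 1))
    = (\<lambda>v. indicator {0..<real (Suc K) / 2 ^ n} v *\<^sub>R h (nat \<lfloor>v * 2 ^ n\<rfloor> + 1))"
  proof
    fix v :: real
    have "nat \<lfloor>v * 2 ^ n\<rfloor> = K" if "real K / 2 ^ n \<le> v" "v < real (Suc K) / 2 ^ n"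
    proof -
      have "real_of_int (int K) \<le> v * 2 ^ n" "v * 2 ^ n < real_of_int (int K) + 1" using that by (auto simp: field_simps)
      then have "\<lfloor>v * 2 ^ n\<rfloor> = int K" by (simp add: floor_eq_iff)
      then show ?thesis by simp
    qed
    moreover have "0 \<le> real K / 2 ^ n" "real K / 2 ^ n \<le> real (Suc K) / 2 ^ n" by (auto simp: divide_right_mono)
    moreover have "\<not> real K / 2 ^ n \<le> v" if "\<not> 0 \<le> v"
      using that \<open>0 \<le> real K / 2 ^ n\<close> by linarith
    ultimately show "indicator {0..<real K / 2 ^ n} v *\<^sub>R h (nat \<lfloor>v * 2 ^ n\<rfloor> + 1)
      + indicator {real K / 2 ^ n..<real (Suc K) / 2 ^ n} v *\<^sub>R h (K + 1)
      = indicator {0..<real (Suc K) / 2 ^ n} v *\<^sub>R h (nat \<lfloor>v * 2 ^ n\<rfloor> + 1)"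
      by (cases "0 \<le> v") (auto simp: indicator_def)
  qed
  also have "(\<Sum>k<K. h (k + 1) / 2 ^ n) + (1 / 2 ^ n) *\<^sub>R h (K + 1) = (\<Sum>k<Suc K. h (k + 1) / 2 ^ n)"
    by (simp add: scaleR_conv_of_real)
  finally show ?case .
qed

text \<open>A pointwise limit of functions that are constant between dyadic times. The truncation
  \<open>max 0\<close> is there because nothing is known of paths at negative times.\<close>

lemma right_cont_measurable:
  assumes "right_cont w"
  shows "(\<lambda>v. w (max 0 v)) \<in> borel_measurable borel"
proof (rule borel_measurable_LIMSEQ_metric)
  show "(\<lambda>v. w (max 0 (next_dyadic n v))) \<in> borel_measurable borel" for n
  proof -
    have "(\<lambda>v::real. (\<lambda>i::int. w (max 0 (real_of_int (i + 1) / 2 ^ n))) \<lfloor>v * 2 ^ n\<rfloor>) \<in> borel_measurable borel"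
      by (rule measurable_compose[where N="count_space UNIV"]) measurable
    then show ?thesis by (simp add: next_dyadic_def)
  qed
  show "(\<lambda>n. w (max 0 (next_dyadic n v))) \<longlonglongrightarrow> w (max 0 v)" for v
  proof (rule right_cont_seq[OF assms])
    show "(\<lambda>n. max 0 (next_dyadic n v)) \<longlonglongrightarrow> max 0 v"
      by (intro tendsto_max tendsto_const next_dyadic_tendsto)
    show "max 0 v \<le> max 0 (next_dyadic n v)" for n
      using next_dyadic_bounds(1)[of v n] by auto
  qed simp
qed

text \<open>Dominated convergence for step functions: the values converge by right-continuity, the
  end points by \<open>stop_index_tendsto\<close>.\<close>

lemma stop_index_integral_tendsto:
  fixes F :: "real \<Rightarrow> complex"
  assumes s: "0 \<le> s" "s \<le> real t" and w: "right_cont w"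
    and F: "continuous_on UNIV F" "\<And>z. norm (F z) \<le> B"
  shows "(\<lambda>n. \<Sum>k<stop_index w s e t n. F (w (real (k + 1) / 2 ^ n)) / 2 ^ n)
     \<longlonglongrightarrow> (LINT v:{0..<stop_time w s e t}|lborel. F (w v))"
proof -
  let ?T = "stop_time w s e t" and ?K = "stop_index w s e t"
  have [measurable]: "F \<in> borel_measurable borel" using F(1) by (rule borel_measurable_continuous_onI)
  note [measurable] = right_cont_measurable[OF w]
  have B: "0 \<le> B" using F(2)[of 0] norm_ge_zero order_trans by blast
  have Feq: "indicator {0..<T} v *\<^sub>R F (w v) = indicator {0..<T} v *\<^sub>R F (w (max 0 v))" for T v :: real
    by (auto simp: indicator_def max_def)
  have "(\<lambda>n. LINT v|lborel. indicator {0..<real (?K n) / 2 ^ n} v *\<^sub>R F (w (real (nat \<lfloor>v * 2 ^ n\<rfloor> + 1) / 2 ^ n)))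
     \<longlonglongrightarrow> (LINT v|lborel. indicator {0..<?T} v *\<^sub>R F (w v))"
  proof (rule integral_dominated_convergence)
    show "(\<lambda>v. indicator {0..<?T} v *\<^sub>R F (w v)) \<in> borel_measurable lborel"
      unfolding Feq by measurable
    show "(\<lambda>v. indicator {0..<real (?K n) / 2 ^ n} v *\<^sub>R F (w (real (nat \<lfloor>v * 2 ^ n\<rfloor> + 1) / 2 ^ n))) \<in> borel_measurable lborel" for n
      using step_function_integral[of "?K n" n "\<lambda>k. F (w (real k / 2 ^ n))"] by (simp add: has_bochner_integral_iff)
    show "integrable lborel (\<lambda>v. B * indicator {0..real t} v)" by simp
    show "AE v in lborel. norm (indicator {0..<real (?K n) / 2 ^ n} v *\<^sub>R F (w (real (nat \<lfloor>v * 2 ^ n\<rfloor> + 1) / 2 ^ n)))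
       \<le> B * indicator {0..real t} v" for n
      using F(2) B stop_index_le_t[OF s, of w e n] by (intro AE_I2) (auto simp: indicator_def)
    show "AE v in lborel. (\<lambda>n. indicator {0..<real (?K n) / 2 ^ n} v *\<^sub>R F (w (real (nat \<lfloor>v * 2 ^ n\<rfloor> + 1) / 2 ^ n)))
       \<longlonglongrightarrow> indicator {0..<?T} v *\<^sub>R F (w v)"
      \<comment> \<open>At \<open>v = ?T\<close> the indicators need not converge, since the dyadic
        times may stay strictly above \<open>?T\<close>.\<close>
      using AE_lborel_singleton[of ?T]
    proof eventually_elim
      case (elim v)
      show ?case
      proof (cases "v < 0")
        case False
        then have v: "0 \<le> v" by simp
        have "(\<lambda>n. w (next_dyadic n v)) \<longlonglongrightarrow> w v"
          using v next_dyadic_bounds(1)[THEN less_imp_le] by (intro right_cont_seq[OF w] next_dyadic_tendsto) auto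
        then have 1: "(\<lambda>n. F (w (next_dyadic n v))) \<longlonglongrightarrow> F (w v)"
          by (rule continuous_on_tendsto_compose[OF F(1)]) auto
        have 2: "(\<lambda>n. indicator {0..<real (?K n) / 2 ^ n} v :: real) \<longlonglongrightarrow> indicator {0..<?T} v"
        proof (cases "v < ?T")
          case True
          then have "v < real (?K n) / 2 ^ n" for n
            using stop_time_less_index[OF s, of w e n] by linarith
          then show ?thesis using v True by (simp add: indicator_def)
        next
          case False
          then have "?T < v" using elim by simp
          then have "\<forall>\<^sub>F n in sequentially. real (?K n) / 2 ^ n < v"
            using stop_index_tendsto[OF s w] by (rule order_tendstoD[rotated])
          then show ?thesis using False by (intro tendsto_eventually) (auto elim!: eventually_mono simp: indicator_def)
        qed
        from tendsto_scaleR[OF 2 1] show ?thesis using v by (simp only: next_dyadic_nat)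
      qed simp
    qed
  qed
  then show ?thesis
    unfolding set_lebesgue_integral_def
    using step_function_integral[where h="\<lambda>k. F (w (real k / 2 ^ n))" and n=n for n]
    by (simp add: has_bochner_integral_iff)
qed

section \<open>Local times as limits of occupation integrals\<close>

lemma normal_density_le_tail:
  assumes "0 < \<sigma>" "0 \<le> d" "d \<le> \<bar>z - y\<bar>"
  shows "normal_density y \<sigma> z \<le> normal_density 0 \<sigma> d"
proof -
  have "d\<^sup>2 \<le> (z - y)\<^sup>2" using assms by (simp add: abs_le_square_iff [symmetric])
  then show ?thesis using assms unfolding normal_density_def
    by (intro mult_left_mono) (auto intro!: divide_right_mono)
qed

lemma normal_density_le_max: "0 < \<sigma> \<Longrightarrow> normal_density y \<sigma> z \<le> normal_density 0 \<sigma> 0"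
  by (rule normal_density_le_tail) auto

context
  fixes w :: "real \<Rightarrow> real" and l :: "real \<Rightarrow> real \<Rightarrow> real"
  assumes w: "right_cont w"
    and l_nonneg: "\<And>y t. 0 \<le> t \<Longrightarrow> 0 \<le> l y t"
    and l_cont: "continuous_on (UNIV \<times> {0..}) (\<lambda>(y, t). l y t)"
    and l_occ: "\<And>t A. 0 \<le> t \<Longrightarrow> A \<in> sets borel \<Longrightarrow>
       emeasure lborel {s \<in> {0..t}. w s \<in> A} = (\<integral>\<^sup>+y\<in>A. ennreal (l y t) \<partial>lborel)"
begin

lemma local_time_continuous_space: "0 \<le> t \<Longrightarrow> continuous_on UNIV (\<lambda>y. l y t)"
  using continuous_on_compose2[OF l_cont continuous_on_Pair[OF continuous_on_id continuous_on_const[of UNIV t]]] by auto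

lemma local_time_continuous_time: "continuous_on {0..} (l y)"
  using continuous_on_compose2[OF l_cont continuous_on_Pair[OF continuous_on_const[of "{0..}" y] continuous_on_id]] by auto

lemma local_time_measurable: "0 \<le> t \<Longrightarrow> (\<lambda>y. l y t) \<in> borel_measurable borel"
  by (intro borel_measurable_continuous_onI local_time_continuous_space)

text \<open>The identity for sets says that the image of Lebesgue measure on \<open>{0..t}\<close>
  under the path has the density \<open>l y t\<close>; an equality of measures extends to integrals
  of functions.\<close>

lemma occupation_formula:
  assumes t: "0 \<le> t" and [measurable]: "f \<in> borel_measurable borel"
  shows "(\<integral>\<^sup>+v\<in>{0..t}. f (w v) \<partial>lborel) = (\<integral>\<^sup>+y. ennreal (l y t) * f y \<partial>lborel)"
proof -
  note [measurable] = right_cont_measurable[OF w] local_time_measurable[OF t]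
  have eq: "distr (density lborel (indicator {0..t})) borel (\<lambda>v. w (max 0 v)) = density lborel (\<lambda>y. ennreal (l y t))"
  proof (rule measure_eqI)
    fix A assume "A \<in> sets (distr (density lborel (indicator {0..t})) borel (\<lambda>v. w (max 0 v)))"
    then have [measurable]: "A \<in> sets borel" by simp
    have "emeasure (distr (density lborel (indicator {0..t})) borel (\<lambda>v. w (max 0 v))) A
       = (\<integral>\<^sup>+v. indicator {0..t} v * indicator ((\<lambda>v. w (max 0 v)) -` A) v \<partial>lborel)"
      using measurable_sets[OF right_cont_measurable[OF w], of A]
      by (simp add: emeasure_distr emeasure_density)
    also have "\<dots> = (\<integral>\<^sup>+v. indicator ({0..t} \<inter> (\<lambda>v. w (max 0 v)) -` A) v \<partial>lborel)"
      by (intro nn_integral_cong) (auto simp: indicator_def)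
    also have "\<dots> = emeasure lborel ({0..t} \<inter> (\<lambda>v. w (max 0 v)) -` A)"
      using measurable_sets[OF right_cont_measurable[OF w], of A] by (intro nn_integral_indicator) auto
    also have "{0..t} \<inter> (\<lambda>v. w (max 0 v)) -` A = {s \<in> {0..t}. w s \<in> A}" by auto
    also have "emeasure lborel \<dots> = (\<integral>\<^sup>+y\<in>A. ennreal (l y t) \<partial>lborel)" using t by (intro l_occ) auto
    finally show "emeasure (distr (density lborel (indicator {0..t})) borel (\<lambda>v. w (max 0 v))) A
       = emeasure (density lborel (\<lambda>y. ennreal (l y t))) A"
      by (simp add: emeasure_density)
  qed simp
  have "(\<integral>\<^sup>+v\<in>{0..t}. f (w v) \<partial>lborel) = (\<integral>\<^sup>+v. indicator {0..t} v * f (w (max 0 v)) \<partial>lborel)"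
    by (intro nn_integral_cong) (auto simp: indicator_def)
  also have "\<dots> = (\<integral>\<^sup>+y. f y \<partial>distr (density lborel (indicator {0..t})) borel (\<lambda>v. w (max 0 v)))"
    by (simp add: nn_integral_distr nn_integral_density)
  also have "\<dots> = (\<integral>\<^sup>+y. ennreal (l y t) * f y \<partial>lborel)"
    unfolding eq by (simp add: nn_integral_density)
  finally show ?thesis .
qed

lemma local_time_integrable:
  assumes t: "0 \<le> t"
  shows "has_bochner_integral lborel (\<lambda>y. l y t) t"
proof (rule has_bochner_integral_nn_integral)
  show "(\<integral>\<^sup>+y. ennreal (l y t) \<partial>lborel) = ennreal t"
    using occupation_formula[OF t, of "\<lambda>_. 1"] t by simp
qed (use t l_nonneg local_time_measurable in auto)

lemma occupation_integral_eq:
  assumes t: "0 \<le> t" and \<sigma>: "0 < \<sigma>"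
  shows "(LINT v:{0..<t}|lborel. normal_density y \<sigma> (w v)) = (LINT z|lborel. normal_density y \<sigma> z * l z t)"
    and "integrable lborel (\<lambda>z. normal_density y \<sigma> z * l z t)"
proof -
  note [measurable] = right_cont_measurable[OF w] local_time_measurable[OF t]
  show "integrable lborel (\<lambda>z. normal_density y \<sigma> z * l z t)"
  proof (rule Bochner_Integration.integrable_bound)
    show "integrable lborel (\<lambda>z. normal_density 0 \<sigma> 0 * l z t)"
      using local_time_integrable[OF t] by (auto simp: has_bochner_integral_iff)
    show "AE x in lborel. norm (normal_density y \<sigma> x * l x t) \<le> norm (normal_density 0 \<sigma> 0 * l x t)"
      using \<sigma> l_nonneg[OF t] normal_density_le_max[OF \<sigma>]
      by (intro AE_I2) (auto simp: abs_mult intro!: mult_right_mono)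
  qed simp
  have "(LINT v:{0..<t}|lborel. normal_density y \<sigma> (w v)) = (LINT v|lborel. indicator {0..<t} v * normal_density y \<sigma> (w (max 0 v)))"
    unfolding set_lebesgue_integral_def by (intro Bochner_Integration.integral_cong) (auto simp: indicator_def)
  also have "\<dots> = enn2real (\<integral>\<^sup>+v. ennreal (indicator {0..<t} v * normal_density y \<sigma> (w (max 0 v))) \<partial>lborel)"
    by (intro integral_eq_nn_integral) auto
  also have "(\<integral>\<^sup>+v. ennreal (indicator {0..<t} v * normal_density y \<sigma> (w (max 0 v))) \<partial>lborel)
     = (\<integral>\<^sup>+v\<in>{0..t}. ennreal (normal_density y \<sigma> (w v)) \<partial>lborel)"
    by (intro nn_integral_cong_AE, use AE_lborel_singleton[of t] in eventually_elim) (auto simp: indicator_def)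
  also have "\<dots> = (\<integral>\<^sup>+z. ennreal (l z t) * ennreal (normal_density y \<sigma> z) \<partial>lborel)"
    by (rule occupation_formula[OF t]) measurable
  also have "\<dots> = (\<integral>\<^sup>+z. ennreal (normal_density y \<sigma> z * l z t) \<partial>lborel)"
    using l_nonneg[OF t] by (intro nn_integral_cong) (simp add: ennreal_mult' mult.commute)
  also have "enn2real \<dots> = (LINT z|lborel. normal_density y \<sigma> z * l z t)"
    using l_nonneg[OF t] by (intro integral_eq_nn_integral [symmetric]) auto
  finally show "(LINT v:{0..<t}|lborel. normal_density y \<sigma> (w v)) = (LINT z|lborel. normal_density y \<sigma> z * l z t)" .
qed

text \<open>The normal densities form an approximate identity and \<open>l\<close> is continuous in
  space. No bound on \<open>l\<close> is at hand, so away from \<open>y\<close> its finite total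
  mass \<open>t\<close> is used instead.\<close>

lemma occupation_tendsto_local_time:
  assumes t: "0 \<le> t"
  shows "(\<lambda>j. LINT v:{0..<t}|lborel. normal_density y (inverse (real (Suc j))) (w v)) \<longlonglongrightarrow> l y t"
proof (rule LIMSEQ_I)
  note [measurable] = local_time_measurable[OF t]
  fix r :: real assume r: "0 < r"
  define \<sigma> where "\<sigma> j = inverse (real (Suc j))" for j
  have \<sigma>: "0 < \<sigma> j" for j by (simp add: \<sigma>_def)
  have "isCont (\<lambda>z. l z t) y" using local_time_continuous_space[OF t] by (simp add: continuous_on_eq_continuous_at)
  then obtain d where d: "d > 0" "\<And>z. \<bar>z - y\<bar> < d \<Longrightarrow> \<bar>l z t - l y t\<bar> < r / 2"
    unfolding continuous_at_eps_delta using r by (metis dist_real_def half_gt_zero)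
  \<comment> \<open>The terms are the oscillation of \<open>l\<close> within distance
    \<open>d\<close> of \<open>y\<close>, the mass of \<open>l\<close> farther away, and the normal
    tail, estimated by its second moment \<open>(\<sigma> j)\<^sup>2\<close>. The last two tend to
    0.\<close>
  define b where "b j = r / 2 + normal_density 0 (\<sigma> j) d * t + l y t / d\<^sup>2 * (\<sigma> j)\<^sup>2" for j
  have est: "\<bar>(LINT v:{0..<t}|lborel. normal_density y (\<sigma> j) (w v)) - l y t\<bar> \<le> b j" for j
  proof -
    let ?n = "normal_density y (\<sigma> j)"
    have n2: "has_bochner_integral lborel (\<lambda>z. ?n z * (z - y)\<^sup>2) ((\<sigma> j)\<^sup>2)"
    proof -
      have "fact (2 * 1) / ((2 / (\<sigma> j)\<^sup>2) ^ 1 * fact 1) = (\<sigma> j)\<^sup>2" by (simp add: fact_numeral)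
      then show ?thesis using normal_moment_even[OF \<sigma>[of j], where k=1 and \<mu>=y] by (simp only: mult_1_right)
    qed
    have n0: "has_bochner_integral lborel ?n 1"
      using \<sigma>[of j] by (simp add: has_bochner_integral_iff)
    have int: "integrable lborel (\<lambda>z. ?n z * l z t - ?n z * l y t)"
      using occupation_integral_eq(2)[OF t \<sigma>] \<sigma>[of j] by (intro Bochner_Integration.integrable_diff) auto
    have B: "has_bochner_integral lborel (\<lambda>z. r / 2 * ?n z + normal_density 0 (\<sigma> j) d * l z t + l y t / d\<^sup>2 * (?n z * (z - y)\<^sup>2))
       (r / 2 * 1 + normal_density 0 (\<sigma> j) d * t + l y t / d\<^sup>2 * (\<sigma> j)\<^sup>2)"
      by (intro has_bochner_integral_add has_bochner_integral_mult_right n0 n2 local_time_integrable t)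
    have "(LINT v:{0..<t}|lborel. ?n (w v)) - l y t = (LINT z|lborel. ?n z * l z t) - (LINT z|lborel. ?n z * l y t)"
      using \<sigma>[of j] by (simp add: occupation_integral_eq(1)[OF t \<sigma>])
    also have "\<dots> = (LINT z|lborel. ?n z * l z t - ?n z * l y t)"
      using occupation_integral_eq(2)[OF t \<sigma>] \<sigma>[of j] by (intro Bochner_Integration.integral_diff [symmetric]) auto
    finally have "\<bar>(LINT v:{0..<t}|lborel. ?n (w v)) - l y t\<bar> \<le> (LINT z|lborel. \<bar>?n z * l z t - ?n z * l y t\<bar>)"
      by simp
    also have "\<dots> \<le> (LINT z|lborel. r / 2 * ?n z + normal_density 0 (\<sigma> j) d * l z t + l y t / d\<^sup>2 * (?n z * (z - y)\<^sup>2))"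
    proof (rule integral_mono)
      fix z
      have nn: "0 \<le> ?n z" "0 \<le> l z t" "0 \<le> l y t" using l_nonneg[OF t] by auto
      show "\<bar>?n z * l z t - ?n z * l y t\<bar> \<le> r / 2 * ?n z + normal_density 0 (\<sigma> j) d * l z t + l y t / d\<^sup>2 * (?n z * (z - y)\<^sup>2)"
      proof (cases "\<bar>z - y\<bar> < d")
        case True
        have "\<bar>?n z * l z t - ?n z * l y t\<bar> = ?n z * \<bar>l z t - l y t\<bar>"
          using nn by (simp add: abs_mult flip: right_diff_distrib)
        also have "\<dots> \<le> ?n z * (r / 2)" using d(2)[OF True] nn by (intro mult_left_mono) auto
        finally show ?thesis using nn d(1) by (simp add: mult.commute add_increasing2)
      next
        case False
        have 1: "?n z * l z t \<le> normal_density 0 (\<sigma> j) d * l z t"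
          using False d(1) nn \<sigma> by (intro mult_right_mono normal_density_le_tail) auto
        have "d\<^sup>2 \<le> (z - y)\<^sup>2" using False d(1) by (simp add: abs_le_square_iff [symmetric])
        then have "1 \<le> (z - y)\<^sup>2 / d\<^sup>2" using d(1) by simp
        then have "?n z * l y t * 1 \<le> ?n z * l y t * ((z - y)\<^sup>2 / d\<^sup>2)" using nn by (intro mult_left_mono) auto
        then have 2: "?n z * l y t \<le> l y t / d\<^sup>2 * (?n z * (z - y)\<^sup>2)" by (simp add: mult_ac)
        have "0 \<le> r / 2 * ?n z" "0 \<le> ?n z * l z t" "0 \<le> ?n z * l y t" using nn r by auto
        with 1 2 show ?thesis by linarith
      qed
    qed (use int B in \<open>auto simp: has_bochner_integral_iff\<close>)
    also have "\<dots> = b j" using B by (simp add: has_bochner_integral_iff b_def)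
    finally show ?thesis .
  qed
  have "(\<lambda>j. normal_density 0 (\<sigma> j) d) \<longlonglongrightarrow> 0"
    unfolding \<sigma>_def normal_density_def using d(1) by real_asymp
  moreover have "(\<lambda>j. (\<sigma> j)\<^sup>2) \<longlonglongrightarrow> 0" unfolding \<sigma>_def by real_asymp
  ultimately have "b \<longlonglongrightarrow> r / 2 + 0 * t + l y t / d\<^sup>2 * 0"
    unfolding b_def[abs_def] by (intro tendsto_intros)
  then have "\<forall>\<^sub>F j in sequentially. b j < r" by (rule order_tendstoD(2)) (use r in simp)
  then show "\<exists>no. \<forall>n\<ge>no. norm ((LINT v:{0..<t}|lborel. normal_density y (inverse (real (Suc n))) (w v)) - l y t) < r"
    unfolding eventually_sequentially using est by (metis \<sigma>_def le_less_trans real_norm_def)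
qed

text \<open>Monotonicity in time is not part of \<open>local_times\<close>; it is inherited from the
  occupation integrals, which increase in time and converge to \<open>l\<close>.\<close>

lemma local_time_mono:
  assumes "0 \<le> a" "a \<le> b"
  shows "l y a \<le> l y b"
proof (rule LIMSEQ_le[OF occupation_tendsto_local_time occupation_tendsto_local_time])
  note [measurable] = right_cont_measurable[OF w]
  show "\<exists>N. \<forall>j\<ge>N. (LINT v:{0..<a}|lborel. normal_density y (inverse (real (Suc j))) (w v))
     \<le> (LINT v:{0..<b}|lborel. normal_density y (inverse (real (Suc j))) (w v))"
  proof (intro exI allI impI)
    fix j :: nat
    let ?n = "normal_density y (inverse (real (Suc j)))"
    have I: "integrable lborel (\<lambda>v. indicator {0..<T} v * ?n (w (max 0 v)))" if "0 \<le> T" for T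
    proof (rule Bochner_Integration.integrable_bound)
      show "integrable lborel (\<lambda>v. normal_density 0 (inverse (real (Suc j))) 0 * indicator {0..<T} v)"
        using that by (intro integrable_mult_right integrable_real_indicator) auto
      show "AE v in lborel. norm (indicator {0..<T} v * ?n (w (max 0 v))) \<le> norm (normal_density 0 (inverse (real (Suc j))) 0 * indicator {0..<T} v)"
        using normal_density_le_max[of "inverse (real (Suc j))"] by (intro AE_I2) (auto simp: indicator_def)
    qed simp
    have E: "(LINT v:{0..<T}|lborel. ?n (w v)) = (LINT v|lborel. indicator {0..<T} v * ?n (w (max 0 v)))" for T
      unfolding set_lebesgue_integral_def by (intro Bochner_Integration.integral_cong) (auto simp: indicator_def)
    show "(LINT v:{0..<a}|lborel. ?n (w v)) \<le> (LINT v:{0..<b}|lborel. ?n (w v))"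
      unfolding E using assms by (intro integral_mono I) (auto simp: indicator_def)
  qed
qed (use assms in auto)

end

section \<open>Fourier transforms\<close>

text \<open>Sign as in a characteristic function, and no factor 1/(2 pi): that factor is put into
  \<open>gauss\<close>, \<open>potential_integrand\<close> and \<open>G0\<close>.\<close>

definition ft :: "(real \<Rightarrow> complex) \<Rightarrow> real \<Rightarrow> complex" where
  "ft G z = (LINT l|lborel. G l * iexp (l * z))"

lemma norm_iexp_eq_1: "norm (iexp t) = 1"
  by (simp add: norm_exp_i_times)

lemma integrable_ft:
  assumes "integrable lborel G"
  shows "integrable lborel (\<lambda>l. G l * iexp (l * z))"
  by (rule Bochner_Integration.integrable_bound[OF assms])
    (use borel_measurable_integrable[OF assms] in \<open>auto simp: norm_mult norm_iexp_eq_1\<close>)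

lemma norm_ft_le: "norm (ft G z) \<le> (LINT l|lborel. norm (G l))"
proof -
  have "norm (ft G z) \<le> (LINT l|lborel. norm (G l * iexp (l * z)))" unfolding ft_def by (rule integral_norm_bound)
  then show ?thesis by (simp add: norm_mult norm_iexp_eq_1)
qed

lemma ft_diff:
  assumes "integrable lborel G" "integrable lborel H"
  shows "ft (\<lambda>l. G l - H l) z = ft G z - ft H z"
  unfolding ft_def left_diff_distrib
  by (rule Bochner_Integration.integral_diff[OF integrable_ft[OF assms(1)] integrable_ft[OF assms(2)]])

lemma ft_add:
  assumes "integrable lborel G" "integrable lborel H"
  shows "ft (\<lambda>l. G l + H l) z = ft G z + ft H z"
  unfolding ft_def distrib_right
  by (rule Bochner_Integration.integral_add[OF integrable_ft[OF assms(1)] integrable_ft[OF assms(2)]])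

lemma ft_cmult: "ft (\<lambda>l. c * G l) z = c * ft G z"
  unfolding ft_def by (simp add: mult.assoc)

lemma continuous_on_ft:
  assumes G: "integrable lborel G"
  shows "continuous_on UNIV (ft G)"
proof -
  note [measurable] = borel_measurable_integrable[OF G]
  have "(\<lambda>n. ft G (z n)) \<longlonglongrightarrow> ft G z0" if "z \<longlonglongrightarrow> z0" for z z0
    unfolding ft_def
  proof (rule integral_dominated_convergence)
    show "integrable lborel (\<lambda>l. norm (G l))" using G by (rule integrable_norm)
    show "AE l in lborel. (\<lambda>n. G l * iexp (l * z n)) \<longlonglongrightarrow> G l * iexp (l * z0)"
      using that by (intro AE_I2 tendsto_intros)
  qed (auto simp: norm_mult norm_iexp_eq_1)
  then show ?thesis by (auto simp: continuous_on_sequentially o_def)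
qed

lemma ft_measurable: "integrable lborel G \<Longrightarrow> ft G \<in> borel_measurable borel"
  by (intro borel_measurable_continuous_onI continuous_on_ft)

text \<open>Normalised so that its \<open>ft\<close> is the centred normal density of standard
  deviation \<sigma>.\<close>

definition gauss :: "real \<Rightarrow> real \<Rightarrow> complex" where
  "gauss \<sigma> l = of_real (exp (- (\<sigma> * l)\<^sup>2 / 2) / (2 * pi))"

lemma gauss_measurable [measurable]: "gauss \<sigma> \<in> borel_measurable borel"
  unfolding gauss_def[abs_def] by measurable

lemma norm_gauss: "norm (gauss \<sigma> l) = exp (- (\<sigma> * l)\<^sup>2 / 2) / (2 * pi)"
  by (simp add: gauss_def norm_divide)

lemma norm_gauss_le: "norm (gauss \<sigma> l) \<le> 1 / (2 * pi)"
  unfolding norm_gauss by (intro divide_right_mono) auto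

lemma gauss_fourier:
  assumes \<sigma>: "0 < \<sigma>"
  shows "has_bochner_integral lborel (\<lambda>l. gauss \<sigma> l * iexp (l * z)) (of_real (normal_density 0 \<sigma> z))"
proof -
  interpret S: real_distribution std_normal_distribution by (rule real_dist_normal_dist)
  \<comment> \<open>A Gaussian is its own transform up to scale, so the characteristic function of
    the standard normal law at \<open>z / \<sigma>\<close>, rescaled by \<sigma>, does the work of
    an inversion formula.\<close>
  define t where "t = z / \<sigma>"
  have 1: "has_bochner_integral std_normal_distribution (\<lambda>x. iexp (t * x)) (of_real (exp (- t\<^sup>2 / 2)))"
    using char_std_normal_distribution[THEN fun_cong, of t] S.integrable_iexp[of "\<lambda>x. t * x"]
    by (simp add: char_def has_bochner_integral_iff)
  have "has_bochner_integral lborel (\<lambda>x. std_normal_density x *\<^sub>R iexp (t * x)) (of_real (exp (- t\<^sup>2 / 2)))"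
    using 1 by (simp add: has_bochner_integral_iff integrable_density integral_density)
  then have "has_bochner_integral lborel (\<lambda>x. std_normal_density (0 + \<sigma> * x) *\<^sub>R iexp (t * (0 + \<sigma> * x))) (of_real (exp (- t\<^sup>2 / 2)) /\<^sub>R \<bar>\<sigma>\<bar>)"
    by (rule lborel_has_bochner_integral_real_affine_iff[THEN iffD1, rotated]) (use \<sigma> in auto)
  then have "has_bochner_integral lborel (\<lambda>x. of_real (1 / sqrt (2 * pi)) * (std_normal_density (0 + \<sigma> * x) *\<^sub>R iexp (t * (0 + \<sigma> * x))))
     (of_real (1 / sqrt (2 * pi)) * (of_real (exp (- t\<^sup>2 / 2)) /\<^sub>R \<bar>\<sigma>\<bar>))"
    by (rule has_bochner_integral_mult_right)
  also have "(\<lambda>x. of_real (1 / sqrt (2 * pi)) * (std_normal_density (0 + \<sigma> * x) *\<^sub>R iexp (t * (0 + \<sigma> * x))))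
     = (\<lambda>l. gauss \<sigma> l * iexp (l * z))"
  proof
    fix l
    have "1 / sqrt (2 * pi) * std_normal_density (0 + \<sigma> * l) = exp (- (\<sigma> * l)\<^sup>2 / 2) / (2 * pi)"
    proof -
      have "1 / sqrt (2 * pi) * (1 / sqrt (2 * pi) * e) = e / (2 * pi)" for e :: real by simp
      then show ?thesis unfolding std_normal_density_def by simp
    qed
    then have "complex_of_real (1 / sqrt (2 * pi)) * of_real (std_normal_density (0 + \<sigma> * l)) = gauss \<sigma> l"
      unfolding gauss_def of_real_mult [symmetric] by simp
    moreover have "t * (0 + \<sigma> * l) = l * z" using \<sigma> by (simp add: t_def)
    ultimately show "of_real (1 / sqrt (2 * pi)) * (std_normal_density (0 + \<sigma> * l) *\<^sub>R iexp (t * (0 + \<sigma> * l))) = gauss \<sigma> l * iexp (l * z)"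
      by (simp only: scaleR_conv_of_real mult.assoc [symmetric])
  qed
  also have "of_real (1 / sqrt (2 * pi)) * (of_real (exp (- t\<^sup>2 / 2)) /\<^sub>R \<bar>\<sigma>\<bar>) = complex_of_real (normal_density 0 \<sigma> z)"
    using \<sigma> by (simp add: normal_density_def t_def power_divide real_sqrt_mult scaleR_conv_of_real field_simps)
  finally show ?thesis .
qed

lemma integrable_gauss: "0 < \<sigma> \<Longrightarrow> integrable lborel (gauss \<sigma>)"
  using gauss_fourier[of \<sigma> 0] by (simp add: has_bochner_integral_iff)

lemma gauss_fourier_shift:
  assumes \<sigma>: "0 < \<sigma>"
  shows "ft (\<lambda>l. gauss \<sigma> l * iexp (- (l * y))) z = of_real (normal_density y \<sigma> z)"
proof -
  have "(\<lambda>l. gauss \<sigma> l * iexp (- (l * y)) * iexp (l * z)) = (\<lambda>l. gauss \<sigma> l * iexp (l * (z - y)))"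
    by (simp add: fun_eq_iff algebra_simps flip: exp_add)
  then show ?thesis using gauss_fourier[OF \<sigma>, of "z - y"]
    by (simp add: ft_def has_bochner_integral_iff normal_density_def)
qed

text \<open>The bridge from functions of the process to characteristic functions: after Fubini only
  weighted expectations of \<open>iexp (l * Z \<omega>)\<close> remain, and these are what
  independence computes.\<close>

lemma (in prob_space) expectation_ft:
  fixes F :: "'a \<Rightarrow> complex"
  assumes [measurable]: "F \<in> borel_measurable M" "Z \<in> borel_measurable M"
    and F: "\<And>\<omega>. \<omega> \<in> space M \<Longrightarrow> norm (F \<omega>) \<le> B" and G: "integrable lborel G"
  shows "expectation (\<lambda>\<omega>. F \<omega> * ft G (Z \<omega>)) = (LINT l|lborel. G l * expectation (\<lambda>\<omega>. F \<omega> * iexp (l * Z \<omega>)))"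
proof -
  interpret P: pair_sigma_finite M lborel ..
  note [measurable] = borel_measurable_integrable[OF G]
  have B: "0 \<le> B" using F not_empty norm_ge_zero order_trans by blast
  have "integrable (M \<Otimes>\<^sub>M lborel) (\<lambda>(\<omega>, l). F \<omega> * (G l * iexp (l * Z \<omega>)))"
  proof (rule P.Fubini_integrable)
    have "(LINT l|lborel. norm (F \<omega> * (G l * iexp (l * Z \<omega>)))) = norm (F \<omega>) * (LINT l|lborel. norm (G l))" for \<omega>
      by (simp add: norm_mult norm_iexp_eq_1)
    moreover have "integrable M (\<lambda>\<omega>. norm (F \<omega>) * (LINT l|lborel. norm (G l)))"
      using F by (intro integrable_mult_left integrable_norm integrable_const_bound[where B=B]) auto
    ultimately show "integrable M (\<lambda>\<omega>. LINT l|lborel. norm (case (\<omega>, l) of (\<omega>, l) \<Rightarrow> F \<omega> * (G l * iexp (l * Z \<omega>))))"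
      by simp
    show "AE \<omega> in M. integrable lborel (\<lambda>l. case (\<omega>, l) of (\<omega>, l) \<Rightarrow> F \<omega> * (G l * iexp (l * Z \<omega>)))"
      using integrable_ft[OF G] by auto
  qed measurable
  from P.Fubini_integral[OF this]
  have "(LINT l|lborel. LINT \<omega>|M. F \<omega> * (G l * iexp (l * Z \<omega>))) = expectation (\<lambda>\<omega>. F \<omega> * ft G (Z \<omega>))"
    by (simp add: ft_def)
  moreover have "(LINT \<omega>|M. F \<omega> * (G l * iexp (l * Z \<omega>))) = G l * expectation (\<lambda>\<omega>. F \<omega> * iexp (l * Z \<omega>))" for l
    by (subst mult.left_commute) simp
  ultimately show ?thesis by simp
qed

section \<open>The Markov property\<close>

text \<open>The derivative of \<open>exp (- z)\<close> has modulus at most 1 on the closed right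
  half-plane, which is convex and contains 0 and \<open>w\<close>.\<close>

lemma norm_one_minus_exp_le:
  fixes w :: complex
  assumes "0 \<le> Re w"
  shows "norm (1 - exp (- w)) \<le> norm w"
proof -
  have "norm (exp (- w) - exp (- 0)) \<le> 1 * norm (w - 0)"
  proof (rule field_differentiable_bound[where S = "{z. 0 \<le> Re z}" and f' = "\<lambda>z. - exp (- z)"])
    show "convex {z. 0 \<le> Re z}" by (rule convex_halfspace_Re_ge)
    show "((\<lambda>z. exp (- z)) has_field_derivative - exp (- z)) (at z within {z. 0 \<le> Re z})" for z
      by (auto intro!: derivative_eq_intros)
  qed (use assms in \<open>auto simp: norm_exp_eq_Re\<close>)
  then show ?thesis by (simp add: norm_minus_commute)
qed

lemma norm_iexp_mult_bounded_le: "\<bar>a\<bar> \<le> 1 \<Longrightarrow> norm (complex_of_real a * iexp t) \<le> 1"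
  by (simp add: norm_mult norm_iexp_eq_1)

lemma complex_of_real_of_bool: "complex_of_real (of_bool b) = of_bool b"
  by (cases b) auto

lemma abs_prod_le_one:
  fixes f :: "'i \<Rightarrow> real"
  shows "(\<And>i. \<bar>f i\<bar> \<le> 1) \<Longrightarrow> \<bar>\<Prod>i\<in>I. f i\<bar> \<le> 1"
  by (simp add: abs_prod prod_le_1)

text \<open>As \<open>X 0\<close> is almost surely \<open>x\<close>, the positions up to
  \<open>ts k\<close> are functions of the first \<open>k\<close> increments, of which the last
  increment is independent. The factors \<open>c i\<close> stand for an event observed at finitely
  many times.\<close>

lemma levy_process_markov:
  assumes levy: "levy_process M X x"
    and char: "\<And>t \<theta>. 0 \<le> t \<Longrightarrow> char (distr M borel (\<lambda>\<omega>. X t \<omega> - X 0 \<omega>)) \<theta> = exp (- complex_of_real t * \<psi> \<theta>)"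
    and ts: "mono ts" "ts 0 = 0"
    and c [measurable]: "\<And>i. c i \<in> borel_measurable borel" and c1: "\<And>i z. \<bar>c i z\<bar> \<le> (1::real)"
  shows "(LINT \<omega>|M. of_real (\<Prod>i\<le>k. c i (X (ts i) \<omega>)) * iexp (l * X (ts (Suc k)) \<omega>))
     = exp (- complex_of_real (ts (Suc k) - ts k) * \<psi> l) *
       (LINT \<omega>|M. of_real (\<Prod>i\<le>k. c i (X (ts i) \<omega>)) * iexp (l * X (ts k) \<omega>))"
proof -
  interpret prob_space M using levy by (simp add: levy_process_def)
  have ts_nonneg: "0 \<le> ts i" for i using ts monoD[OF ts(1), of 0 i] by simp
  have X [measurable]: "X (ts i) \<in> borel_measurable M" for i
    using levy ts_nonneg by (simp add: levy_process_def)
  have X0: "AE \<omega> in M. X 0 \<omega> = x" using levy by (simp add: levy_process_def)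
  define Y where "Y i \<omega> = X (ts (Suc i)) \<omega> - X (ts i) \<omega>" for i \<omega>
  have [measurable]: "Y i \<in> borel_measurable M" for i unfolding Y_def by measurable
  have tele: "X (ts i) \<omega> = X 0 \<omega> + (\<Sum>j<i. Y j \<omega>)" for i \<omega>
    by (induction i) (auto simp: Y_def ts)
  have "indep_vars (\<lambda>_. borel) Y {..<Suc k}"
    using levy ts unfolding levy_process_def Y_def by auto
  then have ind: "indep_var (PiM {..<k} (\<lambda>_. borel)) (\<lambda>\<omega>. restrict (\<lambda>i. Y i \<omega>) {..<k})
      (PiM {k} (\<lambda>_. borel)) (\<lambda>\<omega>. restrict (\<lambda>i. Y i \<omega>) {k})"
    by (rule indep_var_restrict) auto
  define \<Phi> where "\<Phi> y = complex_of_real (\<Prod>i\<le>k. c i (x + (\<Sum>j<i. y j))) * iexp (l * (x + (\<Sum>j<k. y j)))" for y :: "nat \<Rightarrow> real"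
  define \<Psi> where "\<Psi> y = iexp (l * y k)" for y :: "nat \<Rightarrow> real"
  have sum_meas: "(\<lambda>y. x + (\<Sum>j<i. y j)) \<in> borel_measurable (PiM {..<k} (\<lambda>_. borel))" if "i \<le> k" for i
    using that by (intro borel_measurable_add borel_measurable_sum measurable_const measurable_component_singleton) auto
  have [measurable]: "(\<lambda>y. \<Prod>i\<le>k. c i (x + (\<Sum>j<i. y j))) \<in> borel_measurable (PiM {..<k} (\<lambda>_. borel))"
    by (intro borel_measurable_prod measurable_compose[OF sum_meas c]) auto
  have [measurable]: "(\<lambda>y. iexp (l * (x + (\<Sum>j<k. y j)))) \<in> borel_measurable (PiM {..<k} (\<lambda>_. borel))"
    using sum_meas[of k] by measurable
  have \<Phi> [measurable]: "\<Phi> \<in> borel_measurable (PiM {..<k} (\<lambda>_. borel))"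
    unfolding \<Phi>_def[abs_def] by measurable
  have "(\<lambda>y. y k) \<in> borel_measurable (PiM {k} (\<lambda>_. borel :: real measure))" by measurable
  then have \<Psi> [measurable]: "\<Psi> \<in> borel_measurable (PiM {k} (\<lambda>_. borel))"
    unfolding \<Psi>_def[abs_def] by measurable
  define U where "U \<omega> = \<Phi> (restrict (\<lambda>i. Y i \<omega>) {..<k})" for \<omega>
  define V where "V \<omega> = \<Psi> (restrict (\<lambda>i. Y i \<omega>) {k})" for \<omega>
  have UV: "indep_var borel U borel V"
    using indep_var_compose[OF ind \<Phi> \<Psi>] by (simp add: U_def[abs_def] V_def[abs_def] o_def)
  have [measurable]: "U \<in> borel_measurable M" "V \<in> borel_measurable M"
    unfolding U_def[abs_def] V_def[abs_def] by measurable
  have U: "U \<omega> = complex_of_real (\<Prod>i\<le>k. c i (x + (\<Sum>j<i. Y j \<omega>))) * iexp (l * (x + (\<Sum>j<k. Y j \<omega>)))" for \<omega>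
  proof -
    have "(\<Sum>j<i. restrict (\<lambda>i. Y i \<omega>) {..<k} j) = (\<Sum>j<i. Y j \<omega>)" if "i \<le> k" for i
      using that by (intro sum.cong) auto
    then show ?thesis unfolding U_def \<Phi>_def by (intro arg_cong2[where f="(*)"]) (auto intro!: prod.cong)
  qed
  have V: "V \<omega> = iexp (l * Y k \<omega>)" for \<omega> by (simp add: V_def \<Psi>_def)
  have nU: "norm (U \<omega>) \<le> 1" and nV: "norm (V \<omega>) \<le> 1" for \<omega>
    unfolding U V by (intro norm_iexp_mult_bounded_le abs_prod_le_one c1, simp only: norm_iexp_eq_1)
  have intU: "integrable M U" and intV: "integrable M V"
    using nU nV by (auto intro!: integrable_const_bound[where B=1])
  have "(LINT \<omega>|M. of_real (\<Prod>i\<le>k. c i (X (ts i) \<omega>)) * iexp (l * X (ts (Suc k)) \<omega>)) = (LINT \<omega>|M. U \<omega> * V \<omega>)"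
  proof (rule integral_cong_AE)
    show "AE \<omega> in M. of_real (\<Prod>i\<le>k. c i (X (ts i) \<omega>)) * iexp (l * X (ts (Suc k)) \<omega>) = U \<omega> * V \<omega>"
      using X0
    proof eventually_elim
      case (elim \<omega>)
      show ?case unfolding U V tele elim by (simp add: algebra_simps exp_add)
    qed
  qed measurable
  also have "\<dots> = (LINT \<omega>|M. U \<omega>) * (LINT \<omega>|M. V \<omega>)"
    by (rule indep_var_lebesgue_integral[OF UV intU intV])
  also have "(LINT \<omega>|M. U \<omega>) = (LINT \<omega>|M. of_real (\<Prod>i\<le>k. c i (X (ts i) \<omega>)) * iexp (l * X (ts k) \<omega>))"
  proof (rule integral_cong_AE)
    show "AE \<omega> in M. U \<omega> = of_real (\<Prod>i\<le>k. c i (X (ts i) \<omega>)) * iexp (l * X (ts k) \<omega>)"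
      using X0 by eventually_elim (simp add: U tele)
  qed measurable
  also have "(LINT \<omega>|M. V \<omega>) = exp (- complex_of_real (ts (Suc k) - ts k) * \<psi> l)"
  proof -
    \<comment> \<open>With \<open>ts (Suc k)\<close> written as \<open>ts k + d\<close>,
      stationarity replaces the last increment by the one over \<open>[0, d]\<close>, whose
      characteristic function is given.\<close>
    define d where "d = ts (Suc k) - ts k"
    have d: "0 \<le> d" "ts (Suc k) = ts k + d" using monoD[OF ts(1), of k "Suc k"] by (auto simp: d_def)
    have "(LINT \<omega>|M. V \<omega>) = char (distr M borel (Y k)) l"
      unfolding V char_def by (subst integral_distr) auto
    also have "distr M borel (Y k) = distr M borel (\<lambda>\<omega>. X d \<omega> - X 0 \<omega>)"
      using levy d(1) ts_nonneg[of k] unfolding Y_def[abs_def] d(2) by (auto simp: levy_process_def)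
    also have "char \<dots> l = exp (- complex_of_real d * \<psi> l)" by (rule char[OF d(1)])
    finally show ?thesis by (simp add: d_def)
  qed
  finally show ?thesis by (simp add: mult.commute)
qed

text \<open>Path properties hold for every \<omega>, so that pathwise limits need no exceptional
  sets; \<open>u_T0_stable\<close> supplies such a version. Of independence and stationarity only
  the finite-dimensional identity \<open>markov\<close> is kept.\<close>

locale stable_paths = prob_space M for M :: "'a measure" +
  fixes X :: "real \<Rightarrow> 'a \<Rightarrow> real" and x \<alpha> \<beta> :: real
  assumes \<alpha>: "0 < \<alpha>" "\<alpha> < 1"
    and X_measurable: "\<And>t. 0 \<le> t \<Longrightarrow> X t \<in> borel_measurable M"
    and X_0: "\<And>\<omega>. X 0 \<omega> = x"
    and X_cadlag: "\<And>\<omega>. cadlag (\<lambda>t. X t \<omega>)"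
    and markov: "\<And>ts c k l. mono ts \<Longrightarrow> ts 0 = (0::real) \<Longrightarrow> (\<And>i. c i \<in> borel_measurable borel) \<Longrightarrow>
      (\<And>i z. \<bar>c i z\<bar> \<le> (1::real)) \<Longrightarrow>
      expectation (\<lambda>\<omega>. of_real (\<Prod>i\<le>k. c i (X (ts i) \<omega>)) * iexp (l * X (ts (Suc k)) \<omega>))
     = exp (- complex_of_real (ts (Suc k) - ts k) * stable_exponent \<alpha> \<beta> l) *
       expectation (\<lambda>\<omega>. of_real (\<Prod>i\<le>k. c i (X (ts i) \<omega>)) * iexp (l * X (ts k) \<omega>))"
begin

abbreviation \<psi> where "\<psi> \<equiv> stable_exponent \<alpha> \<beta>"

lemma right_cont_path: "right_cont (\<lambda>v. X v \<omega>)"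
  using X_cadlag[of \<omega>] by (simp add: right_cont_def cadlag_def)

lemma norm_semigroup_le: "0 \<le> r \<Longrightarrow> norm (exp (- complex_of_real r * \<psi> l)) \<le> 1"
  unfolding norm_exp_stable_exponent by simp

lemma integrable_semigroup:
  assumes "integrable lborel G" "0 \<le> r"
  shows "integrable lborel (\<lambda>l. G l * exp (- complex_of_real r * \<psi> l))"
proof (rule Bochner_Integration.integrable_bound[OF assms(1)])
  note [measurable] = borel_measurable_integrable[OF assms(1)]
  show "(\<lambda>l. G l * exp (- complex_of_real r * \<psi> l)) \<in> borel_measurable lborel" by measurable
  show "AE l in lborel. norm (G l * exp (- complex_of_real r * \<psi> l)) \<le> norm (G l)"
    unfolding norm_mult using norm_semigroup_le[OF assms(2)] by (intro AE_I2 mult_left_le) auto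
qed

text \<open>This is \<open>markov\<close> integrated in \<open>l\<close>: on Fourier integrals the
  semigroup acts as multiplication by \<open>exp (- r * \<psi> l)\<close>.\<close>

lemma markov_ft:
  assumes ts: "mono ts" "ts 0 = (0::real)"
    and c [measurable]: "\<And>i. c i \<in> borel_measurable borel" and c1: "\<And>i z. \<bar>c i z\<bar> \<le> (1::real)"
    and G: "integrable lborel G"
  shows "expectation (\<lambda>\<omega>. of_real (\<Prod>i\<le>k. c i (X (ts i) \<omega>)) * ft G (X (ts (Suc k)) \<omega>))
     = expectation (\<lambda>\<omega>. of_real (\<Prod>i\<le>k. c i (X (ts i) \<omega>)) *
         ft (\<lambda>l. G l * exp (- complex_of_real (ts (Suc k) - ts k) * \<psi> l)) (X (ts k) \<omega>))"
proof -
  have ts_nonneg: "0 \<le> ts i" for i using ts monoD[OF ts(1), of 0 i] by simp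
  have [measurable]: "X (ts i) \<in> borel_measurable M" for i using ts_nonneg by (rule X_measurable)
  have d: "0 \<le> ts (Suc k) - ts k" using monoD[OF ts(1), of k "Suc k"] by simp
  let ?F = "\<lambda>\<omega>. complex_of_real (\<Prod>i\<le>k. c i (X (ts i) \<omega>))"
  have F: "norm (?F \<omega>) \<le> 1" for \<omega> unfolding norm_of_real by (intro abs_prod_le_one c1)
  have "expectation (\<lambda>\<omega>. ?F \<omega> * ft G (X (ts (Suc k)) \<omega>)) = (LINT l|lborel. G l * expectation (\<lambda>\<omega>. ?F \<omega> * iexp (l * X (ts (Suc k)) \<omega>)))"
    using F by (intro expectation_ft G) auto
  also have "\<dots> = (LINT l|lborel. (G l * exp (- complex_of_real (ts (Suc k) - ts k) * \<psi> l)) * expectation (\<lambda>\<omega>. ?F \<omega> * iexp (l * X (ts k) \<omega>)))"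
    by (simp only: markov[OF ts c c1] mult.assoc)
  also have "\<dots> = expectation (\<lambda>\<omega>. ?F \<omega> * ft (\<lambda>l. G l * exp (- complex_of_real (ts (Suc k) - ts k) * \<psi> l)) (X (ts k) \<omega>))"
    using F by (intro expectation_ft [symmetric] integrable_semigroup G d) auto
  finally show ?thesis .
qed

section \<open>Strong Markov property at entrance times\<close>

definition T :: "real \<Rightarrow> real \<Rightarrow> nat \<Rightarrow> 'a \<Rightarrow> real" where
  "T s e t \<omega> = stop_time (\<lambda>v. X v \<omega>) s e t"

definition K :: "real \<Rightarrow> real \<Rightarrow> nat \<Rightarrow> nat \<Rightarrow> 'a \<Rightarrow> nat" where
  "K s e t n \<omega> = stop_index (\<lambda>v. X v \<omega>) s e t n"

definition stay_factor :: "real \<Rightarrow> real \<Rightarrow> nat \<Rightarrow> nat \<Rightarrow> real \<Rightarrow> real" where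
  "stay_factor s e n i z = of_bool (s \<le> real i / 2 ^ n \<longrightarrow> e \<le> \<bar>z\<bar>)"

lemma stay_factor_measurable [measurable]: "stay_factor s e n i \<in> borel_measurable borel"
  unfolding stay_factor_def[abs_def] by measurable

lemma stay_factor_le: "\<bar>stay_factor s e n i z\<bar> \<le> 1"
  by (simp add: stay_factor_def)

text \<open>The reason for the form of \<open>stays\<close>: it is a product of functions of single
  positions at dyadic times up to \<open>k\<close>, hence an admissible weight in
  \<open>markov_ft\<close>.\<close>

lemma stays_eq_prod: "of_bool (stays (\<lambda>v. X v \<omega>) s e n k) = (\<Prod>i\<le>k. stay_factor s e n i (X (real i / 2 ^ n) \<omega>))"
  unfolding stays_def stay_factor_def
  by (induction k) (auto simp: le_Suc_eq atMost_Suc)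

lemma X_dyadic_measurable [measurable]: "X (real i / 2 ^ n) \<in> borel_measurable M"
  by (rule X_measurable) simp

lemma K_measurable [measurable]: "(\<lambda>\<omega>. real (K s e t n \<omega>)) \<in> borel_measurable M"
proof -
  have "real (K s e t n \<omega>) = (\<Sum>k<t * 2 ^ n. of_bool (stays (\<lambda>v. X v \<omega>) s e n k))" for \<omega>
    unfolding K_def stop_index_def by (simp add: sum.If_cases of_bool_def Int_def conj_commute)
  then show ?thesis unfolding stays_eq_prod by simp
qed

lemma K_le: "K s e t n \<omega> \<le> t * 2 ^ n"
  unfolding K_def by (rule stop_index_le)

text \<open>Splitting over the finitely many values of \<open>K\<close> reduces measurability and
  expectations at the random time to fixed times.\<close>

lemma X_K_eq: "f (X (real (K s e t n \<omega>) / 2 ^ n + r) \<omega>)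
    = (\<Sum>k\<le>t * 2 ^ n. of_bool (K s e t n \<omega> = k) * (f (X (real k / 2 ^ n + r) \<omega>) :: 'b::comm_semiring_1))"
proof -
  have "(\<Sum>k\<le>t * 2 ^ n. of_bool (K s e t n \<omega> = k) * f (X (real k / 2 ^ n + r) \<omega>))
     = (\<Sum>k\<in>{K s e t n \<omega>}. of_bool (K s e t n \<omega> = k) * f (X (real k / 2 ^ n + r) \<omega>))"
    by (rule sum.mono_neutral_right) (use K_le in auto)
  then show ?thesis by simp
qed

lemma K_eq_pred [measurable]: "Measurable.pred M (\<lambda>\<omega>. K s e t n \<omega> = k)"
proof -
  have "(\<lambda>\<omega>. K s e t n \<omega> = k) = (\<lambda>\<omega>. real (K s e t n \<omega>) = real k)" by auto
  moreover have "Measurable.pred M (\<lambda>\<omega>. real (K s e t n \<omega>) = real k)" by measurable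
  ultimately show ?thesis by (simp only:)
qed

lemma X_K_measurable [measurable]:
  assumes "0 \<le> r"
  shows "(\<lambda>\<omega>. X (real (K s e t n \<omega>) / 2 ^ n + r) \<omega>) \<in> borel_measurable M"
proof -
  have [measurable]: "X (real k / 2 ^ n + r) \<in> borel_measurable M" for k using assms by (intro X_measurable) simp
  show ?thesis unfolding X_K_eq[where f="\<lambda>y. y"] by measurable
qed

context
  fixes s e :: real and t :: nat
  assumes s: "0 \<le> s" "s \<le> t"
begin

lemma K_tendsto: "(\<lambda>n. real (K s e t n \<omega>) / 2 ^ n) \<longlonglongrightarrow> T s e t \<omega>"
  unfolding K_def T_def by (rule stop_index_tendsto[OF s right_cont_path])

lemma T_measurable [measurable]: "T s e t \<in> borel_measurable M"
  by (rule borel_measurable_LIMSEQ_metric[OF _ K_tendsto]) measurable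

lemma X_K_tendsto: "0 \<le> r \<Longrightarrow> (\<lambda>n. X (real (K s e t n \<omega>) / 2 ^ n + r) \<omega>) \<longlonglongrightarrow> X (T s e t \<omega> + r) \<omega>"
  unfolding K_def T_def by (rule path_at_stop_index_tendsto[OF s right_cont_path])

lemma X_T_measurable [measurable]: "0 \<le> r \<Longrightarrow> (\<lambda>\<omega>. X (T s e t \<omega> + r) \<omega>) \<in> borel_measurable M"
  by (rule borel_measurable_LIMSEQ_metric[OF _ X_K_tendsto]) measurable

lemma expectation_X_T_limit:
  fixes g :: "real \<Rightarrow> complex"
  assumes g: "continuous_on UNIV g" "\<And>z. norm (g z) \<le> B" and r: "0 \<le> r"
  shows "(\<lambda>n. expectation (\<lambda>\<omega>. g (X (real (K s e t n \<omega>) / 2 ^ n + r) \<omega>))) \<longlonglongrightarrow> expectation (\<lambda>\<omega>. g (X (T s e t \<omega> + r) \<omega>))"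
proof (rule integral_dominated_convergence)
  note [measurable] = X_T_measurable[OF r] X_K_measurable[OF r] borel_measurable_continuous_onI[OF g(1)]
  show "(\<lambda>\<omega>. g (X (T s e t \<omega> + r) \<omega>)) \<in> borel_measurable M"
    "(\<lambda>\<omega>. g (X (real (K s e t n \<omega>) / 2 ^ n + r) \<omega>)) \<in> borel_measurable M" for n by measurable
  show "AE \<omega> in M. (\<lambda>n. g (X (real (K s e t n \<omega>) / 2 ^ n + r) \<omega>)) \<longlonglongrightarrow> g (X (T s e t \<omega> + r) \<omega>)"
    by (intro AE_I2 continuous_on_tendsto_compose[OF g(1) X_K_tendsto] r) auto
  show "integrable M (\<lambda>_. B)" by simp
qed (use g(2) in auto)

text \<open>The event \<open>K = k\<close> is decided by the positions up to
  \<open>k / 2 ^ n\<close>, so \<open>markov_ft\<close> applies on each such event. In the limit the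
  dyadic times approach \<open>T\<close> from above, and both integrands are bounded continuous
  functions of the position.\<close>

lemma strong_markov:
  assumes G: "integrable lborel G" and r: "0 \<le> r"
  shows "expectation (\<lambda>\<omega>. ft G (X (T s e t \<omega> + r) \<omega>)) = expectation (\<lambda>\<omega>. ft (\<lambda>l. G l * exp (- complex_of_real r * \<psi> l)) (X (T s e t \<omega>) \<omega>))"
proof (rule LIMSEQ_unique)
  let ?H = "\<lambda>l. G l * exp (- complex_of_real r * \<psi> l)"
  have H: "integrable lborel ?H" by (rule integrable_semigroup[OF G r])
  note [measurable] = ft_measurable[OF G] ft_measurable[OF H]
  show "(\<lambda>n. expectation (\<lambda>\<omega>. ft G (X (real (K s e t n \<omega>) / 2 ^ n + r) \<omega>))) \<longlonglongrightarrow> expectation (\<lambda>\<omega>. ft G (X (T s e t \<omega> + r) \<omega>))"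
    by (rule expectation_X_T_limit[OF continuous_on_ft[OF G] norm_ft_le r])
  have "expectation (\<lambda>\<omega>. ft G (X (real (K s e t n \<omega>) / 2 ^ n + r) \<omega>)) = expectation (\<lambda>\<omega>. ft ?H (X (real (K s e t n \<omega>) / 2 ^ n) \<omega>))" for n
  proof -
    let ?N = "t * 2 ^ n"
    have [measurable]: "X (real k / 2 ^ n + r) \<in> borel_measurable M" for k using r by (intro X_measurable) simp
    have int: "integrable M (\<lambda>\<omega>. of_bool (K s e t n \<omega> = k) * ft G' (Z \<omega>))"
      if "integrable lborel G'" and [measurable]: "Z \<in> borel_measurable M" for G' Z k
    proof (rule integrable_const_bound[where B="LINT l|lborel. norm (G' l)"])
      note [measurable] = ft_measurable[OF that(1)]
      show "AE \<omega> in M. norm (of_bool (K s e t n \<omega> = k) * ft G' (Z \<omega>)) \<le> (LINT l|lborel. norm (G' l))"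
        using norm_ft_le[of G'] by (intro AE_I2) (auto simp: of_bool_def)
      show "(\<lambda>\<omega>. of_bool (K s e t n \<omega> = k) * ft G' (Z \<omega>)) \<in> borel_measurable M" by measurable
    qed
    have step: "expectation (\<lambda>\<omega>. of_bool (K s e t n \<omega> = k) * ft G (X (real k / 2 ^ n + r) \<omega>))
       = expectation (\<lambda>\<omega>. of_bool (K s e t n \<omega> = k) * ft ?H (X (real k / 2 ^ n) \<omega>))" if k: "k \<le> ?N" for k
    proof -
      \<comment> \<open>Factors of the event \<open>K = k\<close>: staying up to
        \<open>k - 1\<close> and failing at \<open>k\<close>. At the cap \<open>k = ?N\<close> no
        failure is required, hence the factor 1.\<close>
      define c where "c i z = (if i < k then stay_factor s e n i z else if k = ?N then 1 else 1 - stay_factor s e n i z)" for i z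
      define ts where "ts i = (if i \<le> k then real i / 2 ^ n else real k / 2 ^ n + r)" for i
      have prod: "of_bool (K s e t n \<omega> = k) = (\<Prod>i\<le>k. c i (X (ts i) \<omega>))" for \<omega>
      proof -
        let ?st = "stays (\<lambda>v. X v \<omega>) s e n"
        have "(\<Prod>i\<le>k. c i (X (ts i) \<omega>)) = (\<Prod>i<k. c i (X (ts i) \<omega>)) * c k (X (ts k) \<omega>)"
          by (simp add: lessThan_Suc_atMost [symmetric])
        also have "(\<Prod>i<k. c i (X (ts i) \<omega>)) = (\<Prod>i<k. stay_factor s e n i (X (real i / 2 ^ n) \<omega>))"
          by (intro prod.cong) (auto simp: c_def ts_def)
        also have "\<dots> = of_bool (\<forall>i<k. ?st i)"
        proof (cases k)
          case (Suc m)
          then have "(\<forall>i<k. ?st i) \<longleftrightarrow> ?st m" by (auto simp: stays_def)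
          then show ?thesis using stays_eq_prod[of \<omega> s e n m] Suc by (simp add: lessThan_Suc_atMost)
        qed simp
        also have "c k (X (ts k) \<omega>) = (if k = ?N then 1 else of_bool (\<not> (s \<le> real k / 2 ^ n \<longrightarrow> e \<le> \<bar>X (real k / 2 ^ n) \<omega>\<bar>)))"
          by (simp add: c_def ts_def stay_factor_def)
        also have "of_bool (\<forall>i<k. ?st i) * \<dots> = (of_bool (K s e t n \<omega> = k) :: real)"
        proof -
          have st: "?st i \<longleftrightarrow> i < K s e t n \<omega>" if "i < ?N" for i
            unfolding K_def by (rule stays_iff_less_stop_index[OF that])
          have 1: "(\<forall>i<k. ?st i) \<longleftrightarrow> k \<le> K s e t n \<omega>"
          proof -
            have "(\<forall>i<k. ?st i) \<longleftrightarrow> (\<forall>i<k. i < K s e t n \<omega>)" using st k by auto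
            also have "\<dots> \<longleftrightarrow> k \<le> K s e t n \<omega>" by (induction k) (auto simp: All_less_Suc)
            finally show ?thesis .
          qed
          show ?thesis
          proof (cases "k = ?N")
            case True
            then show ?thesis using K_le[of s e t n \<omega>] unfolding 1 by auto
          next
            case False
            then have "k < ?N" using k by simp
            have "(\<forall>i<k. ?st i) \<and> \<not> (s \<le> real k / 2 ^ n \<longrightarrow> e \<le> \<bar>X (real k / 2 ^ n) \<omega>\<bar>) \<longleftrightarrow> (\<forall>i<k. ?st i) \<and> \<not> ?st k"
              unfolding stays_def by (auto simp: le_less)
            also have "\<dots> \<longleftrightarrow> K s e t n \<omega> = k" unfolding 1 st[OF \<open>k < ?N\<close>] by auto
            finally show ?thesis using False by (auto simp: of_bool_def)
          qed
        qed
        finally show ?thesis by simp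
      qed
      have ts': "ts (Suc k) = real k / 2 ^ n + r" "ts k = real k / 2 ^ n" "ts (Suc k) - ts k = r" by (auto simp: ts_def)
      have "expectation (\<lambda>\<omega>. of_real (\<Prod>i\<le>k. c i (X (ts i) \<omega>)) * ft G (X (ts (Suc k)) \<omega>))
        = expectation (\<lambda>\<omega>. of_real (\<Prod>i\<le>k. c i (X (ts i) \<omega>)) * ft (\<lambda>l. G l * exp (- complex_of_real (ts (Suc k) - ts k) * \<psi> l)) (X (ts k) \<omega>))"
      proof (rule markov_ft)
        show "mono ts" using r by (auto simp: mono_def ts_def divide_right_mono intro: add_increasing2)
        show "c i \<in> borel_measurable borel" for i unfolding c_def by measurable
        show "\<bar>c i z\<bar> \<le> 1" for i z by (simp add: c_def stay_factor_def)
      qed (auto simp: ts_def G)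
      then show ?thesis unfolding prod [symmetric] ts'(3) unfolding ts'(1,2) complex_of_real_of_bool .
    qed
    have "expectation (\<lambda>\<omega>. ft G (X (real (K s e t n \<omega>) / 2 ^ n + r) \<omega>))
      = (\<Sum>k\<le>?N. expectation (\<lambda>\<omega>. of_bool (K s e t n \<omega> = k) * ft G (X (real k / 2 ^ n + r) \<omega>)))"
      unfolding X_K_eq[where f="ft G"] by (intro Bochner_Integration.integral_sum int G) measurable
    also have "\<dots> = (\<Sum>k\<le>?N. expectation (\<lambda>\<omega>. of_bool (K s e t n \<omega> = k) * ft ?H (X (real k / 2 ^ n + 0) \<omega>)))"
      using step by simp
    also have "\<dots> = expectation (\<lambda>\<omega>. ft ?H (X (real (K s e t n \<omega>) / 2 ^ n + 0) \<omega>))"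
      unfolding X_K_eq[where f="ft ?H"] by (intro Bochner_Integration.integral_sum [symmetric] int H) simp
    finally show ?thesis by simp
  qed
  then show "(\<lambda>n. expectation (\<lambda>\<omega>. ft G (X (real (K s e t n \<omega>) / 2 ^ n + r) \<omega>))) \<longlonglongrightarrow> expectation (\<lambda>\<omega>. ft ?H (X (T s e t \<omega>) \<omega>))"
    using expectation_X_T_limit[OF continuous_on_ft[OF H] norm_ft_le, of 0] by simp
qed

end
end

section \<open>Dynkin's formula\<close>

text \<open>Both terms tend to \<open>w\<close>; the first is, up to sign, the difference quotient
  of \<open>exp (- h * w)\<close> at 0 along \<open>h = 1 / 2 ^ n\<close>.\<close>

lemma tendsto_generator_error:
  fixes w :: complex
  shows "(\<lambda>n. 2 ^ n * (1 - exp (- (1 / 2 ^ n) * w)) - w * exp (- (1 / 2 ^ n) * w)) \<longlonglongrightarrow> 0"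
proof -
  have d: "(\<lambda>n. 1 / 2 ^ n :: complex) \<longlonglongrightarrow> 0"
    using LIMSEQ_power_zero[of "1 / 2 :: complex"] by (simp add: power_one_over norm_divide)
  have "((\<lambda>h. exp (- h * w)) has_field_derivative - w) (at 0)"
    by (auto intro!: derivative_eq_intros)
  then have "((\<lambda>h. (exp (- h * w) - exp (- 0 * w)) / (h - 0)) \<longlongrightarrow> - w) (at 0)"
    unfolding has_field_derivative_iff .
  moreover have "filterlim (\<lambda>n. 1 / 2 ^ n :: complex) (at 0) sequentially"
    using d by (auto simp: filterlim_at)
  ultimately have "(\<lambda>n. (exp (- (1 / 2 ^ n) * w) - exp (- 0 * w)) / (1 / 2 ^ n - 0)) \<longlonglongrightarrow> - w"
    by (rule filterlim_compose)
  then have 1: "(\<lambda>n. 2 ^ n * (exp (- (1 / 2 ^ n) * w) - 1)) \<longlonglongrightarrow> - w"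
    by (simp add: mult.commute)
  have 2: "(\<lambda>n. w * exp (- (1 / 2 ^ n) * w)) \<longlonglongrightarrow> w * exp (- 0 * w)"
    by (intro tendsto_intros d)
  have "(\<lambda>n. - (2 ^ n * (exp (- (1 / 2 ^ n) * w) - 1)) - w * exp (- (1 / 2 ^ n) * w)) \<longlonglongrightarrow> - (- w) - w * exp (- 0 * w)"
    by (intro tendsto_diff tendsto_minus 1 2)
  then show ?thesis by (simp add: algebra_simps)
qed

context stable_paths
begin

text \<open>Over one dyadic step of length \<open>\<delta>\<close> the defect of the formula has the Fourier multiplier
  \<open>1 - e\<^sup>-\<^sup>\<delta>\<^sup>\<psi> - \<delta> \<psi> e\<^sup>-\<^sup>\<delta>\<^sup>\<psi>\<close>, which is \<open>o(\<delta>)\<close>.\<close>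

lemma dynkin:
  assumes s: "0 \<le> s" "s \<le> real t"
    and G: "integrable lborel G" and \<psi>G: "integrable lborel (\<lambda>l. \<psi> l * G l)"
  defines "f \<equiv> ft (\<lambda>l. \<psi> l * G l)"
  shows "(\<lambda>\<omega>. LINT v:{0..<T s e t \<omega>}|lborel. f (X v \<omega>)) \<in> borel_measurable M"
    and "expectation (\<lambda>\<omega>. LINT v:{0..<T s e t \<omega>}|lborel. f (X v \<omega>)) = ft G x - expectation (\<lambda>\<omega>. ft G (X (T s e t \<omega>) \<omega>))"
proof -
  define Bf where "Bf = (LINT l|lborel. norm (\<psi> l * G l))"
  define Bg where "Bg = (LINT l|lborel. norm (G l))"
  have f: "norm (f z) \<le> Bf" and g: "norm (ft G z) \<le> Bg" for z
    unfolding f_def Bf_def Bg_def by (rule norm_ft_le)+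
  have Bf0: "0 \<le> Bf" unfolding Bf_def by simp
  note [measurable] = ft_measurable[OF G] ft_measurable[OF \<psi>G, folded f_def] borel_measurable_integrable[OF G]
  have cont_f: "continuous_on UNIV f" unfolding f_def by (rule continuous_on_ft[OF \<psi>G])
  \<comment> \<open>The term for \<open>k\<close> is read at the right end point
    \<open>k + 1\<close>, so that one Markov step from \<open>k\<close> covers both it and the
    increment of \<open>ft G\<close>.\<close>
  define Q where "Q n \<omega> = (\<Sum>k<K s e t n \<omega>. f (X (real (k + 1) / 2 ^ n) \<omega>) / 2 ^ n)" for n \<omega>
  have Q_alt: "Q n \<omega> = (\<Sum>k<t * 2 ^ n. of_bool (stays (\<lambda>v. X v \<omega>) s e n k) * (f (X (real (k + 1) / 2 ^ n) \<omega>) / 2 ^ n))" for n \<omega>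
  proof -
    have "(\<Sum>k<t * 2 ^ n. of_bool (stays (\<lambda>v. X v \<omega>) s e n k) * (f (X (real (k + 1) / 2 ^ n) \<omega>) / 2 ^ n))
      = (\<Sum>k<t * 2 ^ n. of_bool (k < K s e t n \<omega>) * (f (X (real (k + 1) / 2 ^ n) \<omega>) / 2 ^ n))"
      unfolding K_def by (intro sum.cong refl) (simp add: stays_iff_less_stop_index)
    also have "\<dots> = Q n \<omega>" unfolding Q_def
      by (rule sum.mono_neutral_cong_right) (use K_le[of s e t n \<omega>] in auto)
    finally show ?thesis ..
  qed
  have [measurable]: "(\<lambda>\<omega>. of_bool (stays (\<lambda>v. X v \<omega>) s e n k) :: complex) \<in> borel_measurable M" for n k
    unfolding complex_of_real_of_bool [symmetric] stays_eq_prod by measurable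
  have [measurable]: "Q n \<in> borel_measurable M" for n
    unfolding Q_alt[abs_def] by measurable
  have Q_lim: "(\<lambda>n. Q n \<omega>) \<longlonglongrightarrow> (LINT v:{0..<T s e t \<omega>}|lborel. f (X v \<omega>))" for \<omega>
    unfolding Q_def K_def T_def by (rule stop_index_integral_tendsto[OF s right_cont_path cont_f f])
  show meas [measurable]: "(\<lambda>\<omega>. LINT v:{0..<T s e t \<omega>}|lborel. f (X v \<omega>)) \<in> borel_measurable M"
    by (rule borel_measurable_LIMSEQ_metric[OF _ Q_lim]) measurable
  have Q_bound: "norm (Q n \<omega>) \<le> real t * Bf" for n \<omega>
  proof -
    have "norm (Q n \<omega>) \<le> (\<Sum>k<K s e t n \<omega>. norm (f (X (real (k + 1) / 2 ^ n) \<omega>) / 2 ^ n))"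
      unfolding Q_def by (rule norm_sum)
    also have "\<dots> \<le> (\<Sum>k<K s e t n \<omega>. Bf / 2 ^ n)"
      using f by (intro sum_mono) (auto simp: norm_divide norm_power divide_right_mono)
    also have "\<dots> = (real (K s e t n \<omega>) / 2 ^ n) * Bf" by simp
    also have "\<dots> \<le> real t * Bf"
      using stop_index_le_t[OF s, of "\<lambda>v. X v \<omega>" e n] Bf0 unfolding K_def by (intro mult_right_mono) auto
    finally show ?thesis .
  qed
  have Q_exp: "(\<lambda>n. expectation (Q n)) \<longlonglongrightarrow> expectation (\<lambda>\<omega>. LINT v:{0..<T s e t \<omega>}|lborel. f (X v \<omega>))"
    by (rule integral_dominated_convergence[where w="\<lambda>_. real t * Bf"]) (use Q_bound Q_lim in auto)
  have g_exp: "(\<lambda>n. expectation (\<lambda>\<omega>. ft G (X (real (K s e t n \<omega>) / 2 ^ n) \<omega>))) \<longlonglongrightarrow> expectation (\<lambda>\<omega>. ft G (X (T s e t \<omega>) \<omega>))"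
    using expectation_X_T_limit[OF s continuous_on_ft[OF G] norm_ft_le, of 0] by simp
  \<comment> \<open>Multiplier of the one-step defect: \<open>G\<close> at the present time, minus
    \<open>G\<close> and the Riemann term after one step, both brought back by the
    semigroup.\<close>
  define H where "H n l = G l - (G l * exp (- complex_of_real (1 / 2 ^ n) * \<psi> l) +
      1 / 2 ^ n * ((\<psi> l * G l) * exp (- complex_of_real (1 / 2 ^ n) * \<psi> l)))" for n l
  have H1: "integrable lborel (\<lambda>l. G l * exp (- complex_of_real (1 / 2 ^ n) * \<psi> l))" for n
    by (rule integrable_semigroup[OF G]) simp
  have H2: "integrable lborel (\<lambda>l. (\<psi> l * G l) * exp (- complex_of_real (1 / 2 ^ n) * \<psi> l))" for n
    by (rule integrable_semigroup[OF \<psi>G]) simp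
  have Hint: "integrable lborel (H n)" for n
    unfolding H_def[abs_def]
    by (intro Bochner_Integration.integrable_diff Bochner_Integration.integrable_add integrable_mult_right G H1 H2)
  \<comment> \<open>Each of the \<open>t * 2 ^ n\<close> possible steps contributes at most the
    integral of \<open>norm (H n l)\<close>, and the increments over the steps before
    \<open>K\<close> telescope.\<close>
  have key: "norm (ft G x - expectation (\<lambda>\<omega>. ft G (X (real (K s e t n \<omega>) / 2 ^ n) \<omega>)) - expectation (Q n))
     \<le> real t * (LINT l|lborel. 2 ^ n * norm (H n l))" for n
  proof -
    let ?st = "\<lambda>\<omega>. stays (\<lambda>v. X v \<omega>) s e n"
    let ?X = "\<lambda>k. X (real k / 2 ^ n)"
    let ?N = "t * 2 ^ n"
    define D where "D k \<omega> = of_bool (?st \<omega> k) * (ft G (?X k \<omega>) - ft G (?X (k + 1) \<omega>) - f (?X (k + 1) \<omega>) / 2 ^ n)" for k \<omega>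
    have ob: "norm (of_bool b * z) \<le> norm z" for b and z :: complex by (cases b) auto
    have int0: "integrable M (\<lambda>\<omega>. of_bool (?st \<omega> k) * ft G' (?X j \<omega>))" if G': "integrable lborel G'" for G' k j
    proof (rule integrable_const_bound[where B="LINT l|lborel. norm (G' l)"])
      note [measurable] = ft_measurable[OF G']
      show "(\<lambda>\<omega>. of_bool (?st \<omega> k) * ft G' (?X j \<omega>)) \<in> borel_measurable M" by measurable
      show "AE \<omega> in M. norm (of_bool (?st \<omega> k) * ft G' (?X j \<omega>)) \<le> (LINT l|lborel. norm (G' l))"
        using ob norm_ft_le order_trans by (intro AE_I2) blast
    qed
    have D_alt: "D k \<omega> = of_bool (?st \<omega> k) * ft G (?X k \<omega>) - (of_bool (?st \<omega> k) * ft G (?X (k + 1) \<omega>)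
        + 1 / 2 ^ n * (of_bool (?st \<omega> k) * f (?X (k + 1) \<omega>)))" for k \<omega>
      by (simp add: D_def algebra_simps)
    have intD: "integrable M (D k)" for k
      unfolding D_alt[abs_def] f_def
      by (intro Bochner_Integration.integrable_diff Bochner_Integration.integrable_add integrable_mult_right int0 G \<psi>G)
    have shift: "expectation (\<lambda>\<omega>. of_bool (?st \<omega> k) * ft G' (?X (k + 1) \<omega>))
       = expectation (\<lambda>\<omega>. of_bool (?st \<omega> k) * ft (\<lambda>l. G' l * exp (- complex_of_real (1 / 2 ^ n) * \<psi> l)) (?X k \<omega>))"
      if G': "integrable lborel G'" for G' k
    proof -
      have "expectation (\<lambda>\<omega>. of_real (\<Prod>i\<le>k. stay_factor s e n i (X (real i / 2 ^ n) \<omega>)) * ft G' (X (real (Suc k) / 2 ^ n) \<omega>))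
        = expectation (\<lambda>\<omega>. of_real (\<Prod>i\<le>k. stay_factor s e n i (X (real i / 2 ^ n) \<omega>)) *
           ft (\<lambda>l. G' l * exp (- complex_of_real (real (Suc k) / 2 ^ n - real k / 2 ^ n) * \<psi> l)) (X (real k / 2 ^ n) \<omega>))"
        by (rule markov_ft[where ts="\<lambda>i. real i / 2 ^ n"])
          (auto simp: mono_def divide_right_mono stay_factor_le G')
      moreover have "real (Suc k) / 2 ^ n - real k / 2 ^ n = 1 / 2 ^ n" by (simp add: diff_divide_distrib [symmetric])
      ultimately show ?thesis unfolding stays_eq_prod [symmetric] complex_of_real_of_bool by (simp only: Suc_eq_plus1)
    qed
    have ED: "expectation (D k) = expectation (\<lambda>\<omega>. of_bool (?st \<omega> k) * ft (H n) (?X k \<omega>))" for k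
    proof -
      have "expectation (D k) = expectation (\<lambda>\<omega>. of_bool (?st \<omega> k) * ft G (?X k \<omega>)) -
        (expectation (\<lambda>\<omega>. of_bool (?st \<omega> k) * ft G (?X (k + 1) \<omega>)) +
         1 / 2 ^ n * expectation (\<lambda>\<omega>. of_bool (?st \<omega> k) * f (?X (k + 1) \<omega>)))"
        unfolding D_alt[abs_def] f_def
        by (simp only: Bochner_Integration.integral_diff Bochner_Integration.integral_add integral_mult_right_zero
          int0 G \<psi>G Bochner_Integration.integrable_add integrable_mult_right)
      also have "\<dots> = expectation (\<lambda>\<omega>. of_bool (?st \<omega> k) * ft G (?X k \<omega>)) -
        (expectation (\<lambda>\<omega>. of_bool (?st \<omega> k) * ft (\<lambda>l. G l * exp (- complex_of_real (1 / 2 ^ n) * \<psi> l)) (?X k \<omega>)) +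
         1 / 2 ^ n * expectation (\<lambda>\<omega>. of_bool (?st \<omega> k) * ft (\<lambda>l. (\<psi> l * G l) * exp (- complex_of_real (1 / 2 ^ n) * \<psi> l)) (?X k \<omega>)))"
        unfolding f_def shift[OF G] shift[OF \<psi>G] ..
      also have "\<dots> = expectation (\<lambda>\<omega>. of_bool (?st \<omega> k) * ft G (?X k \<omega>) -
        (of_bool (?st \<omega> k) * ft (\<lambda>l. G l * exp (- complex_of_real (1 / 2 ^ n) * \<psi> l)) (?X k \<omega>) +
         1 / 2 ^ n * (of_bool (?st \<omega> k) * ft (\<lambda>l. (\<psi> l * G l) * exp (- complex_of_real (1 / 2 ^ n) * \<psi> l)) (?X k \<omega>))))"
        by (simp only: Bochner_Integration.integral_diff Bochner_Integration.integral_add integral_mult_right_zero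
          int0 G H1 H2 Bochner_Integration.integrable_add integrable_mult_right)
      also have "\<dots> = expectation (\<lambda>\<omega>. of_bool (?st \<omega> k) * ft (H n) (?X k \<omega>))"
      proof -
        have "ft (H n) z = ft G z - (ft (\<lambda>l. G l * exp (- complex_of_real (1 / 2 ^ n) * \<psi> l)) z +
         1 / 2 ^ n * ft (\<lambda>l. (\<psi> l * G l) * exp (- complex_of_real (1 / 2 ^ n) * \<psi> l)) z)" for z
          unfolding H_def[abs_def]
          by (subst ft_diff, rule G, intro Bochner_Integration.integrable_add integrable_mult_right H1 H2,
              subst ft_add, rule H1, intro integrable_mult_right H2, subst ft_cmult, rule refl)
        then show ?thesis by (simp only: right_diff_distrib distrib_left mult.left_commute)
      qed
      finally show ?thesis .
    qed
    have "norm (expectation (D k)) \<le> (LINT l|lborel. norm (H n l))" for k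
      unfolding ED
    proof (rule order_trans[OF integral_norm_bound])
      have "(LINT \<omega>|M. norm (of_bool (?st \<omega> k) * ft (H n) (?X k \<omega>))) \<le> (LINT \<omega>|M. (LINT l|lborel. norm (H n l)))"
        by (intro integral_mono integrable_norm int0 Hint order_trans[OF ob norm_ft_le]) simp
      then show "(LINT \<omega>|M. norm (of_bool (?st \<omega> k) * ft (H n) (?X k \<omega>))) \<le> (LINT l|lborel. norm (H n l))"
        by (simp add: prob_space)
    qed
    then have "norm (\<Sum>k<?N. expectation (D k)) \<le> (\<Sum>k<?N. (LINT l|lborel. norm (H n l)))"
      by (intro sum_norm_le)
    also have "\<dots> = real t * (LINT l|lborel. 2 ^ n * norm (H n l))" by simp
    also have "(\<Sum>k<?N. expectation (D k)) = expectation (\<lambda>\<omega>. \<Sum>k<?N. D k \<omega>)"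
      by (intro Bochner_Integration.integral_sum [symmetric] intD)
    also have "(\<lambda>\<omega>. \<Sum>k<?N. D k \<omega>) = (\<lambda>\<omega>. ft G x - ft G (X (real (K s e t n \<omega>) / 2 ^ n) \<omega>) - Q n \<omega>)"
    proof
      fix \<omega>
      have "(\<Sum>k<?N. D k \<omega>) = (\<Sum>k<?N. of_bool (?st \<omega> k) * (ft G (?X k \<omega>) - ft G (?X (k + 1) \<omega>))) - Q n \<omega>"
        unfolding Q_alt sum_subtractf [symmetric] by (intro sum.cong refl) (simp add: D_def algebra_simps)
      also have "(\<Sum>k<?N. of_bool (?st \<omega> k) * (ft G (?X k \<omega>) - ft G (?X (k + 1) \<omega>)))
         = (\<Sum>k<?N. of_bool (k < K s e t n \<omega>) * (ft G (?X k \<omega>) - ft G (?X (k + 1) \<omega>)))"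
        unfolding K_def by (intro sum.cong refl) (simp add: stays_iff_less_stop_index)
      also have "\<dots> = (\<Sum>k<K s e t n \<omega>. ft G (?X k \<omega>) - ft G (?X (Suc k) \<omega>))"
        by (rule sum.mono_neutral_cong_right) (use K_le[of s e t n \<omega>] in auto)
      also have "\<dots> = ft G (?X 0 \<omega>) - ft G (?X (K s e t n \<omega>) \<omega>)"
        by (rule sum_lessThan_telescope')
      finally show "(\<Sum>k<?N. D k \<omega>) = ft G x - ft G (X (real (K s e t n \<omega>) / 2 ^ n) \<omega>) - Q n \<omega>"
        by (simp add: X_0)
    qed
    also have "expectation (\<lambda>\<omega>. ft G x - ft G (X (real (K s e t n \<omega>) / 2 ^ n) \<omega>) - Q n \<omega>)
       = ft G x - expectation (\<lambda>\<omega>. ft G (X (real (K s e t n \<omega>) / 2 ^ n) \<omega>)) - expectation (Q n)"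
    proof -
      have [measurable]: "(\<lambda>\<omega>. X (real (K s e t n \<omega>) / 2 ^ n) \<omega>) \<in> borel_measurable M"
        using X_K_measurable[of 0 s e t n] by simp
      have "integrable M (\<lambda>\<omega>. ft G (X (real (K s e t n \<omega>) / 2 ^ n) \<omega>))"
        using g by (intro integrable_const_bound[where B=Bg]) auto
      moreover have "integrable M (Q n)" using Q_bound by (intro integrable_const_bound[where B="real t * Bf"]) auto
      ultimately show ?thesis by (simp add: prob_space)
    qed
    finally show ?thesis .
  qed
  have "(\<lambda>n. LINT l|lborel. 2 ^ n * norm (H n l)) \<longlonglongrightarrow> integral\<^sup>L lborel (\<lambda>l::real. 0::real)"
  proof (rule integral_dominated_convergence)
    show "(\<lambda>l. 2 ^ n * norm (H n l)) \<in> borel_measurable lborel" for n unfolding H_def by measurable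
    show "integrable lborel (\<lambda>l. 2 * norm (\<psi> l * G l))" using \<psi>G by simp
    have eq: "2 ^ n * norm (H n l) = norm (G l * (2 ^ n * (1 - exp (- (1 / 2 ^ n) * \<psi> l)) - \<psi> l * exp (- (1 / 2 ^ n) * \<psi> l)))" for n l
    proof -
      have "2 ^ n * norm (H n l) = norm (2 ^ n * H n l)" by (simp add: norm_mult norm_power)
      also have "2 ^ n * H n l = G l * (2 ^ n * (1 - exp (- (1 / 2 ^ n) * \<psi> l)) - \<psi> l * exp (- (1 / 2 ^ n) * \<psi> l))"
        by (simp add: H_def algebra_simps)
      finally show ?thesis .
    qed
    \<comment> \<open>As the real part of \<psi> is nonnegative, each of the two parts of the
      rescaled multiplier is bounded by the modulus of \<psi>.\<close>
    show "AE l in lborel. norm (2 ^ n * norm (H n l)) \<le> 2 * norm (\<psi> l * G l)" for n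
    proof (intro AE_I2)
      fix l
      have Re: "0 \<le> Re ((1 / 2 ^ n) * \<psi> l)"
      proof -
        have "(1 / 2 ^ n) * \<psi> l = complex_of_real (1 / 2 ^ n) * \<psi> l" by simp
        also have "Re \<dots> = (1 / 2 ^ n) * \<bar>l\<bar> powr (\<alpha> + 1)"
          by (simp only: times_complex.sel(1) Re_complex_of_real Im_complex_of_real Re_stable_exponent mult_zero_left diff_zero)
        finally show ?thesis by simp
      qed
      have 1: "norm (2 ^ n * (1 - exp (- (1 / 2 ^ n) * \<psi> l))) \<le> norm (\<psi> l)"
      proof -
        have "norm (1 - exp (- (1 / 2 ^ n) * \<psi> l)) \<le> norm (\<psi> l) / 2 ^ n"
          using norm_one_minus_exp_le[OF Re] by (simp add: norm_divide norm_power)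
        then have "2 ^ n * norm (1 - exp (- (1 / 2 ^ n) * \<psi> l)) \<le> norm (\<psi> l)"
          by (simp only: pos_le_divide_eq zero_less_power zero_less_numeral mult.commute)
        then show ?thesis by (simp only: norm_mult norm_power norm_numeral)
      qed
      have 2: "norm (\<psi> l * exp (- (1 / 2 ^ n) * \<psi> l)) \<le> norm (\<psi> l)"
        unfolding norm_mult using norm_semigroup_le[of "1 / 2 ^ n" l] by (intro mult_left_le) auto
      have "norm (G l) * norm (2 ^ n * (1 - exp (- (1 / 2 ^ n) * \<psi> l)) - \<psi> l * exp (- (1 / 2 ^ n) * \<psi> l))
         \<le> norm (G l) * (norm (\<psi> l) + norm (\<psi> l))"
        by (intro mult_left_mono order_trans[OF norm_triangle_ineq4] add_mono 1 2) simp
      then show "norm (2 ^ n * norm (H n l)) \<le> 2 * norm (\<psi> l * G l)"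
        unfolding eq by (simp add: norm_mult mult_ac)
    qed
    show "AE l in lborel. (\<lambda>n. 2 ^ n * norm (H n l)) \<longlonglongrightarrow> 0"
      unfolding eq by (intro AE_I2 tendsto_norm_zero tendsto_mult_right_zero tendsto_generator_error)
  qed simp
  then have "(\<lambda>n. real t * (LINT l|lborel. 2 ^ n * norm (H n l))) \<longlonglongrightarrow> 0"
    by (intro tendsto_mult_right_zero) simp
  then have "(\<lambda>n. ft G x - expectation (\<lambda>\<omega>. ft G (X (real (K s e t n \<omega>) / 2 ^ n) \<omega>)) - expectation (Q n)) \<longlonglongrightarrow> 0"
    by (rule Lim_null_comparison[rotated]) (use key in auto)
  moreover have "(\<lambda>n. ft G x - expectation (\<lambda>\<omega>. ft G (X (real (K s e t n \<omega>) / 2 ^ n) \<omega>)) - expectation (Q n))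
     \<longlonglongrightarrow> ft G x - expectation (\<lambda>\<omega>. ft G (X (T s e t \<omega>) \<omega>)) - expectation (\<lambda>\<omega>. LINT v:{0..<T s e t \<omega>}|lborel. f (X v \<omega>))"
    by (intro tendsto_diff tendsto_const g_exp Q_exp)
  ultimately show "expectation (\<lambda>\<omega>. LINT v:{0..<T s e t \<omega>}|lborel. f (X v \<omega>)) = ft G x - expectation (\<lambda>\<omega>. ft G (X (T s e t \<omega>) \<omega>))"
    using LIMSEQ_unique by force
qed

end

section \<open>Quasi-left-continuity\<close>

text \<open>Either the sequence reaches \<open>S\<close> and is constant from then on, or it stays
  strictly below and the shifted sequence runs into the left limit at \<open>S + r\<close>.\<close>

lemma cadlag_incseq_shift_convergent:
  fixes w :: "real \<Rightarrow> real"
  assumes w: "cadlag w" and a: "incseq a" "a \<longlonglongrightarrow> S" "0 \<le> a 0" and r: "0 < r"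
  shows "convergent (\<lambda>m. w (a m + r))"
proof (cases "\<exists>m. a m = S")
  case True
  then obtain m where m: "a m = S" by blast
  have "w (a n + r) = w (S + r)" if "m \<le> n" for n
    using incseq_le[OF a(1,2), of n] incseqD[OF a(1) that] m by simp
  then have "(\<lambda>m. w (a m + r)) \<longlonglongrightarrow> w (S + r)"
    by (intro tendsto_eventually) (auto simp: eventually_sequentially)
  then show ?thesis by (rule convergentI)
next
  case False
  have less: "a m < S" for m using incseq_le[OF a(1,2), of m] False by (metis less_le)
  have "0 < S + r" using less[of 0] a(3) r by linarith
  then obtain l where l: "(w \<longlongrightarrow> l) (at_left (S + r))" using w by (auto simp: cadlag_def)
  have "filterlim (\<lambda>m. a m + r) (at_left (S + r)) sequentially"
    unfolding filterlim_at using less by (auto intro!: tendsto_intros a(2) always_eventually)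
  from filterlim_compose[OF l this] show ?thesis by (rule convergentI)
qed

text \<open>Approaching \<open>S\<close> from below yields a left limit, not the value. After a
  shift by \<open>r j > 0\<close> the times lie beyond \<open>S\<close> for large \<open>m\<close>,
  and right-continuity at \<open>S\<close> takes over as the shift vanishes.\<close>

lemma lim_incseq_shift_tendsto:
  fixes w :: "real \<Rightarrow> real"
  assumes w: "cadlag w" and a: "incseq a" "a \<longlonglongrightarrow> S" "0 \<le> a 0"
    and r: "\<And>j. 0 < r j" "r \<longlonglongrightarrow> 0"
  shows "(\<lambda>j. lim (\<lambda>m. w (a m + r j))) \<longlonglongrightarrow> w S"
proof (rule LIMSEQ_I)
  fix \<epsilon> :: real assume \<epsilon>: "0 < \<epsilon>"
  have S0: "0 \<le> S" using incseq_le[OF a(1,2), of 0] a(3) by linarith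
  then have "(w \<longlongrightarrow> w S) (at_right S)" using w by (simp add: cadlag_def)
  then have "\<forall>\<^sub>F u in at_right S. dist (w u) (w S) < \<epsilon> / 2" using \<epsilon> by (intro tendstoD) auto
  then obtain b where b: "b > S" "\<And>u. S < u \<Longrightarrow> u < b \<Longrightarrow> dist (w u) (w S) < \<epsilon> / 2"
    by (auto simp: eventually_at_right_field)
  have "\<forall>\<^sub>F j in sequentially. r j < b - S" using b(1) by (intro order_tendstoD(2)[OF r(2)]) auto
  then obtain J where J: "\<And>j. J \<le> j \<Longrightarrow> r j < b - S" by (auto simp: eventually_sequentially)
  have "norm (lim (\<lambda>m. w (a m + r j)) - w S) < \<epsilon>" if "J \<le> j" for j
  proof -
    have "(\<lambda>m. w (a m + r j)) \<longlonglongrightarrow> lim (\<lambda>m. w (a m + r j))"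
      using cadlag_incseq_shift_convergent[OF w a r(1)] by (simp add: convergent_LIMSEQ_iff)
    then have lim: "(\<lambda>m. dist (w (a m + r j)) (w S)) \<longlonglongrightarrow> dist (lim (\<lambda>m. w (a m + r j))) (w S)"
      by (intro tendsto_dist tendsto_const)
    have "\<forall>\<^sub>F m in sequentially. S - r j < a m" using r(1)[of j] by (intro order_tendstoD(1)[OF a(2)]) auto
    then have "\<forall>\<^sub>F m in sequentially. dist (w (a m + r j)) (w S) \<le> \<epsilon> / 2"
    proof eventually_elim
      case (elim m)
      then show ?case using b(2)[of "a m + r j"] J[OF that] incseq_le[OF a(1,2), of m] by auto
    qed
    then have "dist (lim (\<lambda>m. w (a m + r j))) (w S) \<le> \<epsilon> / 2"
      using lim by (intro tendsto_upperbound[OF lim]) auto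
    then show ?thesis using \<epsilon> by (simp add: dist_real_def)
  qed
  then show "\<exists>no. \<forall>j\<ge>no. norm (lim (\<lambda>m. w (a m + r j)) - w S) < \<epsilon>" by blast
qed

text \<open>Because \<open>\<alpha> + 1 < 2\<close>, the exponent grows at most quadratically, so
  second Gaussian moments control it.\<close>

lemma norm_stable_exponent_le:
  assumes "0 < \<alpha>" "\<alpha> < 1"
  shows "norm (stable_exponent \<alpha> \<beta> l) \<le> (1 + \<bar>\<beta> * tan ((\<alpha> + 1) * pi / 2)\<bar>) * (1 + l\<^sup>2)"
proof -
  have 1: "\<bar>l\<bar> powr (\<alpha> + 1) \<le> 1 + l\<^sup>2"
  proof (cases "\<bar>l\<bar> \<le> 1")
    case True
    then have "\<bar>l\<bar> powr (\<alpha> + 1) \<le> 1" using assms by (intro powr_le1) auto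
    then show ?thesis by (simp add: add_increasing2)
  next
    case False
    then have "\<bar>l\<bar> powr (\<alpha> + 1) \<le> \<bar>l\<bar> powr 2" using assms by (intro powr_mono) auto
    then show ?thesis using False by simp
  qed
  have "norm (1 - \<i> * complex_of_real (\<beta> * sgn l * tan ((\<alpha> + 1) * pi / 2))) \<le> 1 + \<bar>\<beta> * sgn l * tan ((\<alpha> + 1) * pi / 2)\<bar>"
    by (rule order_trans[OF norm_triangle_ineq4]) (simp add: norm_mult abs_mult)
  also have "\<dots> \<le> 1 + \<bar>\<beta> * tan ((\<alpha> + 1) * pi / 2)\<bar>" by (simp add: abs_mult sgn_if)
  finally show ?thesis unfolding stable_exponent_def norm_mult using 1
    by (subst mult.commute, intro mult_mono) auto
qed

text \<open>In modulus, \<open>gauss \<sigma>\<close> is a multiple of the normal density of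
  standard deviation \<open>1 / \<sigma>\<close>, which has a second moment.\<close>

lemma integrable_gauss_square:
  assumes \<sigma>: "0 < \<sigma>"
  shows "integrable lborel (\<lambda>l. norm (gauss \<sigma> l) * (1 + l\<^sup>2))"
proof -
  have "integrable lborel (\<lambda>l. normal_density 0 (1 / \<sigma>) l + normal_density 0 (1 / \<sigma>) l * (l - 0) ^ 2)"
    using \<sigma> by (intro Bochner_Integration.integrable_add integrable_normal_moment integrable_normal_density) auto
  then have "integrable lborel (\<lambda>l. sqrt (2 * pi * (1 / \<sigma>)\<^sup>2) / (2 * pi) * (normal_density 0 (1 / \<sigma>) l + normal_density 0 (1 / \<sigma>) l * (l - 0) ^ 2))"
    by (rule integrable_mult_right)
  also have "(\<lambda>l. sqrt (2 * pi * (1 / \<sigma>)\<^sup>2) / (2 * pi) * (normal_density 0 (1 / \<sigma>) l + normal_density 0 (1 / \<sigma>) l * (l - 0) ^ 2))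
     = (\<lambda>l. norm (gauss \<sigma> l) * (1 + l\<^sup>2))"
  proof
    fix l
    have "sqrt (2 * pi * (1 / \<sigma>)\<^sup>2) * normal_density 0 (1 / \<sigma>) l = exp (- (\<sigma> * l)\<^sup>2 / 2)"
      using \<sigma> by (simp add: normal_density_def power_mult_distrib power_divide field_simps)
    then have "sqrt (2 * pi * (1 / \<sigma>)\<^sup>2) / (2 * pi) * normal_density 0 (1 / \<sigma>) l = norm (gauss \<sigma> l)"
      unfolding norm_gauss by simp
    then show "sqrt (2 * pi * (1 / \<sigma>)\<^sup>2) / (2 * pi) * (normal_density 0 (1 / \<sigma>) l + normal_density 0 (1 / \<sigma>) l * (l - 0) ^ 2)
      = norm (gauss \<sigma> l) * (1 + l\<^sup>2)"
      by (simp only: distrib_left mult.assoc [symmetric]) simp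
  qed
  finally show ?thesis .
qed

lemma stop_time_antimono:
  assumes "0 \<le> s" "s \<le> real t" "e \<le> e'"
  shows "stop_time w s e' t \<le> stop_time w s e t"
  unfolding stop_time_def using assms bdd_below_stop[of s t w e']
  by (intro cInf_superset_mono) auto

context stable_paths
begin

lemma integrable_exponent_gauss:
  assumes "0 < \<sigma>"
  shows "integrable lborel (\<lambda>l. \<psi> l * gauss \<sigma> l)"
proof (rule Bochner_Integration.integrable_bound)
  let ?C = "1 + \<bar>\<beta> * tan ((\<alpha> + 1) * pi / 2)\<bar>"
  show "integrable lborel (\<lambda>l. ?C * (norm (gauss \<sigma> l) * (1 + l\<^sup>2)))"
    by (intro integrable_mult_right integrable_gauss_square assms)
  show "AE l in lborel. norm (\<psi> l * gauss \<sigma> l) \<le> norm (?C * (norm (gauss \<sigma> l) * (1 + l\<^sup>2)))"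
  proof (intro AE_I2)
    fix l
    have "norm (\<psi> l) * norm (gauss \<sigma> l) \<le> (?C * (1 + l\<^sup>2)) * norm (gauss \<sigma> l)"
      by (intro mult_right_mono norm_stable_exponent_le \<alpha>) auto
    also have "\<dots> = ?C * (norm (gauss \<sigma> l) * (1 + l\<^sup>2))" by (simp only: mult_ac)
    also have "\<dots> \<le> norm (?C * (norm (gauss \<sigma> l) * (1 + l\<^sup>2)))" by simp
    finally show "norm (\<psi> l * gauss \<sigma> l) \<le> norm (?C * (norm (gauss \<sigma> l) * (1 + l\<^sup>2)))"
      unfolding norm_mult .
  qed
qed simp

section \<open>Limit of the entrance times into shrinking neighbourhoods of 0\<close>

definition Tm :: "real \<Rightarrow> nat \<Rightarrow> nat \<Rightarrow> 'a \<Rightarrow> real" where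
  "Tm s t m \<omega> = T s (inverse (real (Suc m))) t \<omega>"

text \<open>Every neighbourhood of 0 is entered strictly before the cap, while the limit
  \<open>S\<close> of the entrance times may still equal \<open>t\<close>.\<close>

definition hits :: "real \<Rightarrow> nat \<Rightarrow> 'a \<Rightarrow> bool" where
  "hits s t \<omega> \<longleftrightarrow> (\<forall>m. Tm s t m \<omega> < t)"

definition S :: "real \<Rightarrow> nat \<Rightarrow> 'a \<Rightarrow> real" where
  "S s t \<omega> = lim (\<lambda>m. Tm s t m \<omega>)"

text \<open>On \<open>hits s t\<close> the positions at the times \<open>Tm s t m\<close> tend to \<open>0\<close>, even if the path jumps at their
  limit \<open>S s t\<close>.\<close>

definition W :: "real \<Rightarrow> nat \<Rightarrow> 'a \<Rightarrow> real" where
  "W s t \<omega> = (if hits s t \<omega> then 0 else X t \<omega>)"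

context
  fixes s :: real and t :: nat
  assumes s: "0 \<le> s" "s \<le> t"
begin

lemma Tm_bounds: "s \<le> Tm s t m \<omega>" "Tm s t m \<omega> \<le> t"
  unfolding Tm_def T_def by (rule stop_time_bounds[OF s])+

lemma Tm_incseq: "incseq (\<lambda>m. Tm s t m \<omega>)"
  unfolding Tm_def T_def by (intro incseq_SucI stop_time_antimono s) (simp add: field_simps)

lemma Tm_tendsto: "(\<lambda>m. Tm s t m \<omega>) \<longlonglongrightarrow> S s t \<omega>"
proof -
  have "norm (Tm s t m \<omega>) \<le> real t" for m using Tm_bounds[of m \<omega>] s by simp
  then have "convergent (\<lambda>m. Tm s t m \<omega>)"
    using Tm_incseq[of \<omega>] by (intro Bseq_mono_convergent BseqI'[where K="real t"]) (auto simp: incseq_def)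
  then show ?thesis by (simp add: S_def convergent_LIMSEQ_iff)
qed

lemma Tm_le_S: "Tm s t m \<omega> \<le> S s t \<omega>"
  by (rule incseq_le[OF Tm_incseq Tm_tendsto])

lemma S_bounds: "s \<le> S s t \<omega>" "S s t \<omega> \<le> t"
proof -
  show "s \<le> S s t \<omega>" using Tm_le_S[of 0 \<omega>] Tm_bounds(1)[of 0 \<omega>] by linarith
  show "S s t \<omega> \<le> t" by (rule LIMSEQ_le_const2[OF Tm_tendsto]) (use Tm_bounds(2) in auto)
qed

lemma not_hits_S: "\<not> hits s t \<omega> \<Longrightarrow> S s t \<omega> = t"
  using Tm_le_S[of _ \<omega>] S_bounds(2)[of \<omega>] by (auto simp: hits_def not_less intro: antisym order_trans)

text \<open>On \<open>hits\<close>, \<open>at_stop_time\<close> bounds the position at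
  \<open>Tm\<close> by \<open>1 / (m + 1)\<close>; otherwise all later \<open>Tm\<close> equal the
  cap.\<close>

lemma X_Tm_tendsto: "(\<lambda>m. X (Tm s t m \<omega>) \<omega>) \<longlonglongrightarrow> W s t \<omega>"
proof (cases "hits s t \<omega>")
  case True
  have "\<bar>X (Tm s t m \<omega>) \<omega>\<bar> \<le> inverse (real (Suc m))" for m
    using True at_stop_time[OF s right_cont_path, of \<omega>] unfolding hits_def Tm_def T_def by auto
  then have "(\<lambda>m. X (Tm s t m \<omega>) \<omega>) \<longlonglongrightarrow> 0"
    by (intro Lim_null_comparison[OF _ LIMSEQ_inverse_real_of_nat]) auto
  then show ?thesis using True by (simp add: W_def)
next
  case False
  then obtain m where m: "real t \<le> Tm s t m \<omega>" by (auto simp: hits_def not_less)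
  have "Tm s t n \<omega> = t" if "m \<le> n" for n
    using incseqD[OF Tm_incseq that, of \<omega>] m Tm_bounds(2)[of n \<omega>] by simp
  then have "\<forall>\<^sub>F n in sequentially. X (Tm s t n \<omega>) \<omega> = W s t \<omega>"
    using False unfolding eventually_sequentially W_def by (intro exI[of _ m]) auto
  then show ?thesis by (rule tendsto_eventually)
qed

lemma X_Tm_measurable [measurable]: "0 \<le> r \<Longrightarrow> (\<lambda>\<omega>. X (Tm s t m \<omega> + r) \<omega>) \<in> borel_measurable M"
  unfolding Tm_def by (rule X_T_measurable[OF s])

lemma X_Tm_measurable0 [measurable]: "(\<lambda>\<omega>. X (Tm s t m \<omega>) \<omega>) \<in> borel_measurable M"
  using X_Tm_measurable[of 0] by simp

lemma Tm_measurable [measurable]: "Tm s t m \<in> borel_measurable M"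
  unfolding Tm_def[abs_def] using T_measurable[OF s] by simp

lemma W_measurable [measurable]: "W s t \<in> borel_measurable M"
  by (rule borel_measurable_LIMSEQ_metric[OF _ X_Tm_tendsto]) measurable

lemma hits_measurable [measurable]: "Measurable.pred M (hits s t)"
  unfolding hits_def[abs_def] by measurable

lemma shifted_limit_measurable: "0 < r \<Longrightarrow> (\<lambda>\<omega>. lim (\<lambda>m. X (Tm s t m \<omega> + r) \<omega>)) \<in> borel_measurable M"
  by (intro borel_measurable_lim_metric X_Tm_measurable) simp

text \<open>The position at \<open>S\<close> is not the limit of the positions at \<open>Tm\<close>
  pathwise; a double limit through times beyond \<open>S\<close> reaches it and yields its
  measurability.\<close>

lemma X_S_limit: "(\<lambda>j. lim (\<lambda>m. X (Tm s t m \<omega> + inverse (real (Suc j))) \<omega>)) \<longlonglongrightarrow> X (S s t \<omega>) \<omega>"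
  using Tm_bounds(1)[of 0 \<omega>] s(1)
  by (intro lim_incseq_shift_tendsto[where w="\<lambda>v. X v \<omega>" and a="\<lambda>m. Tm s t m \<omega>"] X_cadlag Tm_incseq Tm_tendsto
      LIMSEQ_inverse_real_of_nat) auto

lemma X_S_measurable [measurable]: "(\<lambda>\<omega>. X (S s t \<omega>) \<omega>) \<in> borel_measurable M"
  by (rule borel_measurable_LIMSEQ_metric[OF shifted_limit_measurable X_S_limit]) simp

text \<open>Quasi-left-continuity at the announced time \<open>S\<close>: the strong Markov property at \<open>Tm\<close> shows that
  the law of \<open>X\<close> at \<open>S\<close> agrees with the law of the limit \<open>W\<close>, tested against a function with a
  strict maximum at \<open>0\<close>.\<close>

lemma quasi_left_continuity: "AE \<omega> in M. hits s t \<omega> \<longrightarrow> X (S s t \<omega>) \<omega> = 0"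
proof -
  define G where "G = gauss 1"
  have G: "integrable lborel G" and \<psi>G: "integrable lborel (\<lambda>l. \<psi> l * G l)"
    unfolding G_def by (auto intro: integrable_gauss integrable_exponent_gauss)
  define g where "g = ft G"
  have g_eq: "g z = of_real (std_normal_density z)" for z
    using gauss_fourier_shift[of 1 0 z] by (simp add: g_def G_def)
  define Bg where "Bg = (LINT l|lborel. norm (G l))"
  have g_bound: "norm (g z) \<le> Bg" for z unfolding g_def Bg_def by (rule norm_ft_le)
  have g_cont: "continuous_on UNIV g" unfolding g_def by (rule continuous_on_ft[OF G])
  note [measurable] = ft_measurable[OF G, folded g_def]
  have lim_g: "(\<lambda>n. expectation (\<lambda>\<omega>. g (Z n \<omega>))) \<longlonglongrightarrow> expectation (\<lambda>\<omega>. g (Z' \<omega>))"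
    if "\<And>\<omega>. (\<lambda>n. Z n \<omega>) \<longlonglongrightarrow> Z' \<omega>" and [measurable]: "\<And>n. Z n \<in> borel_measurable M" "Z' \<in> borel_measurable M" for Z Z'
  proof (rule integral_dominated_convergence[where w="\<lambda>_. Bg"])
    show "AE \<omega> in M. (\<lambda>n. g (Z n \<omega>)) \<longlonglongrightarrow> g (Z' \<omega>)"
      by (intro AE_I2 continuous_on_tendsto_compose[OF g_cont that(1)]) auto
  qed (use g_bound in auto)
  define c where "c = (LINT l|lborel. norm (\<psi> l * G l))"
  \<comment> \<open>Uniform in \<open>m\<close>: by the strong Markov property a delay
    \<open>r\<close> multiplies \<open>G\<close> by \<open>exp (- r * \<psi> l)\<close>, a change of
    modulus at most \<open>r * norm (\<psi> l * G l)\<close>.\<close>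
  have shift: "norm (expectation (\<lambda>\<omega>. g (X (Tm s t m \<omega> + r) \<omega>)) - expectation (\<lambda>\<omega>. g (X (Tm s t m \<omega>) \<omega>))) \<le> r * c"
    if r: "0 \<le> r" for m r
  proof -
    let ?H = "\<lambda>l. G l * exp (- complex_of_real r * \<psi> l)"
    have H: "integrable lborel ?H" by (rule integrable_semigroup[OF G r])
    note [measurable] = ft_measurable[OF H] X_Tm_measurable0
    have "expectation (\<lambda>\<omega>. g (X (Tm s t m \<omega> + r) \<omega>)) - expectation (\<lambda>\<omega>. g (X (Tm s t m \<omega>) \<omega>))
       = expectation (\<lambda>\<omega>. ft ?H (X (Tm s t m \<omega>) \<omega>)) - expectation (\<lambda>\<omega>. g (X (Tm s t m \<omega>) \<omega>))"
      unfolding g_def Tm_def strong_markov[OF s G r] ..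
    also have "\<dots> = expectation (\<lambda>\<omega>. ft ?H (X (Tm s t m \<omega>) \<omega>) - g (X (Tm s t m \<omega>) \<omega>))"
    proof (rule Bochner_Integration.integral_diff [symmetric])
      show "integrable M (\<lambda>\<omega>. ft ?H (X (Tm s t m \<omega>) \<omega>))"
        by (rule integrable_const_bound[OF AE_I2[OF norm_ft_le] measurable_compose[OF X_Tm_measurable0 ft_measurable[OF H]]])
      show "integrable M (\<lambda>\<omega>. g (X (Tm s t m \<omega>) \<omega>))"
        using g_bound by (intro integrable_const_bound[where B=Bg]) auto
    qed
    also have "\<dots> = expectation (\<lambda>\<omega>. ft (\<lambda>l. ?H l - G l) (X (Tm s t m \<omega>) \<omega>))"
      unfolding g_def ft_diff[OF H G] ..
    also have "norm \<dots> \<le> expectation (\<lambda>\<omega>. norm (ft (\<lambda>l. ?H l - G l) (X (Tm s t m \<omega>) \<omega>)))"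
      by (rule integral_norm_bound)
    also have "\<dots> \<le> expectation (\<lambda>\<omega>. r * c)"
    proof (rule integral_mono_AE')
      have "norm (ft (\<lambda>l. ?H l - G l) z) \<le> r * c" for z
      proof (rule order_trans[OF norm_ft_le])
        have "norm (?H l - G l) \<le> r * norm (\<psi> l * G l)" for l
        proof -
          have "?H l - G l = - (G l * (1 - exp (- (complex_of_real r * \<psi> l))))" by (simp add: algebra_simps)
          then have "norm (?H l - G l) = norm (G l) * norm (1 - exp (- (complex_of_real r * \<psi> l)))"
            by (simp only: norm_minus_cancel norm_mult)
          also have "\<dots> \<le> norm (G l) * norm (complex_of_real r * \<psi> l)"
            using r Re_stable_exponent[of \<alpha> \<beta> l] by (intro mult_left_mono norm_one_minus_exp_le) auto
          finally show ?thesis using r by (simp add: norm_mult mult_ac)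
        qed
        then have "(LINT l|lborel. norm (?H l - G l)) \<le> (LINT l|lborel. r * norm (\<psi> l * G l))"
          by (intro integral_mono integrable_norm Bochner_Integration.integrable_diff H G integrable_mult_right \<psi>G)
        then show "(LINT l|lborel. norm (?H l - G l)) \<le> r * c" by (simp add: c_def)
      qed
      then show "AE \<omega> in M. norm (ft (\<lambda>l. ?H l - G l) (X (Tm s t m \<omega>) \<omega>)) \<le> r * c" by auto
    qed (use r in \<open>auto simp: c_def\<close>)
    finally show ?thesis by (simp add: prob_space)
  qed
  \<comment> \<open>First \<open>m\<close> tends to infinity with the delay fixed, then the delay
    tends to 0; the bound \<open>shift\<close> survives the first limit and vanishes in the
    second.\<close>
  have E: "expectation (\<lambda>\<omega>. g (X (S s t \<omega>) \<omega>)) = expectation (\<lambda>\<omega>. g (W s t \<omega>))"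
  proof -
    have "norm (expectation (\<lambda>\<omega>. g (lim (\<lambda>m. X (Tm s t m \<omega> + inverse (real (Suc j))) \<omega>))) - expectation (\<lambda>\<omega>. g (W s t \<omega>)))
        \<le> inverse (real (Suc j)) * c" for j
    proof (rule tendsto_upperbound)
      have "(\<lambda>m. X (Tm s t m \<omega> + inverse (real (Suc j))) \<omega>) \<longlonglongrightarrow> lim (\<lambda>m. X (Tm s t m \<omega> + inverse (real (Suc j))) \<omega>)" for \<omega>
        using cadlag_incseq_shift_convergent[OF X_cadlag Tm_incseq Tm_tendsto, of \<omega> "inverse (real (Suc j))"]
          Tm_bounds(1)[of 0 \<omega>] s(1) by (simp add: convergent_LIMSEQ_iff)
      then show "(\<lambda>m. norm (expectation (\<lambda>\<omega>. g (X (Tm s t m \<omega> + inverse (real (Suc j))) \<omega>)) - expectation (\<lambda>\<omega>. g (X (Tm s t m \<omega>) \<omega>))))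
         \<longlonglongrightarrow> norm (expectation (\<lambda>\<omega>. g (lim (\<lambda>m. X (Tm s t m \<omega> + inverse (real (Suc j))) \<omega>))) - expectation (\<lambda>\<omega>. g (W s t \<omega>)))"
        by (intro tendsto_norm tendsto_diff lim_g X_Tm_tendsto shifted_limit_measurable X_Tm_measurable X_Tm_measurable0 W_measurable) auto
    qed (use shift[of "inverse (real (Suc j))"] in auto)
    moreover have "(\<lambda>j. expectation (\<lambda>\<omega>. g (lim (\<lambda>m. X (Tm s t m \<omega> + inverse (real (Suc j))) \<omega>))) - expectation (\<lambda>\<omega>. g (W s t \<omega>)))
       \<longlonglongrightarrow> expectation (\<lambda>\<omega>. g (X (S s t \<omega>) \<omega>)) - expectation (\<lambda>\<omega>. g (W s t \<omega>))"
      by (intro tendsto_diff lim_g X_S_limit shifted_limit_measurable X_S_measurable tendsto_const) auto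
    moreover have "(\<lambda>j. inverse (real (Suc j)) * c) \<longlonglongrightarrow> 0"
      by (intro tendsto_mult_left_zero LIMSEQ_inverse_real_of_nat)
    ultimately have "expectation (\<lambda>\<omega>. g (X (S s t \<omega>) \<omega>)) - expectation (\<lambda>\<omega>. g (W s t \<omega>)) = 0"
      by (intro LIMSEQ_unique[OF _ Lim_null_comparison]) auto
    then show ?thesis by simp
  qed
  \<comment> \<open>Off \<open>hits\<close> the two arguments coincide because \<open>S = t\<close>;
    on \<open>hits\<close> the first is 0, where the density is largest. So \<open>h\<close> is
    nonnegative with mean 0, and since the maximum is strict, \<open>h = 0\<close> forces the
    position at \<open>S\<close> to be 0.\<close>
  define h where "h \<omega> = std_normal_density (W s t \<omega>) - std_normal_density (X (S s t \<omega>) \<omega>)" for \<omega>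
  have bnd: "norm (std_normal_density z) \<le> Bg" for z
    using g_bound[of z] unfolding g_eq norm_of_real by simp
  have int: "integrable M (\<lambda>\<omega>. std_normal_density (W s t \<omega>))" "integrable M (\<lambda>\<omega>. std_normal_density (X (S s t \<omega>) \<omega>))"
    using bnd by (auto intro!: integrable_const_bound[where B=Bg])
  have "expectation h = 0"
  proof -
    have "expectation h = expectation (\<lambda>\<omega>. std_normal_density (W s t \<omega>)) - expectation (\<lambda>\<omega>. std_normal_density (X (S s t \<omega>) \<omega>))"
      unfolding h_def using int by (rule Bochner_Integration.integral_diff)
    also have "\<dots> = 0" using E unfolding g_eq by simp
    finally show ?thesis .
  qed
  moreover have h_nonneg: "0 \<le> h \<omega>" for \<omega>
    using not_hits_S[of \<omega>] by (auto simp: h_def W_def std_normal_density_def divide_right_mono)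
  moreover have "integrable M h" unfolding h_def[abs_def] using int by (rule Bochner_Integration.integrable_diff)
  ultimately have "AE \<omega> in M. h \<omega> = 0" by (subst (asm) integral_nonneg_eq_0_iff_AE) auto
  then show ?thesis
  proof eventually_elim
    case (elim \<omega>)
    then show ?case by (auto simp: h_def W_def std_normal_density_def)
  qed
qed

end
end

section \<open>Moments of occupation integrals\<close>

context stable_paths
begin

lemma integrable_gauss_decay:
  assumes "0 < \<sigma>" "0 \<le> r"
  shows "integrable lborel (\<lambda>l. norm (gauss \<sigma> l) * exp (- (r * \<bar>l\<bar> powr (\<alpha> + 1))))"
proof (rule Bochner_Integration.integrable_bound[OF integrable_gauss[OF assms(1)]])
  show "AE l in lborel. norm (norm (gauss \<sigma> l) * exp (- (r * \<bar>l\<bar> powr (\<alpha> + 1)))) \<le> norm (gauss \<sigma> l)"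
    using assms by (intro AE_I2) (auto intro!: mult_left_le)
qed simp

text \<open>Bounds the density of \<open>X r\<close> convolved with a centred normal law of standard
  deviation \<sigma>, uniformly in the starting point and the place: the oscillating factors are
  dropped from the inversion integral.\<close>

definition kern :: "real \<Rightarrow> real \<Rightarrow> real" where
  "kern \<sigma> r = (LINT l|lborel. norm (gauss \<sigma> l) * exp (- (r * \<bar>l\<bar> powr (\<alpha> + 1))))"

text \<open>Bounds \<open>(1/2\<pi>) \<integral> min t |l|\<^sup>-\<^sup>1\<^sup>-\<^sup>\<alpha> dl\<close>, with the integral split at \<open>|l| = t\<^sup>-\<^sup>1\<^sup>/\<^sup>2\<close>.\<close>

definition kappa :: "real \<Rightarrow> real" where
  "kappa t = (t powr (1 / 2) + t powr (\<alpha> / 2) / \<alpha>) / pi"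

lemma kern_nonneg: "0 \<le> kern \<sigma> r"
  unfolding kern_def by simp

lemma kappa_nonneg: "0 \<le> kappa t"
  unfolding kappa_def using \<alpha> by simp

lemma kern_measurable [measurable]: "kern \<sigma> \<in> borel_measurable borel"
  unfolding kern_def[abs_def] by measurable

text \<open>The weight of the past is nonnegative and factors out, because \<open>kern\<close>
  bounds the smoothed transition density whatever the position at \<open>ts k\<close>.\<close>

lemma expectation_normal_density_le:
  assumes ts: "mono ts" "ts 0 = (0::real)"
    and c [measurable]: "\<And>i. c i \<in> borel_measurable borel"
    and c0: "\<And>i z. 0 \<le> c i z" and c1: "\<And>i z. c i z \<le> (1::real)"
    and \<sigma>: "0 < \<sigma>"
  shows "expectation (\<lambda>\<omega>. (\<Prod>i\<le>k. c i (X (ts i) \<omega>)) * normal_density y \<sigma> (X (ts (Suc k)) \<omega>))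
     \<le> expectation (\<lambda>\<omega>. \<Prod>i\<le>k. c i (X (ts i) \<omega>)) * kern \<sigma> (ts (Suc k) - ts k)"
proof -
  have ts_nonneg: "0 \<le> ts i" for i using ts monoD[OF ts(1), of 0 i] by simp
  have [measurable]: "X (ts i) \<in> borel_measurable M" for i using ts_nonneg by (rule X_measurable)
  define d where "d = ts (Suc k) - ts k"
  have d: "0 \<le> d" using monoD[OF ts(1), of k "Suc k"] by (simp add: d_def)
  let ?F = "\<lambda>\<omega>. \<Prod>i\<le>k. c i (X (ts i) \<omega>)"
  let ?G = "\<lambda>l. gauss \<sigma> l * iexp (- (l * y))"
  let ?H = "\<lambda>l. ?G l * exp (- complex_of_real d * \<psi> l)"
  have cabs: "\<bar>c i z\<bar> \<le> 1" for i z using c0[of i z] c1[of i z] by simp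
  have F0: "0 \<le> ?F \<omega>" for \<omega> by (intro prod_nonneg) (auto simp: c0)
  have F1: "?F \<omega> \<le> 1" for \<omega> by (intro prod_le_1) (auto simp: c0 c1)
  have G: "integrable lborel ?G"
    using integrable_ft[OF integrable_gauss[OF \<sigma>], of "- y"] by simp
  have H: "integrable lborel ?H" by (rule integrable_semigroup[OF G d])
  note [measurable] = ft_measurable[OF H]
  have Hk: "(LINT l|lborel. norm (?H l)) = kern \<sigma> d"
    unfolding kern_def norm_mult norm_exp_stable_exponent by (simp add: norm_iexp_eq_1[of "- _", simplified])
  have "complex_of_real (expectation (\<lambda>\<omega>. ?F \<omega> * normal_density y \<sigma> (X (ts (Suc k)) \<omega>)))
     = expectation (\<lambda>\<omega>. of_real (?F \<omega>) * ft ?G (X (ts (Suc k)) \<omega>))"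
    unfolding gauss_fourier_shift[OF \<sigma>] by (simp flip: integral_complex_of_real)
  also have "\<dots> = expectation (\<lambda>\<omega>. of_real (?F \<omega>) * ft ?H (X (ts k) \<omega>))"
    unfolding d_def by (rule markov_ft[OF ts c cabs G])
  finally have eq: "complex_of_real (expectation (\<lambda>\<omega>. ?F \<omega> * normal_density y \<sigma> (X (ts (Suc k)) \<omega>)))
     = expectation (\<lambda>\<omega>. of_real (?F \<omega>) * ft ?H (X (ts k) \<omega>))" .
  have "expectation (\<lambda>\<omega>. ?F \<omega> * normal_density y \<sigma> (X (ts (Suc k)) \<omega>))
     \<le> norm (expectation (\<lambda>\<omega>. of_real (?F \<omega>) * ft ?H (X (ts k) \<omega>)))"
    unfolding eq [symmetric] norm_of_real by (rule abs_ge_self)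
  also have "\<dots> \<le> expectation (\<lambda>\<omega>. norm (of_real (?F \<omega>) * ft ?H (X (ts k) \<omega>)))"
    by (rule integral_norm_bound)
  also have "\<dots> \<le> expectation (\<lambda>\<omega>. ?F \<omega> * kern \<sigma> d)"
  proof (rule integral_mono_AE')
    show "integrable M (\<lambda>\<omega>. ?F \<omega> * kern \<sigma> d)"
      using F0 F1 by (intro integrable_mult_left integrable_const_bound[where B=1]) auto
    show "AE \<omega> in M. norm (of_real (?F \<omega>) * ft ?H (X (ts k) \<omega>)) \<le> ?F \<omega> * kern \<sigma> d"
      using F0 norm_ft_le[of ?H, unfolded Hk] unfolding norm_mult norm_of_real
      by (intro AE_I2 mult_mono) (auto simp del: abs_prod)
  qed (use F0 kern_nonneg in auto)
  finally show ?thesis by (simp add: d_def)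
qed

lemma expectation_normal_density_le_kern:
  assumes "0 < \<sigma>" "0 \<le> v"
  shows "expectation (\<lambda>\<omega>. normal_density y \<sigma> (X v \<omega>)) \<le> kern \<sigma> v"
  using expectation_normal_density_le[of "\<lambda>i. if i = 0 then 0 else v" "\<lambda>_ _. 1" \<sigma> 0 y] assms
  by (auto simp: mono_def prob_space)

lemma expectation_two_normal_density_le:
  assumes \<sigma>: "0 < \<sigma>" and v: "0 \<le> v" "v \<le> w"
  shows "expectation (\<lambda>\<omega>. normal_density y \<sigma> (X v \<omega>) * normal_density y \<sigma> (X w \<omega>)) \<le> kern \<sigma> v * kern \<sigma> (w - v)"
proof -
  define B where "B = normal_density 0 \<sigma> 0"
  have B: "0 < B" unfolding B_def by (rule normal_density_pos[OF \<sigma>])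
  define ts where "ts i = (if i = 0 then 0 else if i = 1 then v else w)" for i :: nat
  \<comment> \<open>The first density is divided by its maximum \<open>B\<close> to become an
    admissible weight with values in \<open>{0..1}\<close>.\<close>
  define c where "c i z = (if i = 1 then normal_density y \<sigma> z / B else 1)" for i :: nat and z
  have "expectation (\<lambda>\<omega>. (\<Prod>i\<le>1. c i (X (ts i) \<omega>)) * normal_density y \<sigma> (X (ts (Suc 1)) \<omega>))
     \<le> expectation (\<lambda>\<omega>. \<Prod>i\<le>1. c i (X (ts i) \<omega>)) * kern \<sigma> (ts (Suc 1) - ts 1)"
  proof (rule expectation_normal_density_le)
    show "mono ts" using v by (auto simp: mono_def ts_def)
    show "c i \<in> borel_measurable borel" for i unfolding c_def by measurable
    show "0 \<le> c i z" "c i z \<le> 1" for i z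
      using B normal_density_le_max[OF \<sigma>, of y z] by (auto simp: c_def B_def)
  qed (auto simp: ts_def \<sigma>)
  then have "expectation (\<lambda>\<omega>. normal_density y \<sigma> (X v \<omega>) * normal_density y \<sigma> (X w \<omega>) / B)
     \<le> expectation (\<lambda>\<omega>. normal_density y \<sigma> (X v \<omega>) / B) * kern \<sigma> (w - v)"
    by (simp add: c_def ts_def)
  then have "expectation (\<lambda>\<omega>. normal_density y \<sigma> (X v \<omega>) * normal_density y \<sigma> (X w \<omega>))
     \<le> expectation (\<lambda>\<omega>. normal_density y \<sigma> (X v \<omega>)) * kern \<sigma> (w - v)"
    using B by (simp add: divide_le_cancel)
  also have "\<dots> \<le> kern \<sigma> v * kern \<sigma> (w - v)"
    by (intro mult_right_mono expectation_normal_density_le_kern \<sigma> v kern_nonneg)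
  finally show ?thesis .
qed

text \<open>The bound is free of \<sigma>, as the passage to point masses requires: integrating in
  \<open>r\<close> first gives at most \<open>min t (|l|^(-1-\<alpha>))\<close>, which is integrable
  without help from the Gaussian factor.\<close>

lemma nn_integral_kern_le:
  assumes \<sigma>: "0 < \<sigma>" and t: "0 \<le> t"
  shows "(\<integral>\<^sup>+r\<in>{0..t}. ennreal (kern \<sigma> r) \<partial>lborel) \<le> ennreal (kappa t)"
proof (cases "t = 0")
  case True
  then show ?thesis by (simp add: nn_integral_null_set)
next
  case False
  then have t: "0 < t" using t by simp
  have inner: "(\<integral>\<^sup>+r\<in>{0..t}. ennreal (exp (- (r * \<bar>l\<bar> powr (\<alpha> + 1)))) \<partial>lborel) \<le> ennreal (min t (\<bar>l\<bar> powr (- 1 - \<alpha>)))"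
    if "l \<noteq> 0" for l
  proof -
    let ?a = "\<bar>l\<bar> powr (\<alpha> + 1)"
    have a: "0 < ?a" using that by simp
    have "(\<integral>\<^sup>+r\<in>{0..t}. ennreal (exp (- (r * ?a))) \<partial>lborel) \<le> (\<integral>\<^sup>+r. indicator {0..t} r \<partial>lborel)"
      using a by (intro nn_integral_mono) (auto simp: indicator_def)
    also have "\<dots> = ennreal t" using t by simp
    finally have 1: "(\<integral>\<^sup>+r\<in>{0..t}. ennreal (exp (- (r * ?a))) \<partial>lborel) \<le> ennreal t" .
    have "(\<integral>\<^sup>+r\<in>{0..t}. ennreal (exp (- (r * ?a))) \<partial>lborel) \<le> (\<integral>\<^sup>+r\<in>{0<..}. ennreal (r powr (1 - 1) * exp (- (?a * r))) \<partial>lborel)"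
      by (intro nn_integral_mono_AE, use AE_lborel_singleton[of 0] in eventually_elim) (auto simp: indicator_def mult.commute)
    also have "\<dots> = ennreal (\<bar>l\<bar> powr (- 1 - \<alpha>))"
    proof -
      have "- 1 - \<alpha> = - (\<alpha> + 1)" by simp
      then have "1 / ?a = \<bar>l\<bar> powr (- 1 - \<alpha>)" by (simp only: powr_minus_divide)
      then show ?thesis using a by (subst nn_integral_Gamma_scaled) (auto simp: powr_minus_divide)
    qed
    finally show ?thesis using 1 by (auto simp: min_def)
  qed
  have "(\<integral>\<^sup>+r\<in>{0..t}. ennreal (kern \<sigma> r) \<partial>lborel)
     = (\<integral>\<^sup>+r. (\<integral>\<^sup>+l. ennreal (norm (gauss \<sigma> l) * exp (- (r * \<bar>l\<bar> powr (\<alpha> + 1)))) * indicator {0..t} r \<partial>lborel) \<partial>lborel)"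
  proof (intro nn_integral_cong)
    fix r
    show "ennreal (kern \<sigma> r) * indicator {0..t} r = (\<integral>\<^sup>+l. ennreal (norm (gauss \<sigma> l) * exp (- (r * \<bar>l\<bar> powr (\<alpha> + 1)))) * indicator {0..t} r \<partial>lborel)"
    proof (cases "r \<in> {0..t}")
      case True
      then show ?thesis unfolding kern_def
        using nn_integral_eq_integral[OF integrable_gauss_decay[OF \<sigma>, of r]] by simp
    qed simp
  qed
  also have "\<dots> = (\<integral>\<^sup>+l. (\<integral>\<^sup>+r. ennreal (norm (gauss \<sigma> l) * exp (- (r * \<bar>l\<bar> powr (\<alpha> + 1)))) * indicator {0..t} r \<partial>lborel) \<partial>lborel)"
    by (rule lborel_pair.Fubini') measurable
  also have "\<dots> \<le> (\<integral>\<^sup>+l. ennreal (1 / (2 * pi)) * ennreal (min t (\<bar>l\<bar> powr (- 1 - \<alpha>))) \<partial>lborel)"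
  proof (intro nn_integral_mono_AE, use AE_lborel_singleton[of 0] in eventually_elim)
    fix l :: real assume l: "l \<noteq> 0"
    have "(\<integral>\<^sup>+r. ennreal (norm (gauss \<sigma> l) * exp (- (r * \<bar>l\<bar> powr (\<alpha> + 1)))) * indicator {0..t} r \<partial>lborel)
       = ennreal (norm (gauss \<sigma> l)) * (\<integral>\<^sup>+r\<in>{0..t}. ennreal (exp (- (r * \<bar>l\<bar> powr (\<alpha> + 1)))) \<partial>lborel)"
      by (subst nn_integral_cmult [symmetric]) (auto simp: ennreal_mult' mult.assoc)
    also have "\<dots> \<le> ennreal (1 / (2 * pi)) * ennreal (min t (\<bar>l\<bar> powr (- 1 - \<alpha>)))"
      by (intro mult_mono inner l ennreal_leI norm_gauss_le) auto
    finally show "(\<integral>\<^sup>+r. ennreal (norm (gauss \<sigma> l) * exp (- (r * \<bar>l\<bar> powr (\<alpha> + 1)))) * indicator {0..t} r \<partial>lborel)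
       \<le> ennreal (1 / (2 * pi)) * ennreal (min t (\<bar>l\<bar> powr (- 1 - \<alpha>)))" .
  qed
  also have "\<dots> = ennreal (1 / (2 * pi)) * (\<integral>\<^sup>+l. ennreal (min t (\<bar>l\<bar> powr (- 1 - \<alpha>))) \<partial>lborel)"
    by (rule nn_integral_cmult) simp
  \<comment> \<open>The cut \<open>t powr (- 1 / 2)\<close> makes both resulting terms vanish with
    \<open>t\<close>.\<close>
  also have "\<dots> \<le> ennreal (1 / (2 * pi)) * ennreal (2 * (t * t powr (- 1 / 2) + (t powr (- 1 / 2)) powr (- \<alpha>) / \<alpha>))"
    using \<alpha> t by (intro mult_left_mono nn_integral_min_powr_le) auto
  also have "\<dots> = ennreal (1 / (2 * pi) * (2 * (t * t powr (- 1 / 2) + (t powr (- 1 / 2)) powr (- \<alpha>) / \<alpha>)))"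
    by (rule ennreal_mult' [symmetric]) simp
  also have "1 / (2 * pi) * (2 * (t * t powr (- 1 / 2) + (t powr (- 1 / 2)) powr (- \<alpha>) / \<alpha>)) = kappa t"
  proof -
    have "t * t powr (- 1 / 2) = t powr (1 / 2)"
      using t powr_add[of t 1 "- 1 / 2"] by simp
    moreover have "(t powr (- 1 / 2)) powr (- \<alpha>) = t powr (\<alpha> / 2)" by (simp add: powr_powr)
    ultimately show ?thesis by (simp add: kappa_def add_divide_distrib)
  qed
  finally show ?thesis .
qed

text \<open>Fubini over paths and time needs this; as for a single path, the process is read at the
  next dyadic time.\<close>

lemma X_joint_measurable [measurable]: "(\<lambda>p. X (max 0 (snd p)) (fst p)) \<in> borel_measurable (M \<Otimes>\<^sub>M lborel)"
proof (rule borel_measurable_LIMSEQ_metric)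
  show "(\<lambda>n. X (max 0 (next_dyadic n (snd p))) (fst p)) \<longlonglongrightarrow> X (max 0 (snd p)) (fst p)" for p
  proof (rule right_cont_seq[OF right_cont_path])
    show "(\<lambda>n. max 0 (next_dyadic n (snd p))) \<longlonglongrightarrow> max 0 (snd p)"
      by (intro tendsto_max tendsto_const next_dyadic_tendsto)
    show "max 0 (snd p) \<le> max 0 (next_dyadic n (snd p))" for n
      using next_dyadic_bounds(1)[of "snd p" n] by auto
  qed simp
  show "(\<lambda>p. X (max 0 (next_dyadic n (snd p))) (fst p)) \<in> borel_measurable (M \<Otimes>\<^sub>M lborel)" for n
  proof -
    have "(\<lambda>p. (\<lambda>(i::int) p. X (max 0 (real_of_int (i + 1) / 2 ^ n)) (fst p)) \<lfloor>snd p * (2::real) ^ n\<rfloor> p) \<in> borel_measurable (M \<Otimes>\<^sub>M lborel)"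
    proof (rule measurable_compose_countable[where f="\<lambda>(i::int) p. X (max 0 (real_of_int (i + 1) / 2 ^ n)) (fst p)" and g="\<lambda>p. \<lfloor>snd p * (2::real) ^ n\<rfloor>"])
      show "(\<lambda>p. X (max 0 (real_of_int (i + 1) / 2 ^ n)) (fst p)) \<in> borel_measurable (M \<Otimes>\<^sub>M lborel)" for i
        by (rule measurable_compose[OF measurable_fst X_measurable]) simp
    qed measurable
    then show ?thesis by (simp add: next_dyadic_def)
  qed
qed

lemma X_joint_compose_measurable [measurable (raw)]:
  assumes [measurable]: "f \<in> N \<rightarrow>\<^sub>M M" "g \<in> borel_measurable N"
  shows "(\<lambda>p. X (max 0 (g p)) (f p)) \<in> borel_measurable N"
proof -
  have "(\<lambda>p. (f p, g p)) \<in> N \<rightarrow>\<^sub>M M \<Otimes>\<^sub>M lborel" by measurable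
  from measurable_compose[OF this X_joint_measurable] show ?thesis by simp
qed

lemma occupation_first_moment:
  assumes \<sigma>: "0 < \<sigma>" and t: "0 \<le> t"
  shows "(\<integral>\<^sup>+\<omega>. (\<integral>\<^sup>+v\<in>{0..t}. ennreal (normal_density y \<sigma> (X v \<omega>)) \<partial>lborel) \<partial>M) \<le> ennreal (kappa t)"
proof -
  interpret P: pair_sigma_finite M lborel ..
  have "(\<integral>\<^sup>+\<omega>. (\<integral>\<^sup>+v\<in>{0..t}. ennreal (normal_density y \<sigma> (X v \<omega>)) \<partial>lborel) \<partial>M)
    = (\<integral>\<^sup>+\<omega>. (\<integral>\<^sup>+v\<in>{0..t}. ennreal (normal_density y \<sigma> (X (max 0 v) \<omega>)) \<partial>lborel) \<partial>M)"
    by (intro nn_integral_cong) (auto simp: indicator_def)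
  also have "\<dots> = (\<integral>\<^sup>+v. (\<integral>\<^sup>+\<omega>. ennreal (normal_density y \<sigma> (X (max 0 v) \<omega>)) * indicator {0..t} v \<partial>M) \<partial>lborel)"
    by (rule P.Fubini' [symmetric]) measurable
  also have "\<dots> \<le> (\<integral>\<^sup>+v\<in>{0..t}. ennreal (kern \<sigma> v) \<partial>lborel)"
  proof (intro nn_integral_mono)
    fix v
    have "(\<integral>\<^sup>+\<omega>. ennreal (normal_density y \<sigma> (X v \<omega>)) \<partial>M) \<le> ennreal (kern \<sigma> v)" if v: "0 \<le> v"
    proof -
      have [measurable]: "X v \<in> borel_measurable M" using v by (rule X_measurable)
      have "integrable M (\<lambda>\<omega>. normal_density y \<sigma> (X v \<omega>))"
        using normal_density_le_max[OF \<sigma>] by (intro integrable_const_bound[where B="normal_density 0 \<sigma> 0"]) auto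
      then show ?thesis
        using expectation_normal_density_le_kern[OF \<sigma> v] by (subst nn_integral_eq_integral) (auto intro: ennreal_leI)
    qed
    then show "(\<integral>\<^sup>+\<omega>. ennreal (normal_density y \<sigma> (X (max 0 v) \<omega>)) * indicator {0..t} v \<partial>M) \<le> ennreal (kern \<sigma> v) * indicator {0..t} v"
      by (auto simp: indicator_def)
  qed
  also have "\<dots> \<le> ennreal (kappa t)" by (rule nn_integral_kern_le[OF \<sigma> t])
  finally show ?thesis .
qed

text \<open>The square is a double integral over pairs of times; ordering the pair costs a factor 2,
  and for \<open>v \<le> w\<close> the expectation is at most
  \<open>kern \<sigma> v * kern \<sigma> (w - v)\<close>. The bound is uniform in \<sigma> and
  serves as uniform integrability in \<open>L_T_lower\<close>.\<close>

lemma occupation_second_moment: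
  assumes \<sigma>: "0 < \<sigma>" and t: "0 \<le> t"
  shows "(\<integral>\<^sup>+\<omega>. (\<integral>\<^sup>+v\<in>{0..t}. ennreal (normal_density y \<sigma> (X v \<omega>)) \<partial>lborel)\<^sup>2 \<partial>M) \<le> 2 * (ennreal (kappa t))\<^sup>2"
proof -
  interpret P: pair_sigma_finite M lborel ..
  define N where "N \<omega> v = ennreal (normal_density y \<sigma> (X (max 0 v) \<omega>)) * indicator {0..t} v" for \<omega> v
  have [measurable (raw)]: "(\<lambda>p. N (f p) (g p)) \<in> borel_measurable Q"
    if [measurable]: "f \<in> Q \<rightarrow>\<^sub>M M" "g \<in> borel_measurable Q" for f g and Q :: "'q measure"
    unfolding N_def by measurable
  have N [measurable]: "N \<omega> \<in> borel_measurable lborel" if "\<omega> \<in> space M" for \<omega>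
    unfolding N_def[abs_def] using right_cont_measurable[OF right_cont_path] by measurable
  have sq: "(\<integral>\<^sup>+v\<in>{0..t}. ennreal (normal_density y \<sigma> (X v \<omega>)) \<partial>lborel)\<^sup>2
     \<le> 2 * (\<integral>\<^sup>+v. (\<integral>\<^sup>+w. N \<omega> v * N \<omega> w * indicator {v..} w \<partial>lborel) \<partial>lborel)" if \<omega>: "\<omega> \<in> space M" for \<omega>
  proof -
    define n where "n = N \<omega>"
    have [measurable]: "n \<in> borel_measurable borel" using N[OF \<omega>] by (simp add: n_def)
    have "(\<integral>\<^sup>+v\<in>{0..t}. ennreal (normal_density y \<sigma> (X v \<omega>)) \<partial>lborel) = (\<integral>\<^sup>+v. n v \<partial>lborel)"
      by (intro nn_integral_cong) (auto simp: indicator_def n_def N_def)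
    then have "(\<integral>\<^sup>+v\<in>{0..t}. ennreal (normal_density y \<sigma> (X v \<omega>)) \<partial>lborel)\<^sup>2 = (\<integral>\<^sup>+v. n v * (\<integral>\<^sup>+w. n w \<partial>lborel) \<partial>lborel)"
      by (simp add: power2_eq_square nn_integral_multc)
    also have "\<dots> = (\<integral>\<^sup>+v. (\<integral>\<^sup>+w. n v * n w \<partial>lborel) \<partial>lborel)"
      by (simp add: nn_integral_cmult)
    \<comment> \<open>The diagonal is counted twice, which an upper bound permits.\<close>
    also have "\<dots> \<le> (\<integral>\<^sup>+v. (\<integral>\<^sup>+w. n v * n w * indicator {v..} w + n v * n w * indicator {w..} v \<partial>lborel) \<partial>lborel)"
      by (intro nn_integral_mono) (auto simp: indicator_def)
    also have "\<dots> = (\<integral>\<^sup>+v. (\<integral>\<^sup>+w. n v * n w * indicator {v..} w \<partial>lborel)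
        + (\<integral>\<^sup>+w. n v * n w * indicator {w..} v \<partial>lborel) \<partial>lborel)"
      unfolding indicator_def atLeast_iff by (intro nn_integral_cong nn_integral_add) measurable
    also have "\<dots> = (\<integral>\<^sup>+v. (\<integral>\<^sup>+w. n v * n w * indicator {v..} w \<partial>lborel) \<partial>lborel)
       + (\<integral>\<^sup>+v. (\<integral>\<^sup>+w. n v * n w * indicator {w..} v \<partial>lborel) \<partial>lborel)"
      unfolding indicator_def atLeast_iff by (rule nn_integral_add) measurable
    also have "(\<integral>\<^sup>+v. (\<integral>\<^sup>+w. n v * n w * indicator {w..} v \<partial>lborel) \<partial>lborel)
       = (\<integral>\<^sup>+w. (\<integral>\<^sup>+v. n v * n w * indicator {w..} v \<partial>lborel) \<partial>lborel)"
      unfolding indicator_def atLeast_iff by (rule lborel_pair.Fubini') measurable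
    finally show ?thesis by (simp add: n_def [symmetric] mult_2 mult.commute)
  qed
  have "(\<integral>\<^sup>+\<omega>. (\<integral>\<^sup>+v\<in>{0..t}. ennreal (normal_density y \<sigma> (X v \<omega>)) \<partial>lborel)\<^sup>2 \<partial>M)
     \<le> (\<integral>\<^sup>+\<omega>. 2 * (\<integral>\<^sup>+v. (\<integral>\<^sup>+w. N \<omega> v * N \<omega> w * indicator {v..} w \<partial>lborel) \<partial>lborel) \<partial>M)"
    by (intro nn_integral_mono sq)
  also have "\<dots> = 2 * (\<integral>\<^sup>+\<omega>. (\<integral>\<^sup>+v. (\<integral>\<^sup>+w. N \<omega> v * N \<omega> w * indicator {v..} w \<partial>lborel) \<partial>lborel) \<partial>M)"
    unfolding indicator_def atLeast_iff by (rule nn_integral_cmult) measurable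
  also have "(\<integral>\<^sup>+\<omega>. (\<integral>\<^sup>+v. (\<integral>\<^sup>+w. N \<omega> v * N \<omega> w * indicator {v..} w \<partial>lborel) \<partial>lborel) \<partial>M)
     = (\<integral>\<^sup>+v. (\<integral>\<^sup>+\<omega>. (\<integral>\<^sup>+w. N \<omega> v * N \<omega> w * indicator {v..} w \<partial>lborel) \<partial>M) \<partial>lborel)"
    unfolding indicator_def atLeast_iff by (rule P.Fubini' [symmetric]) measurable
  also have "\<dots> = (\<integral>\<^sup>+v. (\<integral>\<^sup>+w. (\<integral>\<^sup>+\<omega>. N \<omega> v * N \<omega> w * indicator {v..} w \<partial>M) \<partial>lborel) \<partial>lborel)"
    unfolding indicator_def atLeast_iff by (intro nn_integral_cong P.Fubini' [symmetric]) measurable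
  also have "\<dots> \<le> (\<integral>\<^sup>+v. (\<integral>\<^sup>+w. (ennreal (kern \<sigma> v) * indicator {0..t} v) * (ennreal (kern \<sigma> (w - v)) * indicator {0..t} (w - v)) \<partial>lborel) \<partial>lborel)"
  proof (intro nn_integral_mono)
    fix v w
    show "(\<integral>\<^sup>+\<omega>. N \<omega> v * N \<omega> w * indicator {v..} w \<partial>M) \<le> (ennreal (kern \<sigma> v) * indicator {0..t} v) * (ennreal (kern \<sigma> (w - v)) * indicator {0..t} (w - v))"
    proof (cases "0 \<le> v \<and> v \<le> w \<and> w \<le> t")
      case True
      then have [measurable]: "X v \<in> borel_measurable M" "X w \<in> borel_measurable M" by (auto intro: X_measurable)
      let ?f = "\<lambda>\<omega>. normal_density y \<sigma> (X v \<omega>) * normal_density y \<sigma> (X w \<omega>)"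
      have "integrable M ?f"
        using normal_density_le_max[OF \<sigma>]
        by (intro integrable_const_bound[where B="normal_density 0 \<sigma> 0 * normal_density 0 \<sigma> 0"]) (auto intro!: mult_mono simp: abs_mult)
      then have "(\<integral>\<^sup>+\<omega>. ennreal (?f \<omega>) \<partial>M) \<le> ennreal (kern \<sigma> v * kern \<sigma> (w - v))"
        using expectation_two_normal_density_le[OF \<sigma>, of v w y] True
        by (subst nn_integral_eq_integral) (auto intro: ennreal_leI)
      moreover have "(\<integral>\<^sup>+\<omega>. N \<omega> v * N \<omega> w * indicator {v..} w \<partial>M) = (\<integral>\<^sup>+\<omega>. ennreal (?f \<omega>) \<partial>M)"
        using True by (intro nn_integral_cong) (auto simp: N_def ennreal_mult')
      ultimately show ?thesis using True kern_nonneg by (simp add: ennreal_mult')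
    next
      case False
      then have "(\<lambda>\<omega>. N \<omega> v * N \<omega> w * indicator {v..} w) = (\<lambda>_. 0)"
        by (auto simp: N_def indicator_def fun_eq_iff)
      then show ?thesis by (simp only:) simp
    qed
  qed
  also have "\<dots> = (\<integral>\<^sup>+v. (ennreal (kern \<sigma> v) * indicator {0..t} v) * (\<integral>\<^sup>+r\<in>{0..t}. ennreal (kern \<sigma> r) \<partial>lborel) \<partial>lborel)"
  proof (intro nn_integral_cong)
    fix v
    have "(\<integral>\<^sup>+r\<in>{0..t}. ennreal (kern \<sigma> r) \<partial>lborel) = ennreal \<bar>1\<bar> * (\<integral>\<^sup>+w. ennreal (kern \<sigma> (- v + 1 * w)) * indicator {0..t} (- v + 1 * w) \<partial>lborel)"
      by (rule nn_integral_real_affine) auto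
    then show "(\<integral>\<^sup>+w. (ennreal (kern \<sigma> v) * indicator {0..t} v) * (ennreal (kern \<sigma> (w - v)) * indicator {0..t} (w - v)) \<partial>lborel)
       = (ennreal (kern \<sigma> v) * indicator {0..t} v) * (\<integral>\<^sup>+r\<in>{0..t}. ennreal (kern \<sigma> r) \<partial>lborel)"
      by (subst nn_integral_cmult) auto
  qed
  also have "\<dots> = (\<integral>\<^sup>+r\<in>{0..t}. ennreal (kern \<sigma> r) \<partial>lborel) * (\<integral>\<^sup>+r\<in>{0..t}. ennreal (kern \<sigma> r) \<partial>lborel)"
    by (rule nn_integral_multc) simp
  also have "\<dots> \<le> ennreal (kappa t) * ennreal (kappa t)"
    by (intro mult_mono nn_integral_kern_le \<sigma> t) auto
  finally show ?thesis by (simp add: power2_eq_square mult_left_mono)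
qed

end

section \<open>The stopped potential identity\<close>

text \<open>The counterpart of Fatou's lemma: \<open>A \<le> min A k + A^2 / k\<close> bounds the
  mass above level \<open>k\<close> uniformly in \<open>j\<close>, so none of it is lost in the
  limit.\<close>

lemma (in prob_space) limit_le_nn_integral_of_bounded_second_moment:
  fixes A :: "nat \<Rightarrow> 'a \<Rightarrow> real"
  assumes [measurable]: "\<And>j. A j \<in> borel_measurable M"
    and nonneg: "\<And>j \<omega>. 0 \<le> A j \<omega>"
    and lim: "\<And>\<omega>. (\<lambda>j. A j \<omega>) \<longlonglongrightarrow> B \<omega>"
    and int: "\<And>j. integrable M (A j)"
    and sq: "\<And>j. (\<integral>\<^sup>+\<omega>. (ennreal (A j \<omega>))\<^sup>2 \<partial>M) \<le> ennreal c"
    and E: "(\<lambda>j. expectation (A j)) \<longlonglongrightarrow> a"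
  shows "ennreal a \<le> (\<integral>\<^sup>+\<omega>. ennreal (B \<omega>) \<partial>M)"
proof (cases "(\<integral>\<^sup>+\<omega>. ennreal (B \<omega>) \<partial>M)")
  case (real b)
  have [measurable]: "B \<in> borel_measurable M" by (rule borel_measurable_LIMSEQ_metric[OF _ lim]) measurable
  have B0: "0 \<le> B \<omega>" for \<omega> by (rule LIMSEQ_le_const[OF lim]) (use nonneg in auto)
  \<comment> \<open>The hypothesis sees \<open>c\<close> only through \<open>ennreal\<close>, which
    sends negative numbers to 0.\<close>
  define c' where "c' = max 0 c"
  have "a \<le> b + c' / real (Suc K)" for K
  proof -
    define k where "k = real (Suc K)"
    have k: "0 < k" by (simp add: k_def)
    have intmin: "integrable M (\<lambda>\<omega>. min (A j \<omega>) k)" for j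
      using nonneg k by (intro integrable_const_bound[where B=k]) auto
    have sq_int: "integrable M (\<lambda>\<omega>. (A j \<omega>)\<^sup>2)" and sq_le: "expectation (\<lambda>\<omega>. (A j \<omega>)\<^sup>2) \<le> c'" for j
    proof -
      have le: "(\<integral>\<^sup>+\<omega>. ennreal ((A j \<omega>)\<^sup>2) \<partial>M) \<le> ennreal c'"
        using order_trans[OF sq[of j] ennreal_leI[of c c']] nonneg by (simp add: ennreal_power c'_def)
      show 1: "integrable M (\<lambda>\<omega>. (A j \<omega>)\<^sup>2)"
        by (rule integrableI_nonneg) (use le in \<open>auto intro: le_less_trans\<close>)
      show "expectation (\<lambda>\<omega>. (A j \<omega>)\<^sup>2) \<le> c'"
      proof -
        have "0 \<le> c'" by (simp add: c'_def)
        then show ?thesis using le by (subst (asm) nn_integral_eq_integral[OF 1]) auto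
      qed
    qed
    have "expectation (A j) \<le> expectation (\<lambda>\<omega>. min (A j \<omega>) k) + c' / k" for j
    proof -
      have "expectation (A j) \<le> expectation (\<lambda>\<omega>. min (A j \<omega>) k + (A j \<omega>)\<^sup>2 / k)"
      proof (rule integral_mono[OF int])
        show "integrable M (\<lambda>\<omega>. min (A j \<omega>) k + (A j \<omega>)\<^sup>2 / k)"
          by (intro Bochner_Integration.integrable_add intmin Bochner_Integration.integrable_divide sq_int)
        fix \<omega>
        show "A j \<omega> \<le> min (A j \<omega>) k + (A j \<omega>)\<^sup>2 / k"
        proof (cases "A j \<omega> \<le> k")
          case False
          then have "A j \<omega> * k \<le> A j \<omega> * A j \<omega>" using nonneg by (intro mult_left_mono) auto
          then have "A j \<omega> \<le> (A j \<omega>)\<^sup>2 / k" using k by (simp add: power2_eq_square pos_le_divide_eq)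
          then show ?thesis using False k by simp
        qed (use k in simp)
      qed
      also have "\<dots> = expectation (\<lambda>\<omega>. min (A j \<omega>) k) + expectation (\<lambda>\<omega>. (A j \<omega>)\<^sup>2) / k"
        using intmin sq_int by simp
      also have "\<dots> \<le> expectation (\<lambda>\<omega>. min (A j \<omega>) k) + c' / k"
        using sq_le k by (intro add_left_mono divide_right_mono) auto
      finally show ?thesis .
    qed
    moreover have "(\<lambda>j. expectation (\<lambda>\<omega>. min (A j \<omega>) k)) \<longlonglongrightarrow> expectation (\<lambda>\<omega>. min (B \<omega>) k)"
      by (rule integral_dominated_convergence[where w="\<lambda>_. k"])
        (use nonneg k in \<open>auto intro!: tendsto_min lim\<close>)
    then have "(\<lambda>j. expectation (\<lambda>\<omega>. min (A j \<omega>) k) + c' / k) \<longlonglongrightarrow> expectation (\<lambda>\<omega>. min (B \<omega>) k) + c' / k"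
      by (intro tendsto_intros)
    ultimately have "a \<le> expectation (\<lambda>\<omega>. min (B \<omega>) k) + c' / k"
      by (intro LIMSEQ_le[OF E]) auto
    moreover have "expectation (\<lambda>\<omega>. min (B \<omega>) k) \<le> b"
    proof -
      have "integrable M (\<lambda>\<omega>. min (B \<omega>) k)" using B0 k by (intro integrable_const_bound[where B=k]) auto
      then have "ennreal (expectation (\<lambda>\<omega>. min (B \<omega>) k)) = (\<integral>\<^sup>+\<omega>. ennreal (min (B \<omega>) k) \<partial>M)"
        using B0 k by (intro nn_integral_eq_integral [symmetric]) auto
      also have "\<dots> \<le> ennreal b" unfolding real(2) [symmetric] by (intro nn_integral_mono ennreal_leI) auto
      finally show ?thesis using real(1) by simp
    qed
    ultimately show ?thesis by (simp add: k_def)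
  qed
  moreover have "(\<lambda>K. b + c' / real (Suc K)) \<longlonglongrightarrow> b + 0"
    using LIMSEQ_inverse_real_of_nat by (intro tendsto_add tendsto_const) (auto simp: divide_inverse intro: tendsto_mult_right_zero)
  ultimately have "a \<le> b" by (intro LIMSEQ_le_const[of _ b a]) auto
  then show ?thesis using real by (simp add: ennreal_leI)
qed simp

locale stable_local_times = stable_paths M X x \<alpha> \<beta>
  for M :: "'a measure" and X :: "real \<Rightarrow> 'a \<Rightarrow> real" and x \<alpha> \<beta> :: real +
  fixes L :: "real \<Rightarrow> real \<Rightarrow> 'a \<Rightarrow> real"
  assumes L_nonneg: "\<And>y t \<omega>. 0 \<le> t \<Longrightarrow> 0 \<le> L y t \<omega>"
    and L_continuous: "\<And>\<omega>. continuous_on (UNIV \<times> {0..}) (\<lambda>(y, t). L y t \<omega>)"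
    and L_occupation: "\<And>t A \<omega>. 0 \<le> t \<Longrightarrow> A \<in> sets borel \<Longrightarrow>
       emeasure lborel {s \<in> {0..t}. X s \<omega> \<in> A} = (\<integral>\<^sup>+y\<in>A. ennreal (L y t \<omega>) \<partial>lborel)"
begin

definition occ :: "real \<Rightarrow> real \<Rightarrow> real \<Rightarrow> 'a \<Rightarrow> real" where
  "occ y \<sigma> u \<omega> = (LINT v:{0..<u}|lborel. normal_density y \<sigma> (X v \<omega>))"

abbreviation \<sigma>\<^sub>j :: "nat \<Rightarrow> real" where "\<sigma>\<^sub>j j \<equiv> inverse (real (Suc j))"

lemma occ_tendsto: "0 \<le> u \<Longrightarrow> (\<lambda>j. occ y (\<sigma>\<^sub>j j) u \<omega>) \<longlonglongrightarrow> L y u \<omega>"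
  unfolding occ_def by (rule occupation_tendsto_local_time[OF right_cont_path L_nonneg L_continuous L_occupation])

lemma L_mono: "0 \<le> a \<Longrightarrow> a \<le> b \<Longrightarrow> L y a \<omega> \<le> L y b \<omega>"
  by (rule local_time_mono[OF right_cont_path L_nonneg L_continuous L_occupation])

lemma L_continuous_time: "continuous_on {0..} (\<lambda>t. L y t \<omega>)"
  by (rule local_time_continuous_time[OF right_cont_path L_nonneg L_continuous L_occupation])

lemma occ_alt: "occ y \<sigma> u \<omega> = (LINT v|lborel. indicator {0..<u} v * normal_density y \<sigma> (X (max 0 v) \<omega>))"
  unfolding occ_def set_lebesgue_integral_def
  by (intro Bochner_Integration.integral_cong) (auto simp: indicator_def)

lemma occ_integrand_integrable:
  assumes "0 < \<sigma>"
  shows "integrable lborel (\<lambda>v. indicator {0..<u} v * normal_density y \<sigma> (X (max 0 v) \<omega>))"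
proof (rule Bochner_Integration.integrable_bound)
  note [measurable] = right_cont_measurable[OF right_cont_path, of \<omega>]
  show "integrable lborel (\<lambda>v. normal_density 0 \<sigma> 0 * indicator {0..<u} v)"
    by (cases "0 \<le> u") (auto intro!: integrable_mult_right integrable_real_indicator)
  show "AE v in lborel. norm (indicator {0..<u} v * normal_density y \<sigma> (X (max 0 v) \<omega>)) \<le> norm (normal_density 0 \<sigma> 0 * indicator {0..<u} v)"
    using normal_density_le_max[OF assms] by (intro AE_I2) (auto simp: indicator_def)
  show "(\<lambda>v. indicator {0..<u} v * normal_density y \<sigma> (X (max 0 v) \<omega>)) \<in> borel_measurable lborel" by measurable
qed

lemma occ_nonneg: "0 \<le> occ y \<sigma> u \<omega>"
  unfolding occ_alt by (intro integral_nonneg_AE AE_I2) auto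

lemma ennreal_occ:
  assumes "0 < \<sigma>"
  shows "ennreal (occ y \<sigma> u \<omega>) = (\<integral>\<^sup>+v. ennreal (indicator {0..<u} v * normal_density y \<sigma> (X (max 0 v) \<omega>)) \<partial>lborel)"
  unfolding occ_alt by (rule nn_integral_eq_integral [symmetric, OF occ_integrand_integrable[OF assms]]) auto

lemma ennreal_occ_le:
  assumes "0 < \<sigma>" "u \<le> t"
  shows "ennreal (occ y \<sigma> u \<omega>) \<le> (\<integral>\<^sup>+v\<in>{0..t}. ennreal (normal_density y \<sigma> (X v \<omega>)) \<partial>lborel)"
  unfolding ennreal_occ[OF assms(1)] using assms(2) by (intro nn_integral_mono) (auto simp: indicator_def)

lemma occ_le:
  assumes "0 < \<sigma>" "0 \<le> u" "u \<le> t"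
  shows "occ y \<sigma> u \<omega> \<le> t * normal_density 0 \<sigma> 0"
proof -
  have int: "integrable lborel (\<lambda>v. indicator {0..<u} v * normal_density 0 \<sigma> 0)"
    using assms(2) by (intro integrable_mult_left integrable_real_indicator) auto
  have "occ y \<sigma> u \<omega> \<le> (LINT v|lborel. indicator {0..<u} v * normal_density 0 \<sigma> 0)"
    unfolding occ_alt using normal_density_le_max[OF assms(1)] assms(2)
    by (intro integral_mono occ_integrand_integrable int assms(1)) (auto simp: indicator_def)
  also have "\<dots> = u * normal_density 0 \<sigma> 0" using assms(2) by simp
  also have "\<dots> \<le> t * normal_density 0 \<sigma> 0" using assms(3) by (intro mult_right_mono) auto
  finally show ?thesis .
qed

text \<open>\<open>\<psi> * G0 y\<close> is the Fourier transform of the difference of the point masses at \<open>y\<close> and \<open>0\<close>; at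
  \<open>l = 0\<close> the division by zero gives \<open>0\<close>.\<close>

definition G0 :: "real \<Rightarrow> real \<Rightarrow> complex" where
  "G0 y l = (iexp (- (l * y)) - 1) / \<psi> l / of_real (2 * pi)"

text \<open>The function \<open>g\<close> of the overview. What matters in the end is
  \<open>gp y x - gp y 0\<close>, the asserted value of the expected local time.\<close>

definition gp :: "real \<Rightarrow> real \<Rightarrow> real" where
  "gp y z = potential \<alpha> \<beta> (- z) - potential \<alpha> \<beta> (y - z)"

abbreviation "gpT y s e t \<equiv> expectation (\<lambda>\<omega>. gp y (X (T s e t \<omega>) \<omega>))"

abbreviation "gpTm y s t m \<equiv> expectation (\<lambda>\<omega>. gp y (X (Tm s t m \<omega>) \<omega>))"

abbreviation "gpW y s t \<equiv> expectation (\<lambda>\<omega>. gp y (W s t \<omega>))"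

abbreviation "occT y \<sigma> s e t \<equiv> expectation (\<lambda>\<omega>. occ y \<sigma> (T s e t \<omega>) \<omega>)"

abbreviation "hitL y \<equiv> \<integral>\<^sup>+\<omega>. local_time_at L y (hitting_time X 0) \<omega> \<partial>M"

lemma G0_integrable: "integrable lborel (G0 y)"
proof -
  have "norm (iexp (- (l * y)) - 1) \<le> (2 * (1 + \<bar>y\<bar>)) * min 1 \<bar>l\<bar>" for l
  proof -
    have "norm (iexp (- (l * y)) - 1) \<le> 2 * min 1 \<bar>- (l * y)\<bar>"
      using norm_one_minus_iexp_le[of "- (l * y)"] by (simp add: norm_minus_commute)
    also have "min 1 \<bar>- (l * y)\<bar> \<le> (1 + \<bar>y\<bar>) * min 1 \<bar>l\<bar>"
      by (auto simp: min_def abs_mult algebra_simps)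
    finally show ?thesis by (simp only: mult.assoc)
  qed
  then have "integrable lborel (\<lambda>l. (iexp (- (l * y)) - 1) / \<psi> l)"
    by (intro integrable_div_stable_exponent[OF \<alpha>]) auto
  then show ?thesis unfolding G0_def[abs_def] by (rule Bochner_Integration.integrable_divide)
qed

lemma G0_measurable [measurable]: "G0 y \<in> borel_measurable borel"
  using borel_measurable_integrable[OF G0_integrable] by simp

text \<open>\<open>(iexp (- (l * y)) - 1) * iexp (l * z)\<close> is the difference of
  \<open>1 - iexp (l * z)\<close> and \<open>1 - iexp (- (l * (y - z)))\<close>, and each of these
  divided by \<psi> is integrable by itself.\<close>

lemma ft_G0: "ft (G0 y) z = of_real (gp y z)"
proof -
  have "(\<lambda>l. G0 y l * iexp (l * z)) = (\<lambda>l. potential_integrand \<alpha> \<beta> (- z) l - potential_integrand \<alpha> \<beta> (y - z) l)"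
  proof
    fix l
    have "iexp (- (l * y)) * iexp (l * z) = iexp (- (l * (y - z)))" by (simp add: algebra_simps flip: exp_add)
    then show "G0 y l * iexp (l * z) = potential_integrand \<alpha> \<beta> (- z) l - potential_integrand \<alpha> \<beta> (y - z) l"
    proof -
      have e: "iexp (- (l * (- z))) = iexp (l * z)" by simp
      have alg: "(a - 1) / p / c * b = (1 - b) / p / c - (1 - a * b) / p / c" for a b p c :: complex
        by (simp add: diff_divide_distrib left_diff_distrib)
      show ?thesis
        unfolding G0_def potential_integrand_def[OF \<alpha>] e \<open>iexp (- (l * y)) * iexp (l * z) = _\<close> [symmetric]
        by (rule alg)
    qed
  qed
  then show ?thesis
    using potential_integrand_integral[OF \<alpha>, of \<beta> "- z"] potential_integrand_integral[OF \<alpha>, of \<beta> "y - z"]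
    by (simp add: ft_def gp_def has_bochner_integral_iff)
qed

definition gp_bound :: "real \<Rightarrow> real" where
  "gp_bound y = (LINT l|lborel. norm (G0 y l))"

lemma gp_abs_le: "\<bar>gp y z\<bar> \<le> gp_bound y"
  using norm_ft_le[of "G0 y" z] unfolding ft_G0 gp_bound_def by simp

lemma gp_continuous: "continuous_on UNIV (gp y)"
  using continuous_on_ft[OF G0_integrable, of y] unfolding ft_G0
  by (simp add: continuous_on_of_real_o_iff [unfolded o_def])

lemma gp_measurable [measurable]: "gp y \<in> borel_measurable borel"
  by (rule borel_measurable_continuous_onI[OF gp_continuous])

definition damp :: "real \<Rightarrow> real \<Rightarrow> real" where
  "damp \<sigma> l = exp (- (\<sigma> * l)\<^sup>2 / 2)"

text \<open>Bounds, uniformly in the position, the change of \<open>gp y\<close> when its Fourier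
  integrand is damped.\<close>

definition eta :: "real \<Rightarrow> real \<Rightarrow> real" where
  "eta y \<sigma> = (LINT l|lborel. norm (G0 y l) * (1 - damp \<sigma> l))"

lemma damp_bounds: "0 < damp \<sigma> l" "damp \<sigma> l \<le> 1"
  by (simp_all add: damp_def)

lemma damp_measurable [measurable]: "damp \<sigma> \<in> borel_measurable borel"
  unfolding damp_def[abs_def] by measurable

lemma eta_tendsto: "(\<lambda>j. eta y (\<sigma>\<^sub>j j)) \<longlonglongrightarrow> 0"
proof -
  have "(\<lambda>j. eta y (\<sigma>\<^sub>j j)) \<longlonglongrightarrow> integral\<^sup>L lborel (\<lambda>l::real. 0::real)"
    unfolding eta_def
  proof (rule integral_dominated_convergence)
    show "integrable lborel (\<lambda>l. norm (G0 y l))" using G0_integrable by (rule integrable_norm)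
    show "AE l in lborel. norm (norm (G0 y l) * (1 - damp (\<sigma>\<^sub>j j) l)) \<le> norm (G0 y l)" for j
      using damp_bounds[of "\<sigma>\<^sub>j j"] by (intro AE_I2) (auto simp: abs_mult intro!: mult_left_le simp: less_imp_le)
    have "(\<lambda>j. damp (\<sigma>\<^sub>j j) l) \<longlonglongrightarrow> exp (- (0 * l)\<^sup>2 / 2)" for l
      unfolding damp_def by (intro tendsto_intros LIMSEQ_inverse_real_of_nat) auto
    then have "(\<lambda>j. norm (G0 y l) * (1 - damp (\<sigma>\<^sub>j j) l)) \<longlonglongrightarrow> norm (G0 y l) * (1 - 1)" for l
      by (intro tendsto_intros) simp
    then show "AE l in lborel. (\<lambda>j. norm (G0 y l) * (1 - damp (\<sigma>\<^sub>j j) l)) \<longlonglongrightarrow> 0" by simp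
  qed measurable
  then show ?thesis by simp
qed

context
  fixes s e :: real and t :: nat
  assumes s: "0 \<le> s" "s \<le> t"
begin

lemma T_bounds: "s \<le> T s e t \<omega>" "0 \<le> T s e t \<omega>" "T s e t \<omega> \<le> t"
  using stop_time_bounds[OF s, of "\<lambda>v. X v \<omega>" e] s unfolding T_def by auto

lemma X_T_measurable0 [measurable]: "(\<lambda>\<omega>. X (T s e t \<omega>) \<omega>) \<in> borel_measurable M"
  using X_T_measurable[OF s, of 0 e] by simp

lemma occ_T_measurable [measurable]: "(\<lambda>\<omega>. occ y \<sigma> (T s e t \<omega>) \<omega>) \<in> borel_measurable M"
proof -
  note [measurable] = T_measurable[OF s]
  have "(\<lambda>\<omega>. LINT v|lborel. of_bool (0 \<le> v \<and> v < T s e t \<omega>) * normal_density y \<sigma> (X (max 0 v) \<omega>)) \<in> borel_measurable M"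
    by measurable
  then show ?thesis unfolding occ_alt by (simp add: indicator_def)
qed

lemma occ_T_integrable: "0 < \<sigma> \<Longrightarrow> integrable M (\<lambda>\<omega>. occ y \<sigma> (T s e t \<omega>) \<omega>)"
  using occ_le[OF _ T_bounds(2,3)] occ_nonneg
  by (intro integrable_const_bound[where B="real t * normal_density 0 \<sigma> 0"]) auto

lemma gp_X_T_integrable: "integrable M (\<lambda>\<omega>. gp y (X (T s e t \<omega>) \<omega>))"
  using gp_abs_le by (intro integrable_const_bound[where B="gp_bound y"]) auto

text \<open>\<open>dynkin\<close> does not fit \<open>G0\<close>, because
  \<open>\<psi> l * G0 y l\<close> is in general not integrable. After damping, this product has as
  its \<open>ft\<close> the difference of two normal densities, at \<open>y\<close> and at 0; the
  error \<open>eta\<close> occurs at the start and at the stopped position.\<close>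

lemma occ_difference:
  assumes \<sigma>: "0 < \<sigma>"
  shows "\<bar>(occT y \<sigma> s e t - occT 0 \<sigma> s e t)
     - (gp y x - gpT y s e t)\<bar> \<le> 2 * eta y \<sigma>"
proof -
  define G where "G l = G0 y l * of_real (damp \<sigma> l)" for l
  have G_int: "integrable lborel G"
    unfolding G_def[abs_def]
    by (rule Bochner_Integration.integrable_bound[OF G0_integrable[of y]])
      (use damp_bounds in \<open>auto simp: norm_mult less_imp_le intro!: mult_left_le\<close>)
  have I1: "integrable lborel (\<lambda>l. gauss \<sigma> l * iexp (- (l * y)))" for y
    using integrable_ft[OF integrable_gauss[OF \<sigma>], of "- y"] by simp
  \<comment> \<open>At \<open>l = 0\<close>, where \<open>G0\<close> is 0 by convention, both sides
    vanish.\<close>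
  have \<psi>G_eq: "(\<lambda>l. \<psi> l * G l) = (\<lambda>l. gauss \<sigma> l * iexp (- (l * y)) - gauss \<sigma> l * iexp (- (l * 0)))"
  proof
    fix l show "\<psi> l * G l = gauss \<sigma> l * iexp (- (l * y)) - gauss \<sigma> l * iexp (- (l * 0))"
      by (cases "l = 0") (simp_all add: G_def G0_def gauss_def damp_def algebra_simps diff_divide_distrib)
  qed
  have \<psi>G_int: "integrable lborel (\<lambda>l. \<psi> l * G l)"
    unfolding \<psi>G_eq by (intro Bochner_Integration.integrable_diff I1)
  have f: "ft (\<lambda>l. \<psi> l * G l) z = of_real (normal_density y \<sigma> z - normal_density 0 \<sigma> z)" for z
    unfolding \<psi>G_eq ft_diff[OF I1 I1] gauss_fourier_shift[OF \<sigma>] by simp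
  have close: "norm (ft G z - of_real (gp y z)) \<le> eta y \<sigma>" for z
  proof -
    have "ft G z - of_real (gp y z) = ft (\<lambda>l. G l - G0 y l) z"
      unfolding ft_G0 [symmetric] by (rule ft_diff [OF G_int G0_integrable, symmetric])
    also have "norm \<dots> \<le> (LINT l|lborel. norm (G l - G0 y l))" by (rule norm_ft_le)
    also have "\<dots> = eta y \<sigma>" unfolding eta_def
    proof (intro Bochner_Integration.integral_cong refl)
      fix l
      have "G l - G0 y l = - (G0 y l * of_real (1 - damp \<sigma> l))" by (simp add: G_def algebra_simps)
      then show "norm (G l - G0 y l) = norm (G0 y l) * (1 - damp \<sigma> l)"
        using damp_bounds(2)[of \<sigma> l] by (simp only: norm_minus_cancel norm_mult norm_of_real)
    qed
    finally show ?thesis .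
  qed
  note [measurable] = ft_measurable[OF G_int]
  let ?XT = "\<lambda>\<omega>. X (T s e t \<omega>) \<omega>"
  have gint: "integrable M (\<lambda>\<omega>. ft G (?XT \<omega>))"
    by (rule integrable_const_bound[OF AE_I2[OF norm_ft_le]]) measurable
  have "expectation (\<lambda>\<omega>. LINT v:{0..<T s e t \<omega>}|lborel. ft (\<lambda>l. \<psi> l * G l) (X v \<omega>))
     = ft G x - expectation (\<lambda>\<omega>. ft G (?XT \<omega>))"
    by (rule dynkin(2)[OF s G_int \<psi>G_int])
  also have "(\<lambda>\<omega>. LINT v:{0..<T s e t \<omega>}|lborel. ft (\<lambda>l. \<psi> l * G l) (X v \<omega>))
     = (\<lambda>\<omega>. complex_of_real (occ y \<sigma> (T s e t \<omega>) \<omega> - occ 0 \<sigma> (T s e t \<omega>) \<omega>))"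
  proof
    fix \<omega>
    let ?T = "T s e t \<omega>"
    have "occ y \<sigma> ?T \<omega> - occ 0 \<sigma> ?T \<omega> = (LINT v|lborel. indicator {0..<?T} v * normal_density y \<sigma> (X (max 0 v) \<omega>)
        - indicator {0..<?T} v * normal_density 0 \<sigma> (X (max 0 v) \<omega>))"
      unfolding occ_alt by (intro Bochner_Integration.integral_diff [symmetric] occ_integrand_integrable \<sigma>)
    then have "complex_of_real (occ y \<sigma> ?T \<omega> - occ 0 \<sigma> ?T \<omega>) = (LINT v|lborel. complex_of_real (indicator {0..<?T} v * normal_density y \<sigma> (X (max 0 v) \<omega>)
        - indicator {0..<?T} v * normal_density 0 \<sigma> (X (max 0 v) \<omega>)))"
      by (simp only: integral_complex_of_real)
    also have "\<dots> = (LINT v:{0..<?T}|lborel. ft (\<lambda>l. \<psi> l * G l) (X v \<omega>))"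
      unfolding set_lebesgue_integral_def f by (intro Bochner_Integration.integral_cong) (auto simp: indicator_def)
    finally show "(LINT v:{0..<?T}|lborel. ft (\<lambda>l. \<psi> l * G l) (X v \<omega>)) = complex_of_real (occ y \<sigma> ?T \<omega> - occ 0 \<sigma> ?T \<omega>)" ..
  qed
  finally have id: "complex_of_real (occT y \<sigma> s e t - occT 0 \<sigma> s e t)
     = ft G x - expectation (\<lambda>\<omega>. ft G (?XT \<omega>))"
    by (simp add: occ_T_integrable \<sigma> integral_complex_of_real del: of_real_diff)
  have "norm (expectation (\<lambda>\<omega>. ft G (?XT \<omega>)) - expectation (\<lambda>\<omega>. complex_of_real (gp y (?XT \<omega>)))) \<le> eta y \<sigma>"
  proof -
    have diff: "expectation (\<lambda>\<omega>. ft G (?XT \<omega>)) - expectation (\<lambda>\<omega>. complex_of_real (gp y (?XT \<omega>)))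
       = expectation (\<lambda>\<omega>. ft G (?XT \<omega>) - complex_of_real (gp y (?XT \<omega>)))"
      by (rule Bochner_Integration.integral_diff [symmetric, OF gint integrable_of_real[OF gp_X_T_integrable]])
    have "norm (expectation (\<lambda>\<omega>. ft G (?XT \<omega>)) - expectation (\<lambda>\<omega>. complex_of_real (gp y (?XT \<omega>))))
       \<le> expectation (\<lambda>\<omega>. norm (ft G (?XT \<omega>) - complex_of_real (gp y (?XT \<omega>))))"
      unfolding diff by (rule integral_norm_bound)
    also have "\<dots> \<le> expectation (\<lambda>\<omega>. eta y \<sigma>)"
    proof (rule integral_mono)
      show "integrable M (\<lambda>\<omega>. norm (ft G (?XT \<omega>) - complex_of_real (gp y (?XT \<omega>))))"
        by (rule integrable_norm[OF Bochner_Integration.integrable_diff[OF gint integrable_of_real[OF gp_X_T_integrable]]])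
    qed (simp_all add: close)
    finally show ?thesis by (simp add: prob_space)
  qed
  then have "norm ((ft G x - expectation (\<lambda>\<omega>. ft G (?XT \<omega>))) - (complex_of_real (gp y x) - expectation (\<lambda>\<omega>. complex_of_real (gp y (?XT \<omega>))))) \<le> eta y \<sigma> + eta y \<sigma>"
    using close[of x] norm_triangle_ineq4[of "ft G x - complex_of_real (gp y x)" "expectation (\<lambda>\<omega>. ft G (?XT \<omega>)) - expectation (\<lambda>\<omega>. complex_of_real (gp y (?XT \<omega>)))"]
    by (simp add: algebra_simps)
  then show ?thesis
    unfolding id [symmetric] integral_complex_of_real of_real_diff [symmetric] norm_of_real by simp
qed

text \<open>Before \<open>s\<close> the path is unrestricted and the first moment bound
  \<open>kappa s\<close> is used; from \<open>s\<close> up to the entrance time it keeps distance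
  \<open>e\<close> from 0, where the normal density is at most its value at
  \<open>e\<close>.\<close>

lemma occ_zero_bound:
  assumes \<sigma>: "0 < \<sigma>" and e: "0 \<le> e"
  shows "occT 0 \<sigma> s e t \<le> kappa s + t * normal_density 0 \<sigma> e"
proof -
  have pw: "ennreal (occ 0 \<sigma> (T s e t \<omega>) \<omega>) \<le> (\<integral>\<^sup>+v\<in>{0..s}. ennreal (normal_density 0 \<sigma> (X v \<omega>)) \<partial>lborel) + ennreal (t * normal_density 0 \<sigma> e)" for \<omega>
  proof -
    note [measurable] = right_cont_measurable[OF right_cont_path, of \<omega>]
    have "ennreal (occ 0 \<sigma> (T s e t \<omega>) \<omega>) \<le> (\<integral>\<^sup>+v. ennreal (normal_density 0 \<sigma> (X (max 0 v) \<omega>)) * indicator {0..s} v + ennreal (normal_density 0 \<sigma> e) * indicator {0..real t} v \<partial>lborel)"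
      unfolding ennreal_occ[OF \<sigma>]
    proof (intro nn_integral_mono)
      fix v
      show "ennreal (indicator {0..<T s e t \<omega>} v * normal_density 0 \<sigma> (X (max 0 v) \<omega>))
         \<le> ennreal (normal_density 0 \<sigma> (X (max 0 v) \<omega>)) * indicator {0..s} v + ennreal (normal_density 0 \<sigma> e) * indicator {0..real t} v"
      proof (cases "0 \<le> v \<and> v < T s e t \<omega> \<and> s < v")
        case True
        then have "e \<le> \<bar>X v \<omega>\<bar>" unfolding T_def by (intro before_stop_time[OF s]) auto
        then have "normal_density 0 \<sigma> (X v \<omega>) \<le> normal_density 0 \<sigma> e" using e by (intro normal_density_le_tail[OF \<sigma>]) auto
        then show ?thesis using True T_bounds(3)[of \<omega>] by (auto simp: indicator_def intro: ennreal_leI)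
      next
        case False
        then show ?thesis by (auto simp: indicator_def intro: add_increasing2)
      qed
    qed
    also have "\<dots> = (\<integral>\<^sup>+v. ennreal (normal_density 0 \<sigma> (X (max 0 v) \<omega>)) * indicator {0..s} v \<partial>lborel) + ennreal (normal_density 0 \<sigma> e) * ennreal t"
      by (subst nn_integral_add) (auto simp: nn_integral_cmult_indicator)
    also have "(\<integral>\<^sup>+v. ennreal (normal_density 0 \<sigma> (X (max 0 v) \<omega>)) * indicator {0..s} v \<partial>lborel) = (\<integral>\<^sup>+v\<in>{0..s}. ennreal (normal_density 0 \<sigma> (X v \<omega>)) \<partial>lborel)"
      by (intro nn_integral_cong) (auto simp: indicator_def)
    also have "ennreal (normal_density 0 \<sigma> e) * ennreal t = ennreal (t * normal_density 0 \<sigma> e)"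
      by (simp add: ennreal_mult' mult.commute)
    finally show ?thesis .
  qed
  have "(\<integral>\<^sup>+\<omega>. ennreal (occ 0 \<sigma> (T s e t \<omega>) \<omega>) \<partial>M) \<le> (\<integral>\<^sup>+\<omega>. (\<integral>\<^sup>+v\<in>{0..s}. ennreal (normal_density 0 \<sigma> (X (max 0 v) \<omega>)) \<partial>lborel) + ennreal (t * normal_density 0 \<sigma> e) \<partial>M)"
    by (intro nn_integral_mono order_trans[OF pw] add_right_mono nn_integral_mono) (auto simp: indicator_def)
  also have "\<dots> = (\<integral>\<^sup>+\<omega>. (\<integral>\<^sup>+v\<in>{0..s}. ennreal (normal_density 0 \<sigma> (X (max 0 v) \<omega>)) \<partial>lborel) \<partial>M) + ennreal (t * normal_density 0 \<sigma> e)"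
    by (subst nn_integral_add) (auto simp: emeasure_space_1)
  also have "(\<integral>\<^sup>+\<omega>. (\<integral>\<^sup>+v\<in>{0..s}. ennreal (normal_density 0 \<sigma> (X (max 0 v) \<omega>)) \<partial>lborel) \<partial>M) = (\<integral>\<^sup>+\<omega>. (\<integral>\<^sup>+v\<in>{0..s}. ennreal (normal_density 0 \<sigma> (X v \<omega>)) \<partial>lborel) \<partial>M)"
    by (intro nn_integral_cong) (auto simp: indicator_def)
  also have "\<dots> + ennreal (t * normal_density 0 \<sigma> e) \<le> ennreal (kappa s) + ennreal (t * normal_density 0 \<sigma> e)"
    by (intro add_right_mono occupation_first_moment \<sigma> s)
  also have "\<dots> = ennreal (kappa s + t * normal_density 0 \<sigma> e)"
    using kappa_nonneg by simp
  finally have "ennreal (occT 0 \<sigma> s e t) \<le> ennreal (kappa s + t * normal_density 0 \<sigma> e)"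
    unfolding nn_integral_eq_integral[OF occ_T_integrable[OF \<sigma>] AE_I2[OF occ_nonneg]] .
  moreover have "0 \<le> kappa s + t * normal_density 0 \<sigma> e" using kappa_nonneg[of s] by simp
  ultimately show ?thesis by (simp only: ennreal_le_iff)
qed

end
end

section \<open>The expected local time at the hitting time\<close>

text \<open>Fatou's lemma, in the form used for the upper estimates.\<close>

lemma nn_integral_le_of_tendsto:
  fixes u :: "nat \<Rightarrow> 'a \<Rightarrow> real"
  assumes meas: "\<And>n. u n \<in> borel_measurable M"
    and lim: "\<And>\<omega>. (\<lambda>n. u n \<omega>) \<longlonglongrightarrow> v \<omega>"
    and le: "\<And>n. (\<integral>\<^sup>+\<omega>. ennreal (u n \<omega>) \<partial>M) \<le> ennreal (b n)" and b: "b \<longlonglongrightarrow> b'"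
  shows "(\<integral>\<^sup>+\<omega>. ennreal (v \<omega>) \<partial>M) \<le> ennreal b'"
proof -
  note [measurable] = meas
  have "(\<integral>\<^sup>+\<omega>. ennreal (v \<omega>) \<partial>M) = (\<integral>\<^sup>+\<omega>. liminf (\<lambda>n. ennreal (u n \<omega>)) \<partial>M)"
    by (intro nn_integral_cong lim_imp_Liminf [symmetric] tendsto_ennrealI lim) simp
  also have "\<dots> \<le> liminf (\<lambda>n. \<integral>\<^sup>+\<omega>. ennreal (u n \<omega>) \<partial>M)"
    by (rule nn_integral_liminf) measurable
  also have "\<dots> \<le> liminf (\<lambda>n. ennreal (b n))"
    by (intro Liminf_mono always_eventually allI le)
  also have "\<dots> = ennreal b'"
    by (intro lim_imp_Liminf tendsto_ennrealI b) simp
  finally show ?thesis .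
qed

lemma normal_density_inverse_tendsto_0:
  assumes "0 < e"
  shows "(\<lambda>j. normal_density 0 (inverse (real (Suc j))) e) \<longlonglongrightarrow> 0"
  unfolding normal_density_def using assms by real_asymp

lemma stop_time_less_mono:
  assumes s: "0 \<le> s" "s \<le> real t" and t: "t \<le> t'" and less: "stop_time w s e t < t"
  shows "stop_time w s e t' < t'"
proof -
  obtain u where u: "u \<in> insert (real t) {v. s \<le> v \<and> v \<le> real t \<and> \<bar>w v\<bar> < e}" "u < t"
    using stop_time_less_ex[OF s less] by blast
  then have "u \<in> insert (real t') {v. s \<le> v \<and> v \<le> real t' \<and> \<bar>w v\<bar> < e}" using t by auto
  then have "stop_time w s e t' \<le> u"
    unfolding stop_time_def using bdd_below_stop[of s t' w e] s t by (intro cInf_lower) auto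
  then show ?thesis using u(2) t by simp
qed

text \<open>Beyond \<open>|y|\<close> the signs of \<open>z\<close> and \<open>z - y\<close> agree,
  so both powers carry the same constant, and their difference vanishes because \<alpha> <
  1.\<close>

lemma potential_difference_tendsto_0:
  assumes \<alpha>: "0 < \<alpha>" "\<alpha> < 1"
  shows "((\<lambda>z. potential \<alpha> \<beta> (- z) - potential \<alpha> \<beta> (y - z)) \<longlongrightarrow> 0) at_infinity"
proof -
  have "((\<lambda>z. potential \<alpha> \<beta> (- z) - potential \<alpha> \<beta> (y - z)) \<longlongrightarrow> 0) at_top"
  proof (rule Lim_transform_eventually)
    have "((\<lambda>z. z powr \<alpha> - (z - y) powr \<alpha>) \<longlongrightarrow> 0) at_top"
      using \<alpha> by real_asymp
    then show "((\<lambda>z. C_const \<alpha> \<beta> * (1 - \<beta>) * (z powr \<alpha> - (z - y) powr \<alpha>)) \<longlongrightarrow> 0) at_top"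
      by (rule tendsto_mult_right_zero)
    show "\<forall>\<^sub>F z in at_top. C_const \<alpha> \<beta> * (1 - \<beta>) * (z powr \<alpha> - (z - y) powr \<alpha>) = potential \<alpha> \<beta> (- z) - potential \<alpha> \<beta> (y - z)"
      using eventually_gt_at_top[of "\<bar>y\<bar>"]
      by eventually_elim (auto simp: potential_def[OF \<alpha>] sgn_if algebra_simps)
  qed
  moreover have "((\<lambda>z. potential \<alpha> \<beta> (- z) - potential \<alpha> \<beta> (y - z)) \<longlongrightarrow> 0) at_bot"
    unfolding filterlim_at_bot_mirror
  proof (rule Lim_transform_eventually)
    have "((\<lambda>z. z powr \<alpha> - (z + y) powr \<alpha>) \<longlongrightarrow> 0) at_top"
      using \<alpha> by real_asymp
    then show "((\<lambda>z. C_const \<alpha> \<beta> * (1 + \<beta>) * (z powr \<alpha> - (z + y) powr \<alpha>)) \<longlongrightarrow> 0) at_top"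
      by (rule tendsto_mult_right_zero)
    show "\<forall>\<^sub>F z in at_top. C_const \<alpha> \<beta> * (1 + \<beta>) * (z powr \<alpha> - (z + y) powr \<alpha>) = potential \<alpha> \<beta> (- (- z)) - potential \<alpha> \<beta> (y - - z)"
      using eventually_gt_at_top[of "\<bar>y\<bar>"]
      by eventually_elim (auto simp: potential_def[OF \<alpha>] sgn_if algebra_simps)
  qed
  ultimately show ?thesis by (simp add: at_infinity_eq_at_top_bot filterlim_sup)
qed

context stable_local_times
begin

lemma L_T_measurable [measurable]:
  assumes "0 \<le> s" "s \<le> real t"
  shows "(\<lambda>\<omega>. L y (T s e t \<omega>) \<omega>) \<in> borel_measurable M"
  by (rule borel_measurable_LIMSEQ_metric[OF _ occ_tendsto[OF T_bounds(2)[OF assms]]])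
    (rule occ_T_measurable[OF assms])

context
  fixes s e :: real and t :: nat
  assumes s: "0 \<le> s" "s \<le> real t" and e: "0 < e"
begin

abbreviation "occ_err y j \<equiv> kappa s + real t * normal_density 0 (\<sigma>\<^sub>j j) e + 2 * eta y (\<sigma>\<^sub>j j)"

lemma occ_err_tendsto: "(\<lambda>j. occ_err y j) \<longlonglongrightarrow> kappa s"
proof -
  have "(\<lambda>j. occ_err y j) \<longlonglongrightarrow> kappa s + real t * 0 + 2 * 0"
    by (intro tendsto_intros eta_tendsto normal_density_inverse_tendsto_0 e)
  then show ?thesis by simp
qed

lemma occ_T_upper:
  "occT y (\<sigma>\<^sub>j j) s e t \<le> gp y x - gpT y s e t + occ_err y j"
  using occ_difference[OF s, of "\<sigma>\<^sub>j j" y e] occ_zero_bound[OF s, of "\<sigma>\<^sub>j j" e] e by simp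

lemma occ_T_lower:
  "gp y x - gpT y s e t - 2 * eta y (\<sigma>\<^sub>j j) \<le> occT y (\<sigma>\<^sub>j j) s e t"
proof -
  have "0 \<le> occT 0 (\<sigma>\<^sub>j j) s e t"
    by (intro integral_nonneg_AE AE_I2 occ_nonneg)
  then show ?thesis using occ_difference[OF s, of "\<sigma>\<^sub>j j" y e] by (simp add: abs_le_iff)
qed

text \<open>\<open>ennreal\<close> would hide a negative bound in \<open>L_T_upper\<close>; the sign
  is recorded separately because \<open>hits_eventually\<close> is drawn from it.\<close>

lemma potential_T_nonneg: "0 \<le> gp y x - gpT y s e t + kappa s"
proof (rule LIMSEQ_le_const)
  show "(\<lambda>j. gp y x - gpT y s e t + occ_err y j) \<longlonglongrightarrow> gp y x - gpT y s e t + kappa s"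
    by (intro tendsto_add tendsto_const occ_err_tendsto)
  have "0 \<le> occT y (\<sigma>\<^sub>j j) s e t" for j
    by (intro integral_nonneg_AE AE_I2 occ_nonneg)
  then show "\<exists>N. \<forall>n\<ge>N. 0 \<le> gp y x - gpT y s e t + occ_err y n"
    using occ_T_upper order_trans by blast
qed

lemma L_T_upper:
  "(\<integral>\<^sup>+\<omega>. ennreal (L y (T s e t \<omega>) \<omega>) \<partial>M) \<le> ennreal (gp y x - gpT y s e t + kappa s)"
proof (rule nn_integral_le_of_tendsto)
  show "(\<lambda>\<omega>. occ y (\<sigma>\<^sub>j j) (T s e t \<omega>) \<omega>) \<in> borel_measurable M" for j
    by (rule occ_T_measurable[OF s])
  show "(\<lambda>j. occ y (\<sigma>\<^sub>j j) (T s e t \<omega>) \<omega>) \<longlonglongrightarrow> L y (T s e t \<omega>) \<omega>" for \<omega>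
    by (rule occ_tendsto[OF T_bounds(2)[OF s]])
  show "(\<integral>\<^sup>+\<omega>. ennreal (occ y (\<sigma>\<^sub>j j) (T s e t \<omega>) \<omega>) \<partial>M)
     \<le> ennreal (gp y x - gpT y s e t + occ_err y j)" for j
    by (subst nn_integral_eq_integral[OF occ_T_integrable[OF s]]) (auto simp del: of_nat_Suc intro!: ennreal_leI occ_T_upper occ_nonneg)
  show "(\<lambda>j. gp y x - gpT y s e t + occ_err y j) \<longlonglongrightarrow> gp y x - gpT y s e t + kappa s"
    by (intro tendsto_add tendsto_const occ_err_tendsto)
qed

text \<open>With \<open>s = 0\<close> the path avoids a neighbourhood of 0 on all of
  \<open>[0, T)\<close>, so the smoothed local time at 0 disappears together with \<sigma>. The
  second moments rule out the loss of mass that Fatou's lemma would allow.\<close>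

lemma L_T_lower:
  assumes "s = 0"
  shows "ennreal (gp y x - gpT y s e t) \<le> (\<integral>\<^sup>+\<omega>. ennreal (L y (T s e t \<omega>) \<omega>) \<partial>M)"
proof (rule limit_le_nn_integral_of_bounded_second_moment)
  show "(\<lambda>\<omega>. occ y (\<sigma>\<^sub>j j) (T s e t \<omega>) \<omega>) \<in> borel_measurable M" for j
    by (rule occ_T_measurable[OF s])
  show "(\<lambda>j. occ y (\<sigma>\<^sub>j j) (T s e t \<omega>) \<omega>) \<longlonglongrightarrow> L y (T s e t \<omega>) \<omega>" for \<omega>
    by (rule occ_tendsto[OF T_bounds(2)[OF s]])
  show "integrable M (\<lambda>\<omega>. occ y (\<sigma>\<^sub>j j) (T s e t \<omega>) \<omega>)" for j
    by (rule occ_T_integrable[OF s]) simp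
  show "(\<integral>\<^sup>+\<omega>. (ennreal (occ y (\<sigma>\<^sub>j j) (T s e t \<omega>) \<omega>))\<^sup>2 \<partial>M) \<le> ennreal (2 * (kappa t)\<^sup>2)" for j
  proof -
    have "(\<integral>\<^sup>+\<omega>. (ennreal (occ y (\<sigma>\<^sub>j j) (T s e t \<omega>) \<omega>))\<^sup>2 \<partial>M) \<le> (\<integral>\<^sup>+\<omega>. (\<integral>\<^sup>+v\<in>{0..real t}. ennreal (normal_density y (\<sigma>\<^sub>j j) (X v \<omega>)) \<partial>lborel)\<^sup>2 \<partial>M)"
      by (intro nn_integral_mono power_mono ennreal_occ_le T_bounds(3)[OF s]) auto
    also have "\<dots> \<le> 2 * (ennreal (kappa t))\<^sup>2" by (rule occupation_second_moment) auto
    also have "\<dots> = ennreal (2 * (kappa t)\<^sup>2)"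
      using kappa_nonneg by (simp add: ennreal_mult' ennreal_power)
    finally show ?thesis .
  qed
  have "kappa s = 0" using assms \<alpha> by (simp add: kappa_def)
  show "(\<lambda>j. occT y (\<sigma>\<^sub>j j) s e t) \<longlonglongrightarrow> gp y x - gpT y s e t"
  proof (rule tendsto_sandwich[OF always_eventually always_eventually], rule allI, rule occ_T_lower, rule allI, rule occ_T_upper)
    show "(\<lambda>j. gp y x - gpT y s e t - 2 * eta y (\<sigma>\<^sub>j j)) \<longlonglongrightarrow> gp y x - gpT y s e t"
      using tendsto_diff[OF tendsto_const tendsto_mult[OF tendsto_const eta_tendsto[of y]], of "gp y x - gpT y s e t" 2] by simp
    show "(\<lambda>j. gp y x - gpT y s e t + occ_err y j) \<longlonglongrightarrow> gp y x - gpT y s e t"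
      using tendsto_add[OF tendsto_const occ_err_tendsto[of y], of "gp y x - gpT y s e t"] \<open>kappa s = 0\<close> by simp
  qed
qed (rule occ_nonneg)

end

lemma gp_Tm_tendsto:
  assumes s: "0 \<le> s" "s \<le> real t"
  shows "(\<lambda>m. gpTm y s t m) \<longlonglongrightarrow> gpW y s t"
proof (rule integral_dominated_convergence)
  note [measurable] = W_measurable[OF s] X_Tm_measurable0[OF s]
  show "AE \<omega> in M. (\<lambda>m. gp y (X (Tm s t m \<omega>) \<omega>)) \<longlonglongrightarrow> gp y (W s t \<omega>)"
    by (intro AE_I2 continuous_on_tendsto_compose[OF gp_continuous X_Tm_tendsto[OF s]]) auto
  show "(\<lambda>\<omega>. gp y (W s t \<omega>)) \<in> borel_measurable M" "(\<lambda>\<omega>. gp y (X (Tm s t m \<omega>) \<omega>)) \<in> borel_measurable M" for m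
    by measurable
  show "integrable M (\<lambda>_. gp_bound y)" by simp
qed (use gp_abs_le in auto)

lemma L_Tm_tendsto:
  assumes s: "0 \<le> s" "s \<le> real t"
  shows "(\<lambda>m. L y (Tm s t m \<omega>) \<omega>) \<longlonglongrightarrow> L y (S s t \<omega>) \<omega>"
proof (rule continuous_on_tendsto_compose[OF L_continuous_time[of y \<omega>] Tm_tendsto[OF s]])
  show "S s t \<omega> \<in> {0..}" using S_bounds(1)[OF s, of \<omega>] s by simp
  show "\<forall>\<^sub>F m in sequentially. Tm s t m \<omega> \<in> {0..}"
    using Tm_bounds(1)[OF s] s(1) by (auto intro!: always_eventually intro: order_trans)
qed

lemma L_S_upper:
  assumes s: "0 \<le> s" "s \<le> real t"
  shows "(\<integral>\<^sup>+\<omega>. ennreal (L y (S s t \<omega>) \<omega>) \<partial>M) \<le> ennreal (gp y x - gpW y s t + kappa s)"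
proof (rule nn_integral_le_of_tendsto)
  show "(\<lambda>\<omega>. L y (Tm s t m \<omega>) \<omega>) \<in> borel_measurable M" for m
    unfolding Tm_def by (rule L_T_measurable[OF s])
  show "(\<lambda>m. L y (Tm s t m \<omega>) \<omega>) \<longlonglongrightarrow> L y (S s t \<omega>) \<omega>" for \<omega>
    by (rule L_Tm_tendsto[OF s])
  show "(\<integral>\<^sup>+\<omega>. ennreal (L y (Tm s t m \<omega>) \<omega>) \<partial>M) \<le> ennreal (gp y x - gpTm y s t m + kappa s)" for m
    unfolding Tm_def by (rule L_T_upper[OF s]) simp
  show "(\<lambda>m. gp y x - gpTm y s t m + kappa s) \<longlonglongrightarrow> gp y x - gpW y s t + kappa s"
    by (intro tendsto_add tendsto_diff tendsto_const gp_Tm_tendsto s)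
qed

lemma potential_W_nonneg:
  assumes s: "0 \<le> s" "s \<le> real t"
  shows "0 \<le> gp y x - gpW y s t + kappa s"
proof (rule LIMSEQ_le_const)
  show "(\<lambda>m. gp y x - gpTm y s t m + kappa s) \<longlonglongrightarrow> gp y x - gpW y s t + kappa s"
    by (intro tendsto_add tendsto_diff tendsto_const gp_Tm_tendsto s)
  have "0 \<le> gp y x - gpTm y s t m + kappa s" for m
    unfolding Tm_def by (rule potential_T_nonneg[OF s]) simp
  then show "\<exists>N. \<forall>m\<ge>N. 0 \<le> gp y x - gpTm y s t m + kappa s" by blast
qed

section \<open>Almost sure approach to 0\<close>

lemma hits_mono:
  assumes "0 \<le> s" "s \<le> real t" "t \<le> t'" "hits s t \<omega>"
  shows "hits s t' \<omega>"
  using assms stop_time_less_mono[OF assms(1-3)] unfolding hits_def Tm_def T_def by blast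

lemma kern_tendsto_0: "((\<lambda>n. kern 1 (real n)) \<longlonglongrightarrow> 0)"
proof -
  have "(\<lambda>n. kern 1 (real n)) \<longlonglongrightarrow> integral\<^sup>L lborel (\<lambda>l::real. 0::real)"
    unfolding kern_def
  proof (rule integral_dominated_convergence)
    show "integrable lborel (\<lambda>l. norm (gauss 1 l))" by (intro integrable_norm integrable_gauss) simp
    show "AE l in lborel. norm (norm (gauss 1 l) * exp (- (real n * \<bar>l\<bar> powr (\<alpha> + 1)))) \<le> norm (gauss 1 l)" for n
      by (intro AE_I2) (auto intro!: mult_left_le)
    show "AE l in lborel. (\<lambda>n. norm (gauss 1 l) * exp (- (real n * \<bar>l\<bar> powr (\<alpha> + 1)))) \<longlonglongrightarrow> 0"
      using AE_lborel_singleton[of 0]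
    proof eventually_elim
      case (elim l)
      have "(\<lambda>n. exp (- (real n * a))) \<longlonglongrightarrow> 0" if "0 < a" for a :: real using that by real_asymp
      from this[of "\<bar>l\<bar> powr (\<alpha> + 1)"] show ?case using elim by (intro tendsto_mult_right_zero) simp
    qed
  qed measurable
  then show ?thesis by simp
qed

lemma gp_tendsto_0: "(gp y \<longlongrightarrow> 0) at_infinity"
  unfolding gp_def[abs_def] by (rule potential_difference_tendsto_0[OF \<alpha>])

text \<open>The law of \<open>X n\<close>, smoothed at scale 1, has density at most
  \<open>kern 1 n\<close>, which tends to 0; so \<open>X n\<close> leaves every bounded set in
  probability, and \<open>gp y\<close> is bounded and small far out.\<close>

lemma expectation_gp_tendsto_0: "(\<lambda>n. expectation (\<lambda>\<omega>. \<bar>gp y (X (real n) \<omega>)\<bar>)) \<longlonglongrightarrow> 0"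
proof (rule LIMSEQ_I)
  fix r :: real assume r: "0 < r"
  have [measurable]: "X (real n) \<in> borel_measurable M" for n by (rule X_measurable) simp
  have "\<forall>\<^sub>F z in at_infinity. dist (gp y z) 0 < r / 2"
    using gp_tendsto_0 r by (intro tendstoD) auto
  then obtain k where k: "\<And>z. k \<le> \<bar>z\<bar> \<Longrightarrow> \<bar>gp y z\<bar> < r / 2"
    by (auto simp: eventually_at_infinity)
  define K where "K = \<bar>k\<bar>"
  define q where "q = normal_density 0 1 K"
  have q: "0 < q" unfolding q_def by (rule normal_density_pos) simp
  have B0: "0 \<le> gp_bound y" using gp_abs_le[of y 0] by linarith
  have le: "expectation (\<lambda>\<omega>. \<bar>gp y (X (real n) \<omega>)\<bar>) \<le> r / 2 + gp_bound y / q * kern 1 (real n)" for n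
  proof -
    have int: "integrable M (\<lambda>\<omega>. normal_density 0 1 (X (real n) \<omega>))"
      using normal_density_le_max[of 1] by (intro integrable_const_bound[where B="normal_density 0 1 0"]) auto
    have "expectation (\<lambda>\<omega>. \<bar>gp y (X (real n) \<omega>)\<bar>) \<le> expectation (\<lambda>\<omega>. r / 2 + gp_bound y / q * normal_density 0 1 (X (real n) \<omega>))"
    proof (rule integral_mono)
      show "integrable M (\<lambda>\<omega>. \<bar>gp y (X (real n) \<omega>)\<bar>)"
        using gp_abs_le by (intro integrable_const_bound[where B="gp_bound y"]) auto
      show "integrable M (\<lambda>\<omega>. r / 2 + gp_bound y / q * normal_density 0 1 (X (real n) \<omega>))"
        by (intro Bochner_Integration.integrable_add integrable_mult_right int) simp
      fix \<omega>
      show "\<bar>gp y (X (real n) \<omega>)\<bar> \<le> r / 2 + gp_bound y / q * normal_density 0 1 (X (real n) \<omega>)"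
      proof (cases "k \<le> \<bar>X (real n) \<omega>\<bar>")
        case True
        have "0 \<le> gp_bound y / q * normal_density 0 1 (X (real n) \<omega>)" using B0 q by simp
        then show ?thesis using k[OF True] by linarith
      next
        case False
        then have "\<bar>X (real n) \<omega>\<bar> \<le> K" by (simp add: K_def)
        \<comment> \<open>The argument exceeds the mean by the position itself, so this is the
          centred density at the position.\<close>
        then have "q \<le> normal_density (X (real n) \<omega>) 1 (X (real n) \<omega> + X (real n) \<omega>)"
        proof -
          assume a: "\<bar>X (real n) \<omega>\<bar> \<le> K"
          then have "(X (real n) \<omega>)\<^sup>2 \<le> K\<^sup>2" by (simp add: abs_le_square_iff [symmetric] K_def)
          then show ?thesis unfolding q_def normal_density_def by (auto intro!: divide_right_mono)
        qed
        also have "\<dots> = normal_density 0 1 (X (real n) \<omega>)" by (simp add: normal_density_def)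
        finally have "gp_bound y / q * q \<le> gp_bound y / q * normal_density 0 1 (X (real n) \<omega>)"
          using B0 q by (intro mult_left_mono) auto
        then show ?thesis using gp_abs_le[of y "X (real n) \<omega>"] q r by simp
      qed
    qed
    also have "\<dots> = r / 2 + gp_bound y / q * expectation (\<lambda>\<omega>. normal_density 0 1 (X (real n) \<omega>))"
      using int by (simp add: prob_space)
    also have "\<dots> \<le> r / 2 + gp_bound y / q * kern 1 (real n)"
      using B0 q by (intro add_left_mono mult_left_mono expectation_normal_density_le_kern) auto
    finally show ?thesis .
  qed
  have "(\<lambda>n. r / 2 + gp_bound y / q * kern 1 (real n)) \<longlonglongrightarrow> r / 2 + gp_bound y / q * 0"
    by (intro tendsto_intros kern_tendsto_0)
  then have "\<forall>\<^sub>F n in sequentially. r / 2 + gp_bound y / q * kern 1 (real n) < r"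
    by (rule order_tendstoD(2)) (use r in simp)
  then obtain N where N: "\<And>n. N \<le> n \<Longrightarrow> r / 2 + gp_bound y / q * kern 1 (real n) < r"
    by (auto simp: eventually_sequentially)
  have "norm (expectation (\<lambda>\<omega>. \<bar>gp y (X (real n) \<omega>)\<bar>) - 0) < r" if "N \<le> n" for n
  proof -
    have "0 \<le> expectation (\<lambda>\<omega>. \<bar>gp y (X (real n) \<omega>)\<bar>)" by (intro integral_nonneg_AE) auto
    then show ?thesis using le[of n] N[OF that] by simp
  qed
  then show "\<exists>N. \<forall>n\<ge>N. norm (expectation (\<lambda>\<omega>. \<bar>gp y (X (real n) \<omega>)\<bar>) - 0) < r" by blast
qed

lemma potential_0: "potential \<alpha> \<beta> 0 = 0"
  by (simp add: potential_def[OF \<alpha>])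

context
  fixes s :: real
  assumes s01: "0 \<le> s" "s \<le> 1"
begin

lemma s_le_Suc: "s \<le> real (Suc n)"
  using s01 by simp

text \<open>Nonnegativity of the stopped potential gives \<open>\<phi>(y) (1 - p) \<le> \<phi>(-x) - \<phi>(y-x) + \<phi>(y) + \<kappa>(s)\<close> for the
  probability \<open>p\<close> of the event; divide by \<open>\<phi>(y)\<close> and let \<open>y\<close> tend to infinity on a side where \<open>\<phi>\<close> does not
  vanish (for \<open>|\<beta>| = 1\<close> there is only one).\<close>

lemma hits_eventually: "AE \<omega> in M. \<exists>n. hits s (Suc n) \<omega>"
proof -
  note [measurable] = hits_measurable[OF s01(1) s_le_Suc]
  define E where "E n = {\<omega> \<in> space M. hits s (Suc n) \<omega>}" for n
  have [measurable]: "E n \<in> sets M" for n unfolding E_def by measurable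
  have "incseq E"
  proof (rule incseq_SucI)
    show "E n \<subseteq> E (Suc n)" for n
      unfolding E_def using hits_mono[OF s01(1) s_le_Suc, of n "Suc (Suc n)"] by auto
  qed
  then have p_lim: "(\<lambda>n. prob (E n)) \<longlonglongrightarrow> prob (\<Union>n. E n)"
    by (intro finite_Lim_measure_incseq) auto
  define p where "p = prob (\<Union>n. E n)"
  \<comment> \<open>On \<open>hits\<close> the stopped value is \<open>gp y 0\<close>; off it the
    value is \<open>gp y\<close> at the horizon, whose mean modulus tends to 0.\<close>
  have main: "0 \<le> gp y x - gp y 0 * p + kappa s" for y
  proof (rule LIMSEQ_le_const)
    show "(\<lambda>n. gp y x - gp y 0 * prob (E n) + expectation (\<lambda>\<omega>. \<bar>gp y (X (real (Suc n)) \<omega>)\<bar>) + kappa s) \<longlonglongrightarrow> gp y x - gp y 0 * p + kappa s"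
      using tendsto_add[OF tendsto_add[OF tendsto_diff[OF tendsto_const tendsto_mult[OF tendsto_const p_lim]] LIMSEQ_Suc[OF expectation_gp_tendsto_0[of y]]] tendsto_const, of "gp y x" "gp y 0" "kappa s"]
      by (simp add: p_def del: of_nat_Suc)
    have "0 \<le> gp y x - gp y 0 * prob (E n) + expectation (\<lambda>\<omega>. \<bar>gp y (X (real (Suc n)) \<omega>)\<bar>) + kappa s" for n
    proof -
      have [measurable]: "X (real (Suc n)) \<in> borel_measurable M" by (rule X_measurable) simp
      have intX: "integrable M (\<lambda>\<omega>. \<bar>gp y (X (real (Suc n)) \<omega>)\<bar>)"
        using gp_abs_le by (intro integrable_const_bound[where B="gp_bound y"]) (auto simp del: of_nat_Suc)
      have intE: "integrable M (\<lambda>\<omega>. gp y 0 * indicator (E n) \<omega>)"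
        by (intro integrable_mult_right integrable_real_indicator) (auto simp: emeasure_eq_measure)
      note [measurable] = W_measurable[OF s01(1) s_le_Suc]
      have "gp y 0 * prob (E n) - expectation (\<lambda>\<omega>. \<bar>gp y (X (real (Suc n)) \<omega>)\<bar>)
         = expectation (\<lambda>\<omega>. gp y 0 * indicator (E n) \<omega> - \<bar>gp y (X (real (Suc n)) \<omega>)\<bar>)"
        using intX intE by simp
      also have "\<dots> \<le> gpW y s (Suc n)"
      proof (rule integral_mono)
        show "integrable M (\<lambda>\<omega>. gp y 0 * indicator (E n) \<omega> - \<bar>gp y (X (real (Suc n)) \<omega>)\<bar>)"
          by (intro Bochner_Integration.integrable_diff intX intE)
        show "integrable M (\<lambda>\<omega>. gp y (W s (Suc n) \<omega>))"
          using gp_abs_le by (intro integrable_const_bound[where B="gp_bound y"]) auto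
        show "gp y 0 * indicator (E n) \<omega> - \<bar>gp y (X (real (Suc n)) \<omega>)\<bar> \<le> gp y (W s (Suc n) \<omega>)" if "\<omega> \<in> space M" for \<omega>
          using that by (auto simp: W_def E_def)
      qed
      finally show ?thesis using potential_W_nonneg[OF s01(1) s_le_Suc, of y n] by linarith
    qed
    then show "\<exists>N. \<forall>n\<ge>N. 0 \<le> gp y x - gp y 0 * prob (E n) + expectation (\<lambda>\<omega>. \<bar>gp y (X (real (Suc n)) \<omega>)\<bar>) + kappa s"
      by blast
  qed
  have p: "1 \<le> p"
  proof -
    \<comment> \<open>The side of the line on which \<open>1 + \<beta> * q\<close> is at least
      1.\<close>
    define q where "q = (if 0 \<le> \<beta> then 1 else - 1 :: real)"
    define c where "c = C_const \<alpha> \<beta> * (1 + \<beta> * q)"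
    have c: "0 < c" unfolding c_def q_def using C_const_pos[OF \<alpha>, of \<beta>] by (intro mult_pos_pos) auto
    have qq: "q = 1 \<or> q = - 1" by (simp add: q_def)
    have pot: "potential \<alpha> \<beta> (q * r) = c * r powr \<alpha>" if "0 < r" for r
      using that qq by (auto simp: potential_def[OF \<alpha>] c_def abs_mult sgn_mult)
    define D where "D = potential \<alpha> \<beta> (- x) + kappa s"
    \<comment> \<open>\<open>main\<close> at \<open>y = q * r\<close>, divided by
      \<open>c * r powr \<alpha>\<close>. As \<open>r\<close> grows, the first quotient vanishes and
      the second tends to 1, which leaves \<open>1 \<le> p\<close>.\<close>
    have "\<forall>\<^sub>F r in at_top. 0 \<le> D / c / r powr \<alpha> - (r - q * x) powr \<alpha> / r powr \<alpha> + p"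
      using eventually_gt_at_top[of 0] eventually_gt_at_top[of "\<bar>x\<bar>"]
    proof eventually_elim
      case (elim r)
      have pos: "0 < r - q * x" using elim qq by auto
      have "q * r - x = q * (r - q * x)" using qq by (auto simp: algebra_simps)
      then have "0 \<le> D - c * (r - q * x) powr \<alpha> + c * r powr \<alpha> * p"
        using main[of "q * r"] pot[OF elim(1)] pot[OF pos] unfolding gp_def D_def by (simp add: potential_0)
      also have "\<dots> = (c * r powr \<alpha>) * (D / c / r powr \<alpha> - (r - q * x) powr \<alpha> / r powr \<alpha> + p)"
        using c elim(1) by (simp add: field_simps)
      finally have "0 \<le> (c * r powr \<alpha>) * (D / c / r powr \<alpha> - (r - q * x) powr \<alpha> / r powr \<alpha> + p)" .
      moreover have "0 < c * r powr \<alpha>" using c elim(1) by simp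
      ultimately show ?case unfolding zero_le_mult_iff by linarith
    qed
    moreover have "((\<lambda>r. D / c / r powr \<alpha> - (r - q * x) powr \<alpha> / r powr \<alpha> + p) \<longlongrightarrow> 0 - 1 + p) at_top"
    proof (intro tendsto_add tendsto_diff tendsto_const)
      show "((\<lambda>r. (r - q * x) powr \<alpha> / r powr \<alpha>) \<longlongrightarrow> 1) at_top" using \<alpha> by real_asymp
      have "((\<lambda>r. 1 / r powr \<alpha>) \<longlongrightarrow> 0) at_top" using \<alpha> by real_asymp
      from tendsto_mult_right_zero[OF this, of "D / c"] show "((\<lambda>r. D / c / r powr \<alpha>) \<longlongrightarrow> 0) at_top" by simp
    qed
    ultimately have "0 \<le> 0 - 1 + p" by (intro tendsto_lowerbound) auto
    then show ?thesis by simp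
  qed
  have "prob (\<Union>n. E n) = 1" using p unfolding p_def by (intro antisym prob_le_1)
  then have "AE \<omega> in M. \<omega> \<in> (\<Union>n. E n)" by (subst prob_eq_1 [symmetric]) auto
  then show ?thesis by eventually_elim (auto simp: E_def)
qed

text \<open>Almost surely \<open>hits\<close> holds from some horizon on, so \<open>W\<close> is
  eventually 0.\<close>

lemma expectation_gp_W_tendsto: "(\<lambda>n. gpW y s (Suc n)) \<longlonglongrightarrow> gp y 0"
proof -
  have "(\<lambda>n. gpW y s (Suc n)) \<longlonglongrightarrow> expectation (\<lambda>\<omega>. gp y 0)"
  proof (rule integral_dominated_convergence)
    note [measurable] = W_measurable[OF s01(1) s_le_Suc]
    show "AE \<omega> in M. (\<lambda>n. gp y (W s (Suc n) \<omega>)) \<longlonglongrightarrow> gp y 0"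
      using hits_eventually
    proof eventually_elim
      case (elim \<omega>)
      then obtain N where N: "hits s (Suc N) \<omega>" by blast
      have "gp y (W s (Suc n) \<omega>) = gp y 0" if "N \<le> n" for n
        using hits_mono[OF s01(1) s_le_Suc, of N "Suc n" \<omega>] that N by (simp add: W_def)
      then show ?case by (intro tendsto_eventually) (auto simp: eventually_sequentially)
    qed
    show "integrable M (\<lambda>_. gp_bound y)" by simp
    show "(\<lambda>\<omega>. gp y (W s (Suc n) \<omega>)) \<in> borel_measurable M" for n by measurable
  qed (use gp_abs_le in auto)
  then show ?thesis by (simp add: prob_space)
qed

end

section \<open>The expected local time from above and from below\<close>

lemma potential_value_nonneg: "0 \<le> gp y x - gp y 0"
proof (rule LIMSEQ_le_const)
  show "(\<lambda>n. gp y x - gpW y 0 (Suc n) + kappa 0) \<longlonglongrightarrow> gp y x - gp y 0"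
    using tendsto_add[OF tendsto_diff[OF tendsto_const expectation_gp_W_tendsto[of 0 y]] tendsto_const, of "gp y x" "kappa 0"] \<alpha>
    by (simp add: kappa_def)
qed (use potential_W_nonneg[of 0 "Suc n" y for n] in auto)

text \<open>For \<open>s > 0\<close> the limit \<open>S\<close> is a strictly positive zero of the
  path once \<open>hits\<close> holds, so the hitting time is at most \<open>S\<close> and
  monotonicity of \<open>L\<close> applies. With \<open>s = 0\<close> and \<open>x = 0\<close> one
  would get \<open>S = 0\<close>, which is not counted as a hit.\<close>

lemma expected_local_time_at_hitting_le:
  "hitL y \<le> ennreal (gp y x - gp y 0)"
proof (rule tendsto_lowerbound)
  have "((\<lambda>s. gp y x - gp y 0 + kappa s) \<longlongrightarrow> gp y x - gp y 0 + 0) (at_right 0)"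
  proof (intro tendsto_add tendsto_const)
    show "(kappa \<longlongrightarrow> 0) (at_right 0)"
      unfolding kappa_def[abs_def] using \<alpha> by real_asymp
  qed
  then show "((\<lambda>s. ennreal (gp y x - gp y 0 + kappa s)) \<longlongrightarrow> ennreal (gp y x - gp y 0)) (at_right 0)"
    by (intro tendsto_ennrealI) simp
  have le: "hitL y \<le> ennreal (gp y x - gp y 0 + kappa s)" if s: "0 < s" "s \<le> 1" for s
  proof -
    have s0: "0 \<le> s" using s by simp
    have sn: "s \<le> real (Suc n)" for n using s by simp
    have "AE \<omega> in M. \<forall>n. hits s (Suc n) \<omega> \<longrightarrow> X (S s (Suc n) \<omega>) \<omega> = 0"
      unfolding AE_all_countable using quasi_left_continuity[OF s0 sn] by blast
    with hits_eventually[OF s0 s(2)]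
    have "AE \<omega> in M. local_time_at L y (hitting_time X 0) \<omega> \<le> liminf (\<lambda>n. ennreal (L y (S s (Suc n) \<omega>) \<omega>))"
    proof eventually_elim
      case (elim \<omega>)
      then obtain N where N: "hits s (Suc N) \<omega>" by blast
      have "local_time_at L y (hitting_time X 0) \<omega> \<le> ennreal (L y (S s (Suc n) \<omega>) \<omega>)" if "N \<le> n" for n
      proof -
        have "hits s (Suc n) \<omega>" using hits_mono[OF s0 sn, of N "Suc n" \<omega>] that N by simp
        then have zero: "X (S s (Suc n) \<omega>) \<omega> = 0" using elim by blast
        have pos: "0 < S s (Suc n) \<omega>" using S_bounds(1)[OF s0 sn, of n \<omega>] s by simp
        have "hitting_time X 0 \<omega> \<le> ennreal (S s (Suc n) \<omega>)"
          unfolding hitting_time_def using zero pos by (intro INF_lower) auto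
        then show ?thesis unfolding local_time_at_def
          using pos by (intro SUP_least ennreal_leI L_mono) (auto dest: order_trans)
      qed
      then show ?case by (intro Liminf_bounded) (auto simp: eventually_sequentially)
    qed
    then have "hitL y \<le> (\<integral>\<^sup>+\<omega>. liminf (\<lambda>n. ennreal (L y (S s (Suc n) \<omega>) \<omega>)) \<partial>M)"
      by (rule nn_integral_mono_AE)
    also have "\<dots> \<le> liminf (\<lambda>n. \<integral>\<^sup>+\<omega>. ennreal (L y (S s (Suc n) \<omega>) \<omega>) \<partial>M)"
    proof (rule nn_integral_liminf)
      show "(\<lambda>\<omega>. ennreal (L y (S s (Suc n) \<omega>) \<omega>)) \<in> borel_measurable M" for n
      proof (intro measurable_compose[OF _ measurable_ennreal] borel_measurable_LIMSEQ_metric[OF _ L_Tm_tendsto[OF s0 sn]])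
        show "(\<lambda>\<omega>. L y (Tm s (Suc n) m \<omega>) \<omega>) \<in> borel_measurable M" for m
          unfolding Tm_def by (rule L_T_measurable[OF s0 sn])
      qed
    qed
    also have "\<dots> \<le> liminf (\<lambda>n. ennreal (gp y x - gpW y s (Suc n) + kappa s))"
      by (intro Liminf_mono always_eventually allI L_S_upper s0 sn)
    also have "\<dots> = ennreal (gp y x - gp y 0 + kappa s)"
      by (intro lim_imp_Liminf tendsto_ennrealI tendsto_add tendsto_diff tendsto_const expectation_gp_W_tendsto s0 s(2)) simp
    finally show ?thesis .
  qed
  show "\<forall>\<^sub>F s in at_right 0. hitL y \<le> ennreal (gp y x - gp y 0 + kappa s)"
    unfolding eventually_at_right_field using le by (intro exI[of _ 1]) auto
qed simp

text \<open>Before \<open>Tm\<close> the path keeps distance \<open>1 / (m + 1)\<close> from 0, so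
  no zero precedes \<open>Tm\<close> and the hitting time is at least \<open>Tm\<close>, for every
  path. Here \<open>s = 0\<close> is right, and for \<open>x = 0\<close> the left side is 0.\<close>

lemma expected_local_time_at_hitting_ge:
  "ennreal (gp y x - gp y 0) \<le> hitL y"
proof (rule LIMSEQ_le_const2)
  show "(\<lambda>n. ennreal (gp y x - gpW y 0 (Suc n))) \<longlonglongrightarrow> ennreal (gp y x - gp y 0)"
    by (intro tendsto_ennrealI tendsto_diff tendsto_const expectation_gp_W_tendsto) auto
  have "ennreal (gp y x - gpW y 0 (Suc n)) \<le> hitL y" for n
  proof (rule LIMSEQ_le_const2)
    have n: "(0::real) \<le> 0" "0 \<le> real (Suc n)" by auto
    show "(\<lambda>m. ennreal (gp y x - gpTm y 0 (Suc n) m)) \<longlonglongrightarrow> ennreal (gp y x - gpW y 0 (Suc n))"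
      by (intro tendsto_ennrealI tendsto_diff tendsto_const gp_Tm_tendsto n)
    have "ennreal (gp y x - gpTm y 0 (Suc n) m) \<le> hitL y" for m
    proof -
      have "ennreal (gp y x - gpTm y 0 (Suc n) m) \<le> (\<integral>\<^sup>+\<omega>. ennreal (L y (Tm 0 (Suc n) m \<omega>) \<omega>) \<partial>M)"
        unfolding Tm_def by (rule L_T_lower[OF n]) auto
      also have "\<dots> \<le> hitL y"
      proof (intro nn_integral_mono)
        fix \<omega>
        have nn: "0 \<le> Tm 0 (Suc n) m \<omega>" by (rule Tm_bounds(1)[OF n])
        have "Tm 0 (Suc n) m \<omega> \<le> v" if "0 < v" "X v \<omega> = 0" for v
        proof (rule ccontr)
          assume "\<not> ?thesis"
          then have "inverse (real (Suc m)) \<le> \<bar>X v \<omega>\<bar>"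
            using that(1) before_stop_time[OF n, of v "\<lambda>v. X v \<omega>" "inverse (real (Suc m))"] unfolding Tm_def T_def by simp
          then show False using that(2) by (simp del: of_nat_Suc)
        qed
        then have "ennreal (Tm 0 (Suc n) m \<omega>) \<le> hitting_time X 0 \<omega>"
          unfolding hitting_time_def by (intro INF_greatest ennreal_leI) auto
        then show "ennreal (L y (Tm 0 (Suc n) m \<omega>) \<omega>) \<le> local_time_at L y (hitting_time X 0) \<omega>"
          unfolding local_time_at_def using nn by (intro SUP_upper) auto
      qed
      finally show ?thesis .
    qed
    then show "\<exists>N. \<forall>m\<ge>N. ennreal (gp y x - gpTm y 0 (Suc n) m) \<le> hitL y"
      by blast
  qed
  then show "\<exists>N. \<forall>n\<ge>N. ennreal (gp y x - gpW y 0 (Suc n)) \<le> hitL y"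
    by blast
qed

lemma expected_local_time_at_hitting:
  "hitL y
     = ennreal (potential \<alpha> \<beta> (- x) + potential \<alpha> \<beta> y - potential \<alpha> \<beta> (y - x))"
  "0 \<le> potential \<alpha> \<beta> (- x) + potential \<alpha> \<beta> y - potential \<alpha> \<beta> (y - x)"
proof -
  have "gp y x - gp y 0 = potential \<alpha> \<beta> (- x) + potential \<alpha> \<beta> y - potential \<alpha> \<beta> (y - x)"
    by (simp add: gp_def potential_0)
  then show "hitL y
     = ennreal (potential \<alpha> \<beta> (- x) + potential \<alpha> \<beta> y - potential \<alpha> \<beta> (y - x))"
    and "0 \<le> potential \<alpha> \<beta> (- x) + potential \<alpha> \<beta> y - potential \<alpha> \<beta> (y - x)"
    using expected_local_time_at_hitting_le[of y] expected_local_time_at_hitting_ge[of y] potential_value_nonneg[of y]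
    by (auto intro: antisym)
qed

end

text \<open>The almost sure path properties are made to hold everywhere by replacing each path in a null set
  by one fixed good path.\<close>

lemma u_T0_stable:
  assumes \<alpha>: "0 < \<alpha>" "\<alpha> < 1"
    and family: "levy_family P X (stable_exponent \<alpha> \<beta>)"
    and local: "local_times (P x) X L"
  shows "u_T0 P X L x y = ennreal (potential \<alpha> \<beta> (- x) + potential \<alpha> \<beta> y - potential \<alpha> \<beta> (y - x))"
    and "0 \<le> potential \<alpha> \<beta> (- x) + potential \<alpha> \<beta> y - potential \<alpha> \<beta> (y - x)"
proof -
  define M where "M = P x"
  have levy: "levy_process M X x"
    and char: "char (distr M borel (\<lambda>\<omega>. X t \<omega> - X 0 \<omega>)) \<theta> = exp (- complex_of_real t * stable_exponent \<alpha> \<beta> \<theta>)" if "0 \<le> t" for t \<theta>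
    using family that by (simp_all add: levy_family_def M_def)
  have levy: "levy_process M X x" using levy[of 0] by simp
  interpret prob_space M using levy by (simp add: levy_process_def)
  have X_meas: "X t \<in> borel_measurable M" if "0 \<le> t" for t using levy that by (simp add: levy_process_def)
  define good where "good \<omega> \<longleftrightarrow> X 0 \<omega> = x \<and> cadlag (\<lambda>t. X t \<omega>) \<and>
      (\<forall>y. \<forall>t\<ge>0. 0 \<le> L y t \<omega>) \<and> continuous_on (UNIV \<times> {0..}) (\<lambda>(y, t). L y t \<omega>) \<and>
      (\<forall>t\<ge>0. \<forall>A\<in>sets borel. emeasure lborel {s \<in> {0..t}. X s \<omega> \<in> A} = (\<integral>\<^sup>+y\<in>A. ennreal (L y t \<omega>) \<partial>lborel))" for \<omega>
  have "AE \<omega> in M. good \<omega>"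
    using levy local unfolding levy_process_def local_times_def good_def M_def by auto
  then obtain N where N: "{\<omega> \<in> space M. \<not> good \<omega>} \<subseteq> N" "emeasure M N = 0" "N \<in> sets M"
    by (rule AE_E)
  have "N \<noteq> space M" using N(2) emeasure_space_1 by auto
  then obtain \<omega>\<^sub>0 where \<omega>\<^sub>0: "\<omega>\<^sub>0 \<in> space M - N" using sets.sets_into_space[OF N(3)] by blast
  define c where "c \<omega> = (if \<omega> \<in> space M - N then \<omega> else \<omega>\<^sub>0)" for \<omega>
  have c_good: "good (c \<omega>)" for \<omega> using \<omega>\<^sub>0 N(1) by (auto simp: c_def)
  have c_meas [measurable]: "c \<in> M \<rightarrow>\<^sub>M M"
    unfolding c_def[abs_def] by (intro measurable_If_set measurable_ident measurable_const) (use N(3) \<omega>\<^sub>0 in auto)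
  have c_AE: "AE \<omega> in M. c \<omega> = \<omega>"
    using AE_not_in[of N M] AE_space N(2,3) by (auto simp: c_def null_sets_def elim!: eventually_elim2)
  interpret stable_local_times M "\<lambda>t \<omega>. X t (c \<omega>)" x \<alpha> \<beta> "\<lambda>y t \<omega>. L y t (c \<omega>)"
  proof
    show "(\<lambda>\<omega>. X t (c \<omega>)) \<in> borel_measurable M" if "0 \<le> t" for t
      by (rule measurable_compose[OF c_meas X_meas[OF that]])
    fix ts :: "nat \<Rightarrow> real" and ch :: "nat \<Rightarrow> real \<Rightarrow> real" and k l
    assume ts: "mono ts" "ts 0 = (0::real)" and ch [measurable]: "\<And>i. ch i \<in> borel_measurable borel" and ch1: "\<And>i z. \<bar>ch i z\<bar> \<le> 1"
    have ts_nonneg: "0 \<le> ts i" for i using ts monoD[OF ts(1), of 0 i] by simp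
    have [measurable]: "X (ts i) \<in> borel_measurable M" "(\<lambda>\<omega>. X (ts i) (c \<omega>)) \<in> borel_measurable M" for i
      using X_meas[OF ts_nonneg] measurable_compose[OF c_meas X_meas[OF ts_nonneg]] by auto
    \<comment> \<open>Only expectations at fixed times are compared, so it is enough that
      \<open>c\<close> is almost surely the identity.\<close>
    have eq: "expectation (\<lambda>\<omega>. of_real (\<Prod>i\<le>k. ch i (X (ts i) (c \<omega>))) * iexp (l * X (ts j) (c \<omega>)))
        = expectation (\<lambda>\<omega>. of_real (\<Prod>i\<le>k. ch i (X (ts i) \<omega>)) * iexp (l * X (ts j) \<omega>))" for j
    proof (rule integral_cong_AE)
      show "AE \<omega> in M. of_real (\<Prod>i\<le>k. ch i (X (ts i) (c \<omega>))) * iexp (l * X (ts j) (c \<omega>))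
          = of_real (\<Prod>i\<le>k. ch i (X (ts i) \<omega>)) * iexp (l * X (ts j) \<omega>)"
        using c_AE by eventually_elim simp
    qed measurable
    show "expectation (\<lambda>\<omega>. of_real (\<Prod>i\<le>k. ch i (X (ts i) (c \<omega>))) * iexp (l * X (ts (Suc k)) (c \<omega>)))
       = exp (- complex_of_real (ts (Suc k) - ts k) * stable_exponent \<alpha> \<beta> l) *
         expectation (\<lambda>\<omega>. of_real (\<Prod>i\<le>k. ch i (X (ts i) (c \<omega>))) * iexp (l * X (ts k) (c \<omega>)))"
      unfolding eq by (rule levy_process_markov[OF levy char ts ch ch1])
  qed (use c_good \<alpha> in \<open>auto simp: good_def\<close>)
  have "u_T0 P X L x y = (\<integral>\<^sup>+\<omega>. local_time_at (\<lambda>y t \<omega>. L y t (c \<omega>)) y (hitting_time (\<lambda>t \<omega>. X t (c \<omega>)) 0) \<omega> \<partial>M)"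
    unfolding u_T0_def M_def [symmetric]
  proof (rule nn_integral_cong_AE)
    show "AE \<omega> in M. local_time_at L y (hitting_time X 0) \<omega>
       = local_time_at (\<lambda>y t \<omega>. L y t (c \<omega>)) y (hitting_time (\<lambda>t \<omega>. X t (c \<omega>)) 0) \<omega>"
      using c_AE by eventually_elim (simp add: local_time_at_def hitting_time_def)
  qed
  then show "u_T0 P X L x y = ennreal (potential \<alpha> \<beta> (- x) + potential \<alpha> \<beta> y - potential \<alpha> \<beta> (y - x))"
    and "0 \<le> potential \<alpha> \<beta> (- x) + potential \<alpha> \<beta> y - potential \<alpha> \<beta> (y - x)"
    using expected_local_time_at_hitting[of y] by simp_all
qed

theorem lemma5p3:
  fixes \<alpha> \<beta> :: real
    and P :: "real \<Rightarrow> 'a measure"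
    and X :: "real \<Rightarrow> 'a \<Rightarrow> real"
    and L :: "real \<Rightarrow> real \<Rightarrow> 'a \<Rightarrow> real"
    and u R H :: "real \<Rightarrow> real \<Rightarrow> real"
  assumes "0 < \<alpha>" and "\<alpha> < 1" and "\<bar>\<beta>\<bar> \<le> 1"
    and "levy_family P X (stable_exponent \<alpha> \<beta>)"
    and "\<And>x. local_times (P x) X L"
  defines "u \<equiv> \<lambda>x y. enn2real (u_T0 P X L x y)"
  defines "R \<equiv> sym_part u"
    and "H \<equiv> antisym_part u"
  shows "C_const \<alpha> \<beta> > 0 \<and>
    (\<forall>x y.
       u_T0 P X L x y < \<infinity> \<and>
       R x y = C_const \<alpha> \<beta> *
         (\<bar>x\<bar> powr \<alpha> + \<bar>y\<bar> powr \<alpha> - \<bar>x - y\<bar> powr \<alpha>) \<and>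
       H x y = - \<beta> * C_const \<alpha> \<beta> *
         (sgn x * \<bar>x\<bar> powr \<alpha> - sgn y * \<bar>y\<bar> powr \<alpha> - sgn (x - y) * \<bar>x - y\<bar> powr \<alpha>) \<and>
       u x y = C_const \<alpha> \<beta> *
         ((1 - \<beta> * sgn x) * \<bar>x\<bar> powr \<alpha> + (1 - \<beta> * sgn (- y)) * \<bar>y\<bar> powr \<alpha>
           - (1 - \<beta> * sgn (x - y)) * \<bar>x - y\<bar> powr \<alpha>))"
proof -
  note \<alpha> = assms(1,2)
  note u_T0 = u_T0_stable[OF \<alpha> assms(4,5)]
  have sgn_swap: "sgn (y - x) = - sgn (x - y)" for x y :: real
    using sgn_minus[of "x - y"] by simp
  \<comment> \<open>The sign from \<open>u_T0_stable\<close> is needed because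
    \<open>enn2real\<close> after \<open>ennreal\<close> truncates at 0.\<close>
  have u0: "u x y = potential \<alpha> \<beta> (- x) + potential \<alpha> \<beta> y - potential \<alpha> \<beta> (y - x)" for x y
    using u_T0(2)[of x y] by (simp add: u_def u_T0(1))
  have u: "u x y = C_const \<alpha> \<beta> *
         ((1 - \<beta> * sgn x) * \<bar>x\<bar> powr \<alpha> + (1 - \<beta> * sgn (- y)) * \<bar>y\<bar> powr \<alpha>
           - (1 - \<beta> * sgn (x - y)) * \<bar>x - y\<bar> powr \<alpha>)" for x y
    unfolding u0 potential_def[OF \<alpha>] sgn_swap[of y x] abs_minus_commute[of y x] sgn_minus abs_minus_cancel
    by (simp add: algebra_simps)
  \<comment> \<open>Exchanging \<open>x\<close> and \<open>y\<close> fixes the three powers and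
    reverses the combination that carries \<beta>.\<close>
  have "R x y = C_const \<alpha> \<beta> * (\<bar>x\<bar> powr \<alpha> + \<bar>y\<bar> powr \<alpha> - \<bar>x - y\<bar> powr \<alpha>)"
    and "H x y = - \<beta> * C_const \<alpha> \<beta> *
         (sgn x * \<bar>x\<bar> powr \<alpha> - sgn y * \<bar>y\<bar> powr \<alpha> - sgn (x - y) * \<bar>x - y\<bar> powr \<alpha>)" for x y
    unfolding R_def H_def sym_part_def antisym_part_def u sgn_minus sgn_swap[of y x] abs_minus_commute[of y x]
    by (simp_all add: field_simps)
  moreover have "u_T0 P X L x y < \<infinity>" for x y by (simp add: u_T0(1))
  ultimately show ?thesis using C_const_pos[OF \<alpha>] u by blast
qed

end
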